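(* Let $\mathbb{H}_3$ be the Heisenberg group of real matrices $q=\begin{pmatrix}1&x_1&x_3\\0&1&x_2\\0&0&1\end{pmatrix}$, with identity $1$ (i.e. $x_1=x_2=x_3=0$). Let $\Omega\subset\mathbb{R}^2$ be a compact convex set with $0\in\operatorname{int}\Omega$, let $m>0$, $M>0$, and let $f:[-m,M]\to\mathbb{R}$ be continuous, concave, and positive on $(-m,M)$. Let $$U=\Bigl\{u=\begin{pmatrix}0&u_1&u_3\\0&0&u_2\\0&0&0\end{pmatrix}:\ u_3\in[-m,M],\ \exists\,\omega\in\Omega\ \text{with}\ (u_1,u_2)=f(u_3)\,\omega\Bigr\}.$$ Consider the time-optimal problem $T\to\min$, $q(0)=1$, $q(T)=q_1$, $\dot q=q\cdot u$, $u(t)\in U$, i.e. $\dot x_1=u_1$, $\dot x_2=u_2$, $\dot x_3=u_3+x_1u_2$. Its Pontryagin extremals, written in left-trivialized covector coordinates $h=(h_1,h_2,h_3)$ (where $h=dL_q^*p$ is paired with $u$ via $h_1u_1+h_2u_2+h_3u_3$), satisfy $h(t)\neq0$ and, for a.e. $t$, $$\dot h_1=-h_3u_2,\quad \dot h_2=h_3u_1,\quad \dot h_3=0,\quad u\in\operatorname{argmax}_{v\in U}(v_1h_1+v_2h_2+v_3h_3).$$ Then $A=\mu_{\Omega^\circ}(h_1,h_2)\ge0$ and $h_3\in\mathbb{R}$ are constant along every extremal, with $A^2+h_3^2\neq0$, and the projections of extremals starting at $t=0$ at the identity are as follows: 1) If $A=0$, then $x_1(t)\equiv x_2(t)\equiv0$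 and either $x_3(t)=-mt$ or $x_3(t)=Mt$. 2) If $A\neq0$ and $h_3=0$, then $$x_1(t)=W\int_0^t\cos_\Omega\theta(s)\,ds,\quad x_2(t)=W\int_0^t\sin_\Omega\theta(s)\,ds,\quad x_3(t)=\int_0^t\bigl(u_3(s)+Wx_1(s)\sin_\Omega\theta(s)\bigr)ds,$$ where $\eta_0\in\mathbb{R}$ is a constant, $W=\max_{v\in[-m,M]}f(v)$, and $\theta(t)\in{}^\circ\eta_0$, $u_3(t)\in\operatorname{argmax}_{v\in[-m,M]}f(v)$ are measurable functions. 3) If $A\neq0$ and $h_3\neq0$, then $$x_1(t)=\frac{A}{h_3}\bigl(\sin_{\Omega^\circ}\eta(t)-\sin_{\Omega^\circ}\eta_0\bigr),\qquad x_2(t)=\frac{A}{h_3}\bigl(-\cos_{\Omega^\circ}\eta(t)+\cos_{\Omega^\circ}\eta_0\bigr),$$ $$x_3(t)=\frac{H}{h_3}t-\frac12\frac{A^2}{h_3^2}(\eta(t)-\eta_0)+\frac12\frac{A^2}{h_3^2}\Bigl(2\cos_{\Omega^\circ}\eta(t)\sin_{\Omega^\circ}\eta_0-\cos_{\Omega^\circ}\eta(t)\sin_{\Omega^\circ}\eta(t)-\cos_{\Omega^\circ}\eta_0\sin_{\Omega^\circ}\eta_0\Bigr),$$ where $H=\max_{v\in[-m,M]}(Af(v)+h_3v)$ is constant, $\eta(t)=\eta_0+\frac{Hh_3}{A^2}t-\frac{h_3^2}{A^2}\int_0^tu_3(s)\,ds$ for some constant $\eta_0\in\mathbb{R}$ and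 a measurable function $u_3(t)\in\operatorname{argmax}_{v\in[-m,M]}(Af(v)+h_3v)$. Conversely, every curve listed in 1), 2) or 3) is the projection of a solution of the Pontryagin maximum principle.
   Context: Polar set: $\Omega^\circ=\{(p,q)\in\mathbb{R}^{2*}: px+qy\le1\ \forall (x,y)\in\Omega\}$; it is again compact convex with $0$ in its interior. $\mu_{\Omega^\circ}(h_1,h_2)=\inf\{\lambda>0:(h_1,h_2)\in\lambda\Omega^\circ\}$ is its Minkowski functional. Convex trigonometric functions: for a compact convex $\Omega$ with $0$ in its interior and area $S(\Omega)$, and $\theta\in[0,2S(\Omega))$, $(\cos_\Omega\theta,\sin_\Omega\theta)$ is the point $P\in\partial\Omega$ such that the area of the sector of $\Omega$ swept counterclockwise from the ray $Ox$ (positive $x$-axis) to the ray $OP$ equals $\theta/2$; these functions are extended $2S(\Omega)$-periodically to all $\theta\in\mathbb{R}$. The functions $\cos_{\Omega^\circ},\sin_{\Omega^\circ}$ are defined in the same way from $\Omega^\circ$. For angles $\theta,\eta$ one always has $\cos_{\Omega^\circ}\eta\cos_\Omega\theta+\sin_{\Omega^\circ}\eta\sin_\Omega\theta\le1$; ${}^\circ\eta$ denotes the set of $\theta$ for which equality holds (equivalently, the line $\{px+qy=1\}$ with $(p,q)=(\cos_{\Omega^\circ}\eta,\sin_{\Omega^\circ}\eta)$ supports $\Omega$ at $(\cos_\Omega\theta,\sin_\Omega\theta)$). *)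

theory Defs
  imports "HOL-Analysis.Analysis"
begin

definition ang :: "real \<times> real \<Rightarrow> real" where
  "ang z = (let a = Arg (Complex (fst z) (snd z)) in if a < 0 then a + 2 * pi else a)"

definition sector :: "(real \<times> real) set \<Rightarrow> real \<Rightarrow> (real \<times> real) set" where
  "sector \<Omega> \<phi> = {z \<in> \<Omega>. z = 0 \<or> ang z \<le> \<phi>}"

definition cvx_cossin :: "(real \<times> real) set \<Rightarrow> real \<Rightarrow> real \<times> real" where
  "cvx_cossin \<Omega> \<theta> =
     (let S = measure lborel \<Omega>;
          \<theta>' = \<theta> - 2 * S * of_int (floor (\<theta> / (2 * S)))
      in THE P. P \<in> frontier \<Omega> \<and> measure lborel (sector \<Omega> (ang P)) = \<theta>' / 2)"

definition cos_cvx :: "(real \<times> real) set \<Rightarrow> real \<Rightarrow> real" where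
  "cos_cvx \<Omega> \<theta> = fst (cvx_cossin \<Omega> \<theta>)"

definition sin_cvx :: "(real \<times> real) set \<Rightarrow> real \<Rightarrow> real" where
  "sin_cvx \<Omega> \<theta> = snd (cvx_cossin \<Omega> \<theta>)"

definition polar :: "(real \<times> real) set \<Rightarrow> (real \<times> real) set" where
  "polar \<Omega> = {(p, q). \<forall>(x, y) \<in> \<Omega>. p * x + q * y \<le> 1}"

definition mink :: "(real \<times> real) set \<Rightarrow> real \<times> real \<Rightarrow> real" where
  "mink K h = Inf {r. r > 0 \<and> h \<in> (\<lambda>z. r *\<^sub>R z) ` K}"

definition circ_set :: "(real \<times> real) set \<Rightarrow> real \<Rightarrow> real set" where
  "circ_set \<Omega> \<eta> = {\<theta>. cos_cvx (polar \<Omega>) \<eta> * cos_cvx \<Omega> \<theta> + sin_cvx (polar \<Omega>) \<eta> * sin_cvx \<Omega> \<theta> = 1}"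

definition argmax_on :: "real set \<Rightarrow> (real \<Rightarrow> real) \<Rightarrow> real set" where
  "argmax_on S g = {v \<in> S. \<forall>w \<in> S. g w \<le> g v}"

definition Uset :: "(real \<times> real) set \<Rightarrow> (real \<Rightarrow> real) \<Rightarrow> real \<Rightarrow> real \<Rightarrow> (real \<times> real \<times> real) set" where
  "Uset \<Omega> f m M = {(u1, u2, u3). u3 \<in> {-m..M} \<and> (\<exists>\<omega> \<in> \<Omega>. (u1, u2) = f u3 *\<^sub>R \<omega>)}"

(* Pontryagin extremal on [0,T] starting at the identity (x(0) = 0); trajectories are
   Caratheodory solutions written in integral form. *)
definition pmp_extremal ::
  "(real \<times> real) set \<Rightarrow> (real \<Rightarrow> real) \<Rightarrow> real \<Rightarrow> real \<Rightarrow> real \<Rightarrow>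
   (real \<Rightarrow> real) \<Rightarrow> (real \<Rightarrow> real) \<Rightarrow> (real \<Rightarrow> real) \<Rightarrow>
   (real \<Rightarrow> real) \<Rightarrow> (real \<Rightarrow> real) \<Rightarrow> (real \<Rightarrow> real) \<Rightarrow>
   (real \<Rightarrow> real) \<Rightarrow> (real \<Rightarrow> real) \<Rightarrow> (real \<Rightarrow> real) \<Rightarrow> bool" where
  "pmp_extremal \<Omega> f m M T x1 x2 x3 h1 h2 h3 u1 u2 u3 \<longleftrightarrow>
     u1 measurable_on {0..T} \<and> u2 measurable_on {0..T} \<and> u3 measurable_on {0..T} \<and>
     (AE t in lborel. t \<in> {0..T} \<longrightarrow>
        (u1 t, u2 t, u3 t) \<in> Uset \<Omega> f m M \<and>
        (\<forall>(v1, v2, v3) \<in> Uset \<Omega> f m M.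
            v1 * h1 t + v2 * h2 t + v3 * h3 t \<le> u1 t * h1 t + u2 t * h2 t + u3 t * h3 t)) \<and>
     (\<forall>t \<in> {0..T}.
        x1 t = integral {0..t} u1 \<and>
        x2 t = integral {0..t} u2 \<and>
        x3 t = integral {0..t} (\<lambda>s. u3 s + x1 s * u2 s) \<and>
        h1 t = h1 0 - integral {0..t} (\<lambda>s. h3 s * u2 s) \<and>
        h2 t = h2 0 + integral {0..t} (\<lambda>s. h3 s * u1 s) \<and>
        h3 t = h3 0 \<and>
        (h1 t, h2 t, h3 t) \<noteq> (0, 0, 0))"

definition curve1 :: "real \<Rightarrow> real \<Rightarrow> real \<Rightarrow> (real \<Rightarrow> real) \<Rightarrow> (real \<Rightarrow> real) \<Rightarrow> (real \<Rightarrow> real) \<Rightarrow> bool" where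
  "curve1 m M T x1 x2 x3 \<longleftrightarrow>
     (\<forall>t \<in> {0..T}. x1 t = 0 \<and> x2 t = 0) \<and>
     ((\<forall>t \<in> {0..T}. x3 t = - m * t) \<or> (\<forall>t \<in> {0..T}. x3 t = M * t))"

definition curve2 :: "(real \<times> real) set \<Rightarrow> (real \<Rightarrow> real) \<Rightarrow> real \<Rightarrow> real \<Rightarrow> real \<Rightarrow>
    (real \<Rightarrow> real) \<Rightarrow> (real \<Rightarrow> real) \<Rightarrow> (real \<Rightarrow> real) \<Rightarrow> bool" where
  "curve2 \<Omega> f m M T x1 x2 x3 \<longleftrightarrow>
     (let W = (SUP v \<in> {-m..M}. f v) in
      \<exists>\<eta>0 \<theta> v3. \<theta> measurable_on {0..T} \<and> v3 measurable_on {0..T} \<and>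
        (\<forall>t \<in> {0..T}. \<theta> t \<in> circ_set \<Omega> \<eta>0 \<and> v3 t \<in> argmax_on {-m..M} f) \<and>
        (\<forall>t \<in> {0..T}.
           x1 t = W * integral {0..t} (\<lambda>s. cos_cvx \<Omega> (\<theta> s)) \<and>
           x2 t = W * integral {0..t} (\<lambda>s. sin_cvx \<Omega> (\<theta> s)) \<and>
           x3 t = integral {0..t} (\<lambda>s. v3 s + W * x1 s * sin_cvx \<Omega> (\<theta> s))))"

definition curve3 :: "(real \<times> real) set \<Rightarrow> (real \<Rightarrow> real) \<Rightarrow> real \<Rightarrow> real \<Rightarrow> real \<Rightarrow> real \<Rightarrow> real \<Rightarrow>
    (real \<Rightarrow> real) \<Rightarrow> (real \<Rightarrow> real) \<Rightarrow> (real \<Rightarrow> real) \<Rightarrow> bool" where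
  "curve3 \<Omega> f m M A h3 T x1 x2 x3 \<longleftrightarrow>
     (let H = (SUP v \<in> {-m..M}. A * f v + h3 * v);
          cs = cos_cvx (polar \<Omega>); sn = sin_cvx (polar \<Omega>) in
      \<exists>\<eta>0 v3. v3 measurable_on {0..T} \<and>
        (\<forall>t \<in> {0..T}. v3 t \<in> argmax_on {-m..M} (\<lambda>v. A * f v + h3 * v)) \<and>
        (\<forall>t \<in> {0..T}.
           let \<eta> = \<eta>0 + H * h3 / A\<^sup>2 * t - h3\<^sup>2 / A\<^sup>2 * integral {0..t} v3 in
           x1 t = A / h3 * (sn \<eta> - sn \<eta>0) \<and>
           x2 t = A / h3 * (- cs \<eta> + cs \<eta>0) \<and>
           x3 t = H / h3 * t - 1/2 * A\<^sup>2 / h3\<^sup>2 * (\<eta> - \<eta>0)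
                  + 1/2 * A\<^sup>2 / h3\<^sup>2 * (2 * cs \<eta> * sn \<eta>0 - cs \<eta> * sn \<eta> - cs \<eta>0 * sn \<eta>0)))"

end

theory Submission
  imports Defs
begin

text \<open>
  Along an extremal the planar covector \<open>h\<close> satisfies \<open>h' = h\<^sub>3 J u\<close>, where \<open>J\<close> is the rotation by a
  right angle and \<open>u = f(u\<^sub>3) \<omega>\<close> with \<open>\<omega>\<close> a maximizer of the linear form \<open>h\<close> on \<open>\<Omega>\<close>. Such an \<open>\<omega>\<close> is
  a subgradient at \<open>h\<close> of the support function of \<open>\<Omega>\<close>, which is the Minkowski functional of the
  polar set, and \<open>\<omega> \<bullet> J \<omega> = 0\<close>; hence \<open>A\<close> is conserved. If \<open>h\<^sub>3 \<noteq> 0\<close>, the curve \<open>h / A\<close> stays on the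
  boundary of the polar set, and its swept area determines it and evolves linearly in \<open>t\<close> and
  \<open>\<integral>u\<^sub>3\<close>, because \<open>h \<bullet> u = H - h\<^sub>3 u\<^sub>3\<close>. Conversely, the right derivative of the boundary
  parametrized by swept area is \<open>J \<omega>\<close> for a maximizer \<open>\<omega>\<close>, which yields the control. Almost
  everywhere differentiation of Lipschitz functions is replaced throughout by averaging
  difference quotients, which converge to the control in \<open>L\<^sup>1\<close>.
\<close>

section \<open>Primitives of bounded measurable functions\<close>

text \<open>The boundary of \<Omega> may have corners and segments. The dual boundary curve then has
  only one-sided derivatives, and the maximizers \<omega> need be neither unique nor continuous in
  time. What remains of a differential equation is a Lipschitz function together with one fixed
  bounded version of its derivative, and this is what \<open>bounded_primitive\<close> records. The
  version is a function and not a class modulo null sets, because the estimates evaluate it at every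
  point: each compares the increment of a quantity with the remainder
  \<open>h s - h r - (s - r) *\<^sub>R w r\<close>, which is small only on average over
  \<open>r\<close>. Both \<Omega> and its polar set enter as unit balls of asymmetric norms, each
  norm being the support function of the other set, so that a single theory
  (\<open>planar_gauge\<close>) serves both pairs of trigonometric functions. Its parameter is twice
  the swept area. With this normalization the wedge product of a boundary curve with its velocity is
  the velocity of the parameter, which is where the equation for \<eta> comes from.\<close>

definition bounded_primitive ::
    "real \<Rightarrow> real \<Rightarrow> (real \<Rightarrow> 'a::euclidean_space) \<Rightarrow> (real \<Rightarrow> 'a) \<Rightarrow> bool" where
  "bounded_primitive a b h w \<longleftrightarrow>
     (\<exists>B. \<forall>x\<in>{a..b}. norm (w x) \<le> B) \<and>
     (\<forall>x y. a \<le> x \<and> x \<le> y \<and> y \<le> b \<longrightarrow> (w has_integral (h y - h x)) {x..y})"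

lemmas HK_integral_cong = Henstock_Kurzweil_Integration.integral_cong

lemma bounded_measurable_integrable:
  fixes w :: "real \<Rightarrow> 'a::euclidean_space"
  assumes "w \<in> borel_measurable (lebesgue_on {a..b})" "\<And>x. x \<in> {a..b} \<Longrightarrow> norm (w x) \<le> B"
  shows "w integrable_on {a..b}"
  by (rule measurable_bounded_by_integrable_imp_integrable[OF assms(1), of "\<lambda>_. B"])
     (use assms(2) in auto)

lemma bounded_primitive_measurable:
  assumes "bounded_primitive a b h w"
  shows "w \<in> borel_measurable (lebesgue_on {a..b})"
proof (cases "a \<le> b")
  case True
  then have "(w has_integral (h b - h a)) {a..b}"
    using assms unfolding bounded_primitive_def by auto
  from has_integral_implies_lebesgue_measurable[OF this] show ?thesis
    by (simp add: borel_measurable_restrict_space_iff)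
qed (auto simp: measurable_def space_restrict_space)

lemma bounded_primitive_integral:
  fixes w :: "real \<Rightarrow> 'a::euclidean_space"
  assumes "w \<in> borel_measurable (lebesgue_on {a..b})" "\<And>x. x \<in> {a..b} \<Longrightarrow> norm (w x) \<le> B"
  shows "bounded_primitive a b (\<lambda>t. c + integral {a..t} w) w"
  unfolding bounded_primitive_def
proof (intro conjI allI impI exI[of _ B])
  fix x y assume xy: "a \<le> x \<and> x \<le> y \<and> y \<le> b"
  have int: "w integrable_on {a..b}"
    using bounded_measurable_integrable[OF assms] .
  have iy: "w integrable_on {a..y}" and ixy: "w integrable_on {x..y}"
    using xy by (auto intro: integrable_subinterval_real[OF int])
  have "integral {a..x} w + integral {x..y} w = integral {a..y} w"
    using xy iy by (intro Henstock_Kurzweil_Integration.integral_combine) auto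
  then show "(w has_integral (c + integral {a..y} w - (c + integral {a..x} w))) {x..y}"
    using ixy by (simp add: has_integral_integrable_integral algebra_simps)
qed (use assms in auto)

lemma bounded_primitive_diff_bound:
  fixes w :: "real \<Rightarrow> 'a::euclidean_space"
  assumes "bounded_primitive a b h w"
  obtains B where "B > 0" "\<And>x. x \<in> {a..b} \<Longrightarrow> norm (w x) \<le> B"
    "\<And>x y. x \<in> {a..b} \<Longrightarrow> y \<in> {a..b} \<Longrightarrow> norm (h y - h x) \<le> B * \<bar>y - x\<bar>"
proof -
  obtain B0 where B0: "\<And>x. x \<in> {a..b} \<Longrightarrow> norm (w x) \<le> B0"
    using assms unfolding bounded_primitive_def by blast
  define B where "B = max B0 1"
  have B: "B > 0" "\<And>x. x \<in> {a..b} \<Longrightarrow> norm (w x) \<le> B"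
    using B0 unfolding B_def by force+
  have *: "norm (h y - h x) \<le> B * \<bar>y - x\<bar>" if "x \<in> {a..b}" "y \<in> {a..b}" "x \<le> y" for x y
  proof -
    have "(w has_integral (h y - h x)) {x..y}"
      using assms that unfolding bounded_primitive_def by auto
    then have "norm (h y - h x) \<le> B * measure lborel {x..y}"
      using B that by (intro has_integral_bound_real) auto
    then show ?thesis using that by simp
  qed
  have "norm (h y - h x) \<le> B * \<bar>y - x\<bar>" if "x \<in> {a..b}" "y \<in> {a..b}" for x y
    using *[of x y] *[of y x] that by (cases "x \<le> y") (auto simp: norm_minus_commute abs_minus_commute)
  then show thesis using that B by blast
qed

lemma bounded_primitive_continuous:
  fixes w :: "real \<Rightarrow> 'a::euclidean_space"
  assumes "bounded_primitive a b h w"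
  shows "continuous_on {a..b} h"
proof -
  obtain B where "B > 0" and
    B: "\<And>x y. x \<in> {a..b} \<Longrightarrow> y \<in> {a..b} \<Longrightarrow> norm (h y - h x) \<le> B * \<bar>y - x\<bar>"
    using bounded_primitive_diff_bound[OF assms] by metis
  have "B-lipschitz_on {a..b} h"
    using B \<open>B > 0\<close> by (intro lipschitz_onI) (auto simp: dist_norm norm_minus_commute abs_minus_commute)
  then show ?thesis by (rule lipschitz_on_continuous_on)
qed

lemma bounded_primitive_subinterval:
  assumes "bounded_primitive a b h w" "a \<le> x" "y \<le> b"
  shows "bounded_primitive x y h w"
  using assms unfolding bounded_primitive_def by fastforce

text \<open>Measurability supplies continuous functions converging to \<open>w\<close> off a null
  set, but without a common bound. Composing them with the radial retraction \<open>clip\<close>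
  onto the ball of radius \<open>C\<close> keeps continuity, fixes the limit because
  \<open>norm (w x) \<le> C\<close>, and supplies the dominating constant
  \<open>2 * C\<close>.\<close>

lemma bounded_measurable_L1_approx:
  fixes w :: "real \<Rightarrow> 'a::euclidean_space"
  assumes w: "w \<in> borel_measurable (lebesgue_on {a..b})"
    and B: "\<And>x. x \<in> {a..b} \<Longrightarrow> norm (w x) \<le> B" and "e > 0"
  obtains v where "continuous_on UNIV v" "(\<lambda>x. norm (w x - v x)) integrable_on {a..b}"
    "integral {a..b} (\<lambda>x. norm (w x - v x)) < e"
proof -
  have B1: "\<And>x. x \<in> {a..b} \<Longrightarrow> norm (w x) \<le> max B 1" using B by force
  define C where "C = max B 1"
  have C: "C > 0" "\<And>x. x \<in> {a..b} \<Longrightarrow> norm (w x) \<le> C" using B1 by (auto simp: C_def)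
  have "w measurable_on {a..b}"
    using w measurable_on_iff_borel_measurable[of "{a..b}" w] by auto
  then obtain N g where N: "negligible N" and cont: "\<And>n. continuous_on UNIV (g n)"
    and lim: "\<And>x. x \<notin> N \<Longrightarrow> (\<lambda>n. g n x) \<longlonglongrightarrow> (if x \<in> {a..b} then w x else 0)"
    unfolding measurable_on_def by blast
  define clip where "clip z = (C / max C (norm z)) *\<^sub>R z" for z :: 'a
  have clip_cont: "continuous_on UNIV clip"
    unfolding clip_def using C(1) by (auto intro!: continuous_intros)
  have clip_norm: "norm (clip z) \<le> C" for z
    unfolding clip_def using C(1) by (auto simp: field_simps max_def)
  have clip_id: "clip z = z" if "norm z \<le> C" for z
    unfolding clip_def using C(1) that by (auto simp: max_def)
  define v where "v n x = clip (g n x)" for n x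
  have v_cont: "continuous_on UNIV (v n)" for n
    unfolding v_def using continuous_on_compose2[OF clip_cont cont] by auto
  have int: "(\<lambda>x. norm (w x - v n x)) integrable_on {a..b}" for n
  proof (rule bounded_measurable_integrable[where B = "2 * C"])
    have "v n \<in> borel_measurable (lebesgue_on {a..b})"
      using v_cont[of n] continuous_imp_measurable_on_sets_lebesgue[of "{a..b}" "v n"]
      by (auto intro: continuous_on_subset)
    then show "(\<lambda>x. norm (w x - v n x)) \<in> borel_measurable (lebesgue_on {a..b})"
      using w by measurable
    show "norm (norm (w x - v n x)) \<le> 2 * C" if "x \<in> {a..b}" for x
      using norm_triangle_ineq4[of "w x" "v n x"] C(2)[OF that] clip_norm[of "g n x"]
      by (simp add: v_def)
  qed
  have "(\<lambda>n. integral {a..b} (\<lambda>x. if x \<in> N then 0 else norm (w x - v n x))) \<longlonglongrightarrow>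
        integral {a..b} (\<lambda>x. 0)"
  proof (rule dominated_convergence(2)[where h = "\<lambda>_. 2 * C"])
    show "(\<lambda>x. if x \<in> N then 0 else norm (w x - v n x)) integrable_on {a..b}" for n
      by (rule integrable_spike[OF int[of n] N]) auto
    show "norm (if x \<in> N then 0 else norm (w x - v n x)) \<le> 2 * C" if "x \<in> {a..b}" for n x
      using norm_triangle_ineq4[of "w x" "v n x"] C(2)[OF that] clip_norm[of "g n x"] C(1)
      by (simp add: v_def)
    show "(\<lambda>n. if x \<in> N then 0 else norm (w x - v n x)) \<longlonglongrightarrow> 0" if x: "x \<in> {a..b}" for x
    proof (cases "x \<in> N")
      case False
      then have "(\<lambda>n. g n x) \<longlonglongrightarrow> w x" using lim x by force
      moreover have "isCont clip (w x)"
        using clip_cont continuous_on_eq_continuous_at by blast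
      ultimately have "(\<lambda>n. v n x) \<longlonglongrightarrow> clip (w x)"
        unfolding v_def by (rule isCont_tendsto_compose[rotated])
      then have "(\<lambda>n. v n x) \<longlonglongrightarrow> w x" using clip_id C(2)[OF x] by simp
      then have "(\<lambda>n. norm (w x - v n x)) \<longlonglongrightarrow> norm (w x - w x)"
        by (intro tendsto_intros)
      then show ?thesis using False by simp
    qed auto
  qed auto
  then have "(\<lambda>n. integral {a..b} (\<lambda>x. if x \<in> N then 0 else norm (w x - v n x))) \<longlonglongrightarrow> 0"
    by simp
  then have "eventually (\<lambda>n. integral {a..b} (\<lambda>x. if x \<in> N then 0 else norm (w x - v n x)) < e) sequentially"
    using \<open>e > 0\<close> order_tendstoD(2) by blast
  then obtain n where "integral {a..b} (\<lambda>x. if x \<in> N then 0 else norm (w x - v n x)) < e"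
    by (meson eventually_at_top_linorder order_refl)
  moreover have "integral {a..b} (\<lambda>x. if x \<in> N then 0 else norm (w x - v n x))
      = integral {a..b} (\<lambda>x. norm (w x - v n x))"
    by (rule integral_spike[OF N]) auto
  ultimately show thesis using that v_cont int by metis
qed

text \<open>Stands in for the rule that a derivative nonnegative almost everywhere makes
  \<open>G\<close> increase. The estimate may say nothing at a single \<open>r\<close>. Integrated
  over \<open>r\<close> with \<open>s = r + \<epsilon>\<close>, its remainders are of smaller order
  than \<open>\<epsilon>\<close>, because the difference quotients of \<open>h\<close> approach
  \<open>w\<close> in the mean, while the integral of \<open>G (r + \<epsilon>) - G r\<close>
  reduces to integrals over two end intervals of length \<open>\<epsilon>\<close>.\<close>

lemma bounded_primitive_mono_test:
  fixes h w :: "real \<Rightarrow> 'a::euclidean_space" and G :: "real \<Rightarrow> real"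
  assumes "a < b" and G: "continuous_on {a..b} G" and prim: "bounded_primitive a b h w"
    and "R \<ge> 0" "d > 0"
    and est: "\<And>r s. a \<le> r \<Longrightarrow> r < s \<Longrightarrow> s \<le> b \<Longrightarrow> s - r < d \<Longrightarrow>
      G s - G r \<ge> - R * norm (h s - h r - (s - r) *\<^sub>R w r) - C * (s - r)\<^sup>2"
  shows "G a \<le> G b"
proof (rule field_le_epsilon)
  fix e0 :: real assume "e0 > 0"
  \<comment> \<open>\<open>D\<close> adds up the error coefficients of the last estimate: 2 from the
    continuity of \<open>Y\<close> at the two ends, \<open>R * (b - a)\<close> and
    \<open>\<bar>C\<bar> * (b - a)\<close> from the integrated remainders, and \<open>2 * R\<close>
    from the two values of \<open>V\<close>.\<close>
  define D where "D = 2 + R * (b - a) + 2 * R + \<bar>C\<bar> * (b - a)"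
  have "D > 0" unfolding D_def using \<open>a < b\<close> \<open>R \<ge> 0\<close> by (simp add: add_pos_nonneg)
  define e where "e = e0 / D"
  have e: "e > 0" "e * D = e0" using \<open>e0 > 0\<close> \<open>D > 0\<close> by (auto simp: e_def)
  have meas: "w \<in> borel_measurable (lebesgue_on {a..b})"
    using bounded_primitive_measurable[OF prim] .
  obtain B where B: "\<And>x. x \<in> {a..b} \<Longrightarrow> norm (w x) \<le> B"
    using prim unfolding bounded_primitive_def by blast
  obtain v where v: "continuous_on UNIV v"
    and vint: "(\<lambda>x. norm (w x - v x)) integrable_on {a..b}"
    and vle: "integral {a..b} (\<lambda>x. norm (w x - v x)) < e"
    using bounded_measurable_L1_approx[OF meas B \<open>e > 0\<close>] by metis
  define V where "V r = integral {a..r} (\<lambda>x. norm (w x - v x))" for r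
  have Vcont: "continuous_on {a..b} V"
    unfolding V_def by (rule indefinite_integral_continuous_1[OF vint])
  \<comment> \<open>The remainder at \<open>r\<close> contains the integral of
    \<open>norm (w x - v x)\<close> over \<open>{r..r+\<epsilon>}\<close>. Adding
    \<open>R * V\<close> to \<open>G\<close> absorbs it, since it is an increment of
    \<open>V\<close>.\<close>
  define Y where "Y r = G r + R * V r" for r
  have Ycont: "continuous_on {a..b} Y"
    unfolding Y_def by (intro continuous_intros G Vcont)
  have "uniformly_continuous_on {a..b} v"
    by (rule compact_uniformly_continuous) (use v continuous_on_subset in auto)
  then obtain d1 where "d1 > 0"
    and d1: "\<And>x y. x \<in> {a..b} \<Longrightarrow> y \<in> {a..b} \<Longrightarrow> dist y x < d1 \<Longrightarrow> dist (v y) (v x) < e"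
    unfolding uniformly_continuous_on_def using e(1) by metis
  have "uniformly_continuous_on {a..b} Y"
    by (rule compact_uniformly_continuous[OF Ycont]) auto
  then obtain d2 where "d2 > 0"
    and d2: "\<And>x y. x \<in> {a..b} \<Longrightarrow> y \<in> {a..b} \<Longrightarrow> dist y x < d2 \<Longrightarrow> dist (Y y) (Y x) < e"
    unfolding uniformly_continuous_on_def using e(1) by metis
  define \<epsilon> where "\<epsilon> = min (min (d/2) (d1/2)) (min (min (d2/2) e) ((b - a) / 2))"
  have \<epsilon>: "\<epsilon> > 0" "\<epsilon> < d" "\<epsilon> < d1" "\<epsilon> < d2" "\<epsilon> \<le> e" "a + \<epsilon> \<le> b - \<epsilon>"
    using \<open>d > 0\<close> \<open>d1 > 0\<close> \<open>d2 > 0\<close> e(1) \<open>a < b\<close> unfolding \<epsilon>_def by (auto simp: min_def field_simps)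
  have wint: "w integrable_on {a..b}" using bounded_measurable_integrable[OF meas B] .
  have step: "Y (r + \<epsilon>) - Y r \<ge> - R * \<epsilon> * e - R * \<epsilon> * norm (w r - v r) - \<bar>C\<bar> * \<epsilon>\<^sup>2"
    if r: "a \<le> r" "r \<le> b - \<epsilon>" for r
  proof -
    have sub: "{r..r+\<epsilon>} \<subseteq> {a..b}" using r \<epsilon> by auto
    have hint: "(w has_integral (h (r+\<epsilon>) - h r)) {r..r+\<epsilon>}"
      using prim r \<epsilon> unfolding bounded_primitive_def by auto
    have Vdiff: "integral {r..r+\<epsilon>} (\<lambda>x. norm (w x - v x)) = V (r+\<epsilon>) - V r"
    proof -
      have "integral {a..r} (\<lambda>x. norm (w x - v x)) + integral {r..r+\<epsilon>} (\<lambda>x. norm (w x - v x))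
          = integral {a..r+\<epsilon>} (\<lambda>x. norm (w x - v x))"
        using r \<epsilon> by (intro Henstock_Kurzweil_Integration.integral_combine integrable_subinterval_real[OF vint]) auto
      then show ?thesis by (simp add: V_def)
    qed
    have c: "((\<lambda>x. w r) has_integral \<epsilon> *\<^sub>R w r) {r..r+\<epsilon>}"
      using has_integral_const_real[of "w r" r "r+\<epsilon>"] \<epsilon>(1) by simp
    have eq: "h (r+\<epsilon>) - h r - \<epsilon> *\<^sub>R w r = integral {r..r+\<epsilon>} (\<lambda>x. w x - w r)"
      using has_integral_diff[OF hint c] by (simp add: integral_unique)
    have "norm (h (r+\<epsilon>) - h r - \<epsilon> *\<^sub>R w r)
        \<le> integral {r..r+\<epsilon>} (\<lambda>x. norm (w x - v x) + (e + norm (w r - v r)))"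
      unfolding eq
    proof (rule integral_norm_bound_integral)
      show "(\<lambda>x. w x - w r) integrable_on {r..r+\<epsilon>}"
        using has_integral_diff[OF hint c] by blast
      show "(\<lambda>x. norm (w x - v x) + (e + norm (w r - v r))) integrable_on {r..r+\<epsilon>}"
        using sub by (intro integrable_add integrable_const_ivl integrable_subinterval_real[OF vint])
      fix x assume x: "x \<in> {r..r+\<epsilon>}"
      have "norm (v x - v r) < e"
        using d1[of r x] x r \<epsilon> by (auto simp: dist_norm)
      moreover have "norm (w x - w r) \<le> norm (w x - v x) + norm (v x - v r) + norm (v r - w r)"
        using norm_triangle_ineq[of "w x - v x + (v x - v r)" "v r - w r"]
          norm_triangle_ineq[of "w x - v x" "v x - v r"] by (simp add: algebra_simps)
      ultimately show "norm (w x - w r) \<le> norm (w x - v x) + (e + norm (w r - v r))"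
        by (simp add: norm_minus_commute)
    qed
    also have "\<dots> = (V (r+\<epsilon>) - V r) + \<epsilon> * (e + norm (w r - v r))"
      using sub Vdiff \<epsilon>(1)
      by (subst Henstock_Kurzweil_Integration.integral_add)
         (auto intro!: integrable_const_ivl integrable_subinterval_real[OF vint])
    finally have n: "norm (h (r+\<epsilon>) - h r - \<epsilon> *\<^sub>R w r) \<le> (V (r+\<epsilon>) - V r) + \<epsilon> * (e + norm (w r - v r))" .
    have "G (r+\<epsilon>) - G r \<ge> - R * norm (h (r+\<epsilon>) - h r - \<epsilon> *\<^sub>R w r) - C * \<epsilon>\<^sup>2"
      using est[of r "r+\<epsilon>"] r \<epsilon> by simp
    moreover have "R * norm (h (r+\<epsilon>) - h r - \<epsilon> *\<^sub>R w r)
        \<le> R * ((V (r+\<epsilon>) - V r) + \<epsilon> * (e + norm (w r - v r)))"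
      using n \<open>R \<ge> 0\<close> by (rule mult_left_mono)
    moreover have "C * \<epsilon>\<^sup>2 \<le> \<bar>C\<bar> * \<epsilon>\<^sup>2" by (intro mult_right_mono) auto
    ultimately show ?thesis unfolding Y_def by (simp add: algebra_simps)
  qed
  have Yint: "Y integrable_on {a..b}" using Ycont by (rule integrable_continuous_real)
  have vint': "(\<lambda>x. norm (w x - v x)) integrable_on {a..b-\<epsilon>}"
    using \<epsilon> by (intro integrable_subinterval_real[OF vint]) auto
  have Yint2: "(\<lambda>r. Y (r + \<epsilon>)) integrable_on {a..b-\<epsilon>}"
    using \<epsilon> by (intro integrable_continuous_real continuous_on_compose2[OF Ycont] continuous_intros) auto
  have Yint1: "Y integrable_on {a..b-\<epsilon>}"
    using \<epsilon> by (intro integrable_subinterval_real[OF Yint]) auto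
  have shift: "integral {a..b-\<epsilon>} (\<lambda>r. Y (r + \<epsilon>)) = integral {a+\<epsilon>..b} Y"
    using integral_shift_Icc_real[of a "b - \<epsilon>" Y \<epsilon>] by (simp add: comp_def add.commute)
  have "integral {a..b-\<epsilon>} (\<lambda>r. - R * \<epsilon> * e - R * \<epsilon> * norm (w r - v r) - \<bar>C\<bar> * \<epsilon>\<^sup>2)
     \<le> integral {a..b-\<epsilon>} (\<lambda>r. Y (r + \<epsilon>) - Y r)"
  proof (rule integral_le)
    show "(\<lambda>r. - R * \<epsilon> * e - R * \<epsilon> * norm (w r - v r) - \<bar>C\<bar> * \<epsilon>\<^sup>2) integrable_on {a..b-\<epsilon>}"
      using vint' by (intro integrable_diff integrable_const_ivl integrable_on_mult_right)
    show "(\<lambda>r. Y (r + \<epsilon>) - Y r) integrable_on {a..b - \<epsilon>}"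
      by (intro integrable_diff Yint1 Yint2)
  qed (use step in auto)
  also have "integral {a..b-\<epsilon>} (\<lambda>r. Y (r + \<epsilon>) - Y r) = integral {a+\<epsilon>..b} Y - integral {a..b-\<epsilon>} Y"
    using Henstock_Kurzweil_Integration.integral_diff[OF Yint2 Yint1] shift by simp
  \<comment> \<open>The common part of the two intervals cancels. On the two end intervals that
    remain, \<open>Y\<close> is within \<open>e\<close> of its end values.\<close>
  also have "\<dots> = integral {b-\<epsilon>..b} Y - integral {a..a+\<epsilon>} Y"
  proof -
    have "integral {a..a+\<epsilon>} Y + integral {a+\<epsilon>..b} Y = integral {a..b} Y"
      using \<epsilon> by (intro Henstock_Kurzweil_Integration.integral_combine Yint) auto
    moreover have "integral {a..b-\<epsilon>} Y + integral {b-\<epsilon>..b} Y = integral {a..b} Y"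
      using \<epsilon> by (intro Henstock_Kurzweil_Integration.integral_combine Yint) auto
    ultimately show ?thesis by simp
  qed
  also have "\<dots> \<le> \<epsilon> * (Y b + e) - \<epsilon> * (Y a - e)"
  proof -
    have "integral {b-\<epsilon>..b} Y \<le> integral {b-\<epsilon>..b} (\<lambda>_. Y b + e)"
    proof (rule integral_le)
      show "Y integrable_on {b-\<epsilon>..b}" using \<epsilon> by (intro integrable_subinterval_real[OF Yint]) auto
      show "Y x \<le> Y b + e" if "x \<in> {b-\<epsilon>..b}" for x
        using d2[of b x] that \<epsilon> by (auto simp: dist_real_def)
    qed auto
    moreover have "integral {a..a+\<epsilon>} (\<lambda>_. Y a - e) \<le> integral {a..a+\<epsilon>} Y"
    proof (rule integral_le)
      show "Y integrable_on {a..a+\<epsilon>}" using \<epsilon> by (intro integrable_subinterval_real[OF Yint]) auto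
      show "Y a - e \<le> Y x" if "x \<in> {a..a+\<epsilon>}" for x
        using d2[of a x] that \<epsilon> by (auto simp: dist_real_def)
    qed auto
    ultimately show ?thesis using \<epsilon>(1) by simp
  qed
  finally have up: "integral {a..b-\<epsilon>} (\<lambda>r. - R * \<epsilon> * e - R * \<epsilon> * norm (w r - v r) - \<bar>C\<bar> * \<epsilon>\<^sup>2)
      \<le> \<epsilon> * (Y b + e) - \<epsilon> * (Y a - e)" .
  have V_le: "V (b - \<epsilon>) \<le> e"
  proof -
    have "V (b - \<epsilon>) \<le> V b"
      unfolding V_def using \<epsilon> by (intro integral_subset_le vint vint') auto
    then show ?thesis using vle by (simp add: V_def)
  qed
  have "integral {a..b-\<epsilon>} (\<lambda>r. - R * \<epsilon> * e - R * \<epsilon> * norm (w r - v r) - \<bar>C\<bar> * \<epsilon>\<^sup>2)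
     = - R * \<epsilon> * e * (b - \<epsilon> - a) - R * \<epsilon> * V (b - \<epsilon>) - \<bar>C\<bar> * \<epsilon>\<^sup>2 * (b - \<epsilon> - a)"
  proof -
    have c: "((\<lambda>r. k) has_integral k * (b - \<epsilon> - a)) {a..b-\<epsilon>}" for k :: real
      using has_integral_const_real[of k a "b-\<epsilon>"] \<epsilon> by (simp add: mult.commute)
    have "((\<lambda>r. norm (w r - v r)) has_integral V (b - \<epsilon>)) {a..b-\<epsilon>}"
      unfolding V_def using vint' by (rule integrable_integral)
    from has_integral_diff[OF has_integral_diff[OF c has_integral_mult_right[OF this]] c]
    show ?thesis by (rule integral_unique)
  qed
  with up have "\<epsilon> * (Y b - Y a + 2 * e) \<ge>
      \<epsilon> * (- R * e * (b - \<epsilon> - a) - R * V (b - \<epsilon>) - \<bar>C\<bar> * \<epsilon> * (b - \<epsilon> - a))"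
    by (simp add: algebra_simps power2_eq_square)
  then have "Y b - Y a + 2 * e \<ge> - R * e * (b - \<epsilon> - a) - R * V (b - \<epsilon>) - \<bar>C\<bar> * \<epsilon> * (b - \<epsilon> - a)"
    using \<epsilon>(1) by simp
  moreover have "R * e * (b - \<epsilon> - a) \<le> R * e * (b - a)"
    using \<open>R \<ge> 0\<close> e(1) \<epsilon>(1) by (intro mult_left_mono) auto
  moreover have "R * V (b - \<epsilon>) \<le> R * e" using V_le \<open>R \<ge> 0\<close> by (rule mult_left_mono)
  moreover have "\<bar>C\<bar> * \<epsilon> * (b - \<epsilon> - a) \<le> \<bar>C\<bar> * e * (b - a)"
    using \<epsilon> by (intro mult_mono) auto
  moreover have "Y a = G a" by (simp add: Y_def V_def)
  moreover have "Y b \<le> G b + R * e"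
    unfolding Y_def using vle \<open>R \<ge> 0\<close> by (simp add: V_def mult_left_mono)
  ultimately have "G a \<le> G b + e * D"
    unfolding D_def by (simp add: algebra_simps)
  then show "G a \<le> G b + e0" using e(2) by simp
qed


lemma bounded_primitive_const_test:
  fixes h w :: "real \<Rightarrow> 'a::euclidean_space" and G :: "real \<Rightarrow> real"
  assumes "a \<le> b" and G: "continuous_on {a..b} G" and prim: "bounded_primitive a b h w"
    and "R \<ge> 0" "d > 0"
    and est: "\<And>r s. a \<le> r \<Longrightarrow> r < s \<Longrightarrow> s \<le> b \<Longrightarrow> s - r < d \<Longrightarrow>
      \<bar>G s - G r\<bar> \<le> R * norm (h s - h r - (s - r) *\<^sub>R w r) + C * (s - r)\<^sup>2"
  shows "G a = G b"
proof (cases "a = b")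
  case False
  then have "a < b" using \<open>a \<le> b\<close> by simp
  have "G a \<le> G b"
    by (rule bounded_primitive_mono_test[OF \<open>a < b\<close> G prim \<open>R \<ge> 0\<close> \<open>d > 0\<close>, of C]) (use est in \<open>force simp: abs_le_iff\<close>)
  moreover have "- G a \<le> - G b"
    by (rule bounded_primitive_mono_test[OF \<open>a < b\<close> _ prim \<open>R \<ge> 0\<close> \<open>d > 0\<close>, of _ C])
       (use est G in \<open>force intro: continuous_intros simp: abs_le_iff\<close>)+
  ultimately show ?thesis by simp
qed simp

lemma bounded_primitive_reflect:
  fixes h w :: "real \<Rightarrow> 'a::euclidean_space"
  assumes "bounded_primitive a b h w"
  shows "bounded_primitive (-b) (-a) (\<lambda>t. h (-t)) (\<lambda>t. - w (-t))"
  unfolding bounded_primitive_def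
proof (intro conjI allI impI)
  obtain B where "\<forall>x\<in>{a..b}. norm (w x) \<le> B"
    using assms unfolding bounded_primitive_def by blast
  then show "\<exists>B. \<forall>x\<in>{-b..-a}. norm (- w (-x)) \<le> B"
    by (intro exI[of _ B]) auto
next
  fix x y assume "- b \<le> x \<and> x \<le> y \<and> y \<le> - a"
  then have "(w has_integral (h (-x) - h (-y))) {-y..-x}"
    using assms unfolding bounded_primitive_def by auto
  then have "((\<lambda>t. w (-t)) has_integral (h (-x) - h (-y))) {x..y}"
    using has_integral_reflect_real[of w "h (-x) - h (-y)" "-x" "-y"] by simp
  from has_integral_neg[OF this]
  show "((\<lambda>t. - w (-t)) has_integral (h (-y) - h (-x))) {x..y}" by simp
qed

text \<open>A subgradient inequality bounds increments from below only, but for \<open>s\<close> on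
  either side of \<open>r\<close>. It can therefore be tested forwards and, after reversing time,
  backwards; the two monotonicities give constancy.\<close>

lemma bounded_primitive_const_test_subgradient:
  fixes h w :: "real \<Rightarrow> 'a::euclidean_space" and G :: "real \<Rightarrow> real"
  assumes "a \<le> b" and G: "continuous_on {a..b} G" and prim: "bounded_primitive a b h w"
    and "R \<ge> 0"
    and est: "\<And>r s. r \<in> {a..b} \<Longrightarrow> s \<in> {a..b} \<Longrightarrow>
      G s - G r \<ge> - R * norm (h s - h r - (s - r) *\<^sub>R w r)"
  shows "G a = G b"
proof (cases "a = b")
  case False
  then have "a < b" using \<open>a \<le> b\<close> by simp
  have "G a \<le> G b"
    by (rule bounded_primitive_mono_test[OF \<open>a < b\<close> G prim \<open>R \<ge> 0\<close>, of 1 0]) (use est in force)+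
  moreover have "G (- (- b)) \<le> G (- (- a))"
  proof (rule bounded_primitive_mono_test[OF _ _ bounded_primitive_reflect[OF prim] \<open>R \<ge> 0\<close>, of "\<lambda>t. G (- t)" 1 0])
    show "continuous_on {- b..- a} (\<lambda>t. G (- t))"
      by (rule continuous_on_compose2[OF G]) (auto intro: continuous_intros)
    show "G (- s) - G (- r) \<ge> - R * norm (h (- s) - h (- r) - (s - r) *\<^sub>R - w (- r)) - 0 * (s - r)\<^sup>2"
      if "- b \<le> r" "r < s" "s \<le> - a" for r s
    proof -
      have "h (- s) - h (- r) - (s - r) *\<^sub>R - w (- r) = h (- s) - h (- r) - (- s - - r) *\<^sub>R w (- r)"
        by (simp add: algebra_simps)
      then show ?thesis using est[of "- r" "- s"] that by simp
    qed
  qed (use \<open>a < b\<close> in auto)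
  ultimately show ?thesis by simp
qed simp

section \<open>Calculus rules for bounded primitives\<close>

lemma bounded_primitive_Pair:
  assumes "bounded_primitive a b h v" "bounded_primitive a b k w"
  shows "bounded_primitive a b (\<lambda>t. (h t, k t)) (\<lambda>t. (v t, w t))"
proof -
  obtain B where B: "\<forall>x\<in>{a..b}. norm (v x) \<le> B"
    using assms unfolding bounded_primitive_def by blast
  obtain C where C: "\<forall>x\<in>{a..b}. norm (w x) \<le> C"
    using assms unfolding bounded_primitive_def by blast
  have "\<forall>x\<in>{a..b}. norm (v x, w x) \<le> B + C"
    using B C by (meson add_mono norm_Pair_le order_trans)
  moreover have "((\<lambda>t. (v t, w t)) has_integral ((h y, k y) - (h x, k x))) {x..y}"
    if "a \<le> x" "x \<le> y" "y \<le> b" for x y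
  proof -
    have 1: "(v has_integral (h y - h x)) {x..y}" and 2: "(w has_integral (k y - k x)) {x..y}"
      using assms that unfolding bounded_primitive_def by auto
    have "bounded_linear (\<lambda>z::'a. (z, 0::'b))" "bounded_linear (\<lambda>z::'b. (0::'a, z))"
      by (intro bounded_linear_Pair bounded_linear_ident bounded_linear_zero)+
    from has_integral_add[OF has_integral_linear[OF 1 this(1)] has_integral_linear[OF 2 this(2)]]
    show ?thesis by (simp add: o_def)
  qed
  ultimately show ?thesis unfolding bounded_primitive_def by blast
qed

lemma bounded_primitive_linear:
  fixes L :: "'a::euclidean_space \<Rightarrow> 'b::euclidean_space"
  assumes "bounded_primitive a b h w" "bounded_linear L"
  shows "bounded_primitive a b (\<lambda>t. L (h t)) (\<lambda>t. L (w t))"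
proof -
  interpret bounded_linear L by fact
  obtain B where B: "\<forall>x\<in>{a..b}. norm (w x) \<le> B"
    using assms unfolding bounded_primitive_def by blast
  obtain K where K: "K > 0" "\<And>x. norm (L x) \<le> norm x * K" using pos_bounded by blast
  have "\<forall>x\<in>{a..b}. norm (L (w x)) \<le> B * K"
    using B K by (meson less_imp_le mult_right_mono order_trans)
  moreover have "((\<lambda>t. L (w t)) has_integral (L (h y) - L (h x))) {x..y}"
    if "a \<le> x" "x \<le> y" "y \<le> b" for x y
  proof -
    have "(w has_integral (h y - h x)) {x..y}"
      using assms that unfolding bounded_primitive_def by auto
    from has_integral_linear[OF this assms(2)] show ?thesis by (simp add: o_def diff)
  qed
  ultimately show ?thesis unfolding bounded_primitive_def by blast
qed

text \<open>For \<open>\<Phi>\<close> with quadratic Taylor error, \<open>\<Phi> (h t)\<close> and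
  the integral \<open>q\<close> of the expected derivative have the same increments up to
  first-order remainders and a square of the step. Their difference thus passes the constancy
  test.\<close>

lemma bounded_primitive_chain:
  fixes h w :: "real \<Rightarrow> 'a::euclidean_space" and \<Phi> :: "'a \<Rightarrow> real" and D :: "'a \<Rightarrow> 'a"
  assumes prim: "bounded_primitive a b h w" and D: "continuous_on UNIV D"
    and \<Phi>: "\<And>x y. \<bar>\<Phi> y - \<Phi> x - D x \<bullet> (y - x)\<bar> \<le> C * (norm (y - x))\<^sup>2"
  shows "bounded_primitive a b (\<lambda>t. \<Phi> (h t)) (\<lambda>t. D (h t) \<bullet> w t)"
proof -
  define p where "p t = D (h t) \<bullet> w t" for t
  obtain B where B: "B > 0" "\<And>x. x \<in> {a..b} \<Longrightarrow> norm (w x) \<le> B"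
    "\<And>x y. x \<in> {a..b} \<Longrightarrow> y \<in> {a..b} \<Longrightarrow> norm (h y - h x) \<le> B * \<bar>y - x\<bar>"
    using bounded_primitive_diff_bound[OF prim] by metis
  have hc: "continuous_on {a..b} h" using bounded_primitive_continuous[OF prim] .
  have Dc: "continuous_on {a..b} (\<lambda>t. D (h t))"
    by (rule continuous_on_compose2[OF D hc]) auto
  have "compact ((\<lambda>t. D (h t)) ` {a..b})" by (rule compact_continuous_image[OF Dc]) auto
  then obtain E0 where E0: "\<forall>x\<in>(\<lambda>t. D (h t)) ` {a..b}. norm x \<le> E0"
    using compact_imp_bounded bounded_iff by metis
  define E where "E = max E0 1"
  have E: "E > 0" "\<And>t. t \<in> {a..b} \<Longrightarrow> norm (D (h t)) \<le> E"
    using E0 unfolding E_def by force+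
  have C: "C \<ge> 0"
  proof -
    obtain x :: 'a where "x \<in> Basis" using nonempty_Basis by blast
    then have "norm x = 1" by simp
    with \<Phi>[of x 0] show ?thesis by simp
  qed
  have pB: "norm (p t) \<le> E * B" if "t \<in> {a..b}" for t
  proof -
    have "norm (p t) \<le> norm (D (h t)) * norm (w t)" unfolding p_def by (simp add: Cauchy_Schwarz_ineq2)
    also have "\<dots> \<le> E * B" using E B that by (intro mult_mono) auto
    finally show ?thesis .
  qed
  have pm: "p \<in> borel_measurable (lebesgue_on {a..b})"
  proof -
    have "(\<lambda>t. D (h t)) \<in> borel_measurable (lebesgue_on {a..b})"
      using Dc by (intro continuous_imp_measurable_on_sets_lebesgue) auto
    then show ?thesis unfolding p_def using bounded_primitive_measurable[OF prim] by measurable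
  qed
  have main: "\<Phi> (h y) - \<Phi> (h x) = integral {x..y} p" if xy: "a \<le> x" "x \<le> y" "y \<le> b" for x y
  proof -
    define q where "q t = 0 + integral {x..t} p" for t
    have sub: "{x..y} \<subseteq> {a..b}" using xy by auto
    have q: "bounded_primitive x y q p"
      unfolding q_def
      by (rule bounded_primitive_integral[of _ _ _ "E * B"])
         (use pm pB sub in \<open>auto intro: measurable_restrict_mono\<close>)
    \<comment> \<open>The increment of \<open>G\<close> involves the remainder of \<open>h\<close>
      and that of \<open>q\<close>, both small only on average. Pairing the functions puts both
      remainders into one norm.\<close>
    have pq: "bounded_primitive x y (\<lambda>t. (h t, q t)) (\<lambda>t. (w t, p t))"
      by (rule bounded_primitive_Pair[OF bounded_primitive_subinterval[OF prim] q]) (use xy in auto)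
    define G where "G t = \<Phi> (h t) - q t" for t
    have est: "\<bar>G s - G r\<bar> \<le> (E + 1) * norm ((h s, q s) - (h r, q r) - (s - r) *\<^sub>R (w r, p r)) + (C * B\<^sup>2) * (s - r)\<^sup>2"
      if rs: "x \<le> r" "r < s" "s \<le> y" for r s
    proof -
      let ?N = "norm ((h s, q s) - (h r, q r) - (s - r) *\<^sub>R (w r, p r))"
      define d1 where "d1 = h s - h r - (s - r) *\<^sub>R w r"
      define d2 where "d2 = q s - q r - (s - r) * p r"
      have N: "norm d1 \<le> ?N" "\<bar>d2\<bar> \<le> ?N"
        using norm_fst_le[of d1 d2] norm_snd_le[of d2 d1] by (auto simp: d1_def d2_def)
      have "G s - G r = (\<Phi> (h s) - \<Phi> (h r) - D (h r) \<bullet> (h s - h r)) + D (h r) \<bullet> d1 - d2"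
        unfolding G_def d1_def d2_def p_def by (simp add: algebra_simps)
      moreover have "\<bar>\<Phi> (h s) - \<Phi> (h r) - D (h r) \<bullet> (h s - h r)\<bar> \<le> C * (B\<^sup>2 * (s - r)\<^sup>2)"
      proof -
        have "norm (h s - h r) \<le> B * (s - r)" using B(3)[of r s] rs xy by auto
        then have "(norm (h s - h r))\<^sup>2 \<le> (B * (s - r))\<^sup>2" by (intro power_mono) auto
        then have "C * (norm (h s - h r))\<^sup>2 \<le> C * (B * (s - r))\<^sup>2" using C by (rule mult_left_mono)
        then show ?thesis using \<Phi>[of "h s" "h r"] by (simp add: power_mult_distrib)
      qed
      moreover have "\<bar>D (h r) \<bullet> d1\<bar> \<le> E * ?N"
      proof -
        have "\<bar>D (h r) \<bullet> d1\<bar> \<le> norm (D (h r)) * norm d1" by (rule Cauchy_Schwarz_ineq2)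
        also have "\<dots> \<le> E * ?N" using E N rs xy by (intro mult_mono) auto
        finally show ?thesis .
      qed
      ultimately show ?thesis using N(2) by (simp add: algebra_simps)
    qed
    have "G x = G y"
    proof (rule bounded_primitive_const_test[OF \<open>x \<le> y\<close> _ pq _ _ est])
      have "\<exists>L. L-lipschitz_on {a..b} (\<lambda>t. \<Phi> (h t))"
      proof (intro exI lipschitz_onI)
        fix s t assume st: "s \<in> {a..b}" "t \<in> {a..b}"
        have n: "norm (h s - h t) \<le> B * \<bar>s - t\<bar>" using B(3) st by blast
        have "\<bar>D (h t) \<bullet> (h s - h t)\<bar> \<le> norm (D (h t)) * norm (h s - h t)" by (rule Cauchy_Schwarz_ineq2)
        also have "\<dots> \<le> E * (B * \<bar>s - t\<bar>)" using E n st by (intro mult_mono) auto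
        finally have 1: "\<bar>D (h t) \<bullet> (h s - h t)\<bar> \<le> E * (B * \<bar>s - t\<bar>)" .
        have "(norm (h s - h t))\<^sup>2 \<le> (B * \<bar>s - t\<bar>)\<^sup>2" using n by (intro power_mono) auto
        also have "\<dots> = B\<^sup>2 * (\<bar>s - t\<bar> * \<bar>s - t\<bar>)" by (simp add: power_mult_distrib power2_eq_square)
        also have "\<dots> \<le> B\<^sup>2 * (\<bar>b - a\<bar> * \<bar>s - t\<bar>)"
          using st by (intro mult_left_mono mult_right_mono) auto
        finally have "C * (norm (h s - h t))\<^sup>2 \<le> C * (B\<^sup>2 * (\<bar>b - a\<bar> * \<bar>s - t\<bar>))"
          using C by (rule mult_left_mono)
        then show "dist (\<Phi> (h s)) (\<Phi> (h t)) \<le> (E * B + C * B\<^sup>2 * \<bar>b - a\<bar>) * dist s t"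
          using 1 \<Phi>[of "h s" "h t"] by (simp add: dist_real_def algebra_simps)
      qed (use E B C in auto)
      then have "continuous_on {x..y} (\<lambda>t. \<Phi> (h t))"
        using lipschitz_on_continuous_on continuous_on_subset[OF _ sub] by blast
      then show "continuous_on {x..y} G"
        unfolding G_def by (intro continuous_intros bounded_primitive_continuous[OF q])
    qed (use E in auto)
    then show ?thesis by (simp add: G_def q_def)
  qed
  have "(p has_integral (\<Phi> (h y) - \<Phi> (h x))) {x..y}" if xy: "a \<le> x" "x \<le> y" "y \<le> b" for x y
  proof -
    have "p integrable_on {a..b}" using bounded_measurable_integrable[OF pm pB] .
    then have "p integrable_on {x..y}" using xy by (auto intro: integrable_subinterval_real)
    then show ?thesis using main[OF xy] by (simp add: has_integral_integrable_integral)
  qed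
  then show ?thesis
    unfolding bounded_primitive_def p_def[symmetric] using pB by blast
qed

text \<open>The map \<open>fst z * snd z\<close> has gradient \<open>prod.swap z\<close>, and its
  Taylor remainder is exactly the product of the two increments, so the chain rule applies with
  constant 1.\<close>

lemma bounded_primitive_mult:
  fixes X Y :: "real \<Rightarrow> real"
  assumes "bounded_primitive a b X v" "bounded_primitive a b Y w"
  shows "bounded_primitive a b (\<lambda>t. X t * Y t) (\<lambda>t. v t * Y t + X t * w t)"
proof -
  have "bounded_primitive a b (\<lambda>t. (\<lambda>z. fst z * snd z) (X t, Y t)) (\<lambda>t. prod.swap (X t, Y t) \<bullet> (v t, w t))"
  proof (rule bounded_primitive_chain[OF bounded_primitive_Pair[OF assms], where C = 1])
    show "continuous_on UNIV (prod.swap :: real \<times> real \<Rightarrow> _)" by (rule continuous_on_swap)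
    show "\<bar>fst y * snd y - fst x * snd x - prod.swap x \<bullet> (y - x)\<bar> \<le> 1 * (norm (y - x))\<^sup>2"
      for x y :: "real \<times> real"
    proof -
      obtain p q r s where [simp]: "x = (p, q)" "y = (r, s)" by (cases x; cases y)
      have "r * s - p * q - (q * (r - p) + p * (s - q)) = (r - p) * (s - q)" by (simp add: algebra_simps)
      moreover have "\<bar>(r - p) * (s - q)\<bar> \<le> (r - p)\<^sup>2 + (s - q)\<^sup>2"
      proof -
        have "2 * \<bar>r - p\<bar> * \<bar>s - q\<bar> \<le> (r - p)\<^sup>2 + (s - q)\<^sup>2"
          using sum_squares_bound[of "\<bar>r - p\<bar>" "\<bar>s - q\<bar>"] by simp
        moreover have "0 \<le> \<bar>r - p\<bar> * \<bar>s - q\<bar>" by simp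
        ultimately show ?thesis unfolding abs_mult by linarith
      qed
      ultimately show ?thesis
        by (simp add: norm_Pair inner_prod_def prod.swap_def)
    qed
  qed
  then show ?thesis by (simp add: inner_prod_def algebra_simps)
qed


lemma continuous_antiderivative:
  fixes F :: "real \<Rightarrow> real"
  assumes "continuous_on UNIV F"
  obtains I where "\<And>x. (I has_real_derivative F x) (at x)"
proof
  fix x :: real
  let ?a = "- \<bar>x\<bar> - 1" and ?b = "\<bar>x\<bar> + 1"
  have "((\<lambda>u. LBINT y=ereal 0..ereal u. F y) has_vector_derivative F x) (at x within {?a..?b})"
    by (rule interval_integral_FTC2) (use assms in \<open>auto intro: continuous_on_subset\<close>)
  moreover have "at x within {?a..?b} = at x"
    by (rule at_within_interior) (auto simp: interior_atLeastAtMost_real)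
  ultimately show "((\<lambda>u. LBINT y=ereal 0..ereal u. F y) has_real_derivative F x) (at x)"
    by (simp add: has_real_derivative_iff_has_vector_derivative)
qed

text \<open>Mollifying \<open>F\<close> by averages over \<open>[x, x + \<delta>]\<close> turns the right derivative into a pointwise
  limit of continuous derivatives.\<close>

lemma bounded_primitive_chain_right_derivative:
  fixes F \<phi> :: "real \<Rightarrow> real"
  assumes prim: "bounded_primitive a b \<eta> g" and lip: "L-lipschitz_on UNIV F"
    and \<phi>: "\<And>x. (F has_real_derivative \<phi> x) (at_right x)"
  shows "bounded_primitive a b (\<lambda>t. F (\<eta> t)) (\<lambda>t. \<phi> (\<eta> t) * g t)"
proof -
  have L: "L \<ge> 0" "\<And>x y. \<bar>F x - F y\<bar> \<le> L * \<bar>x - y\<bar>"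
    using lip by (auto simp: lipschitz_on_def dist_real_def)
  obtain I where I: "\<And>x. (I has_real_derivative F x) (at x)"
    using continuous_antiderivative[OF lipschitz_on_continuous_on[OF lip]] by blast
  have Iest: "\<bar>I y - I x - F x * (y - x)\<bar> \<le> L * (y - x)\<^sup>2" for x y
  proof -
    have *: "\<exists>z. min x y \<le> z \<and> z \<le> max x y \<and> I y - I x = (y - x) * F z"
    proof (cases x y rule: linorder_cases)
      case less
      then obtain z where "x < z" "z < y" "I y - I x = (y - x) * F z" using MVT2[of x y I F] I by blast
      then show ?thesis using less by (intro exI[of _ z]) (auto simp: min_def max_def)
    next
      case greater
      then obtain z where "y < z" "z < x" "I x - I y = (x - y) * F z" using MVT2[of y x I F] I by blast
      then show ?thesis using greater by (intro exI[of _ z]) (auto simp: min_def max_def algebra_simps)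
    qed auto
    then obtain z where z: "min x y \<le> z" "z \<le> max x y" "I y - I x = (y - x) * F z" by blast
    then have "\<bar>I y - I x - F x * (y - x)\<bar> = \<bar>F z - F x\<bar> * \<bar>y - x\<bar>"
      by (simp add: abs_mult[symmetric] algebra_simps)
    also have "\<dots> \<le> (L * \<bar>z - x\<bar>) * \<bar>y - x\<bar>" using L by (intro mult_right_mono) auto
    also have "\<dots> \<le> (L * \<bar>y - x\<bar>) * \<bar>y - x\<bar>"
      using L z by (intro mult_right_mono mult_left_mono) auto
    finally show ?thesis by (simp add: power2_eq_square mult.assoc)
  qed
  define \<delta> where "\<delta> k = inverse (real (Suc k))" for k
  have \<delta>: "\<delta> k > 0" "(\<lambda>k. \<delta> k) \<longlonglongrightarrow> 0" for k
    unfolding \<delta>_def by (simp, rule LIMSEQ_inverse_real_of_nat)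
  define Fk where "Fk k x = (I (x + \<delta> k) - I x) / \<delta> k" for k x
  define \<phi>k where "\<phi>k k x = (F (x + \<delta> k) - F x) / \<delta> k" for k x
  have Fc: "continuous_on UNIV F" by (rule lipschitz_on_continuous_on[OF lip])
  have \<phi>kc: "continuous_on UNIV (\<phi>k k)" for k
    unfolding \<phi>k_def using \<delta>(1)[of k]
    by (intro continuous_intros continuous_on_compose2[OF Fc] Fc) auto
  have pk: "bounded_primitive a b (\<lambda>t. Fk k (\<eta> t)) (\<lambda>t. \<phi>k k (\<eta> t) \<bullet> g t)" for k
  \<comment> \<open>The Taylor constant blows up as \<open>k\<close> grows, which is harmless: the
    chain rule is applied for each fixed \<open>k\<close>, and the passage to the limit relies on
    the uniform bound \<open>\<phi>kb\<close> alone.\<close>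
  proof (rule bounded_primitive_chain[OF prim \<phi>kc, where C = "2 * L / \<delta> k"])
    fix x y
    have "Fk k y - Fk k x - \<phi>k k x \<bullet> (y - x) = ((I (y + \<delta> k) - I (x + \<delta> k) - F (x + \<delta> k) * ((y + \<delta> k) - (x + \<delta> k)))
        - (I y - I x - F x * (y - x))) / \<delta> k"
      unfolding Fk_def \<phi>k_def by (simp add: diff_divide_distrib add_divide_distrib algebra_simps)
    also have "\<bar>\<dots>\<bar> \<le> (L * (y - x)\<^sup>2 + L * (y - x)\<^sup>2) / \<delta> k"
      using Iest[of "y + \<delta> k" "x + \<delta> k"] Iest[of y x] \<delta>(1)[of k]
      by (simp add: abs_divide divide_right_mono)
    finally show "\<bar>Fk k y - Fk k x - \<phi>k k x \<bullet> (y - x)\<bar> \<le> 2 * L / \<delta> k * (norm (y - x))\<^sup>2"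
      by simp
  qed
  have Flim: "(\<lambda>k. Fk k x) \<longlonglongrightarrow> F x" for x
  proof (rule LIM_zero_cancel)
    have e: "\<bar>Fk k x - F x\<bar> \<le> L * \<delta> k" for k
    proof -
      have "Fk k x - F x = (I (x + \<delta> k) - I x - F x * ((x + \<delta> k) - x)) / \<delta> k"
        unfolding Fk_def using \<delta>(1)[of k] by (simp add: field_simps)
      also have "\<bar>\<dots>\<bar> \<le> L * (\<delta> k)\<^sup>2 / \<delta> k"
        using Iest[of "x + \<delta> k" x] \<delta>(1)[of k] by (simp add: abs_divide divide_right_mono)
      finally show ?thesis using \<delta>(1)[of k] by (simp add: power2_eq_square)
    qed
    have "(\<lambda>k. L * \<delta> k) \<longlonglongrightarrow> L * 0" by (intro tendsto_intros \<delta>)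
    then have "(\<lambda>k. L * \<delta> k) \<longlonglongrightarrow> 0" by simp
    then show "(\<lambda>k. Fk k x - F x) \<longlonglongrightarrow> 0"
      by (rule Lim_null_comparison[rotated]) (use e in auto)
  qed
  have \<phi>lim: "(\<lambda>k. \<phi>k k x) \<longlonglongrightarrow> \<phi> x" for x
  proof -
    have "((\<lambda>y. (F y - F x) / (y - x)) \<longlongrightarrow> \<phi> x) (at_right x)"
      using \<phi>[of x] by (simp add: has_field_derivative_iff)
    moreover have "filterlim (\<lambda>k. x + \<delta> k) (at_right x) sequentially"
    proof -
      have "(\<lambda>k. x + \<delta> k) \<longlonglongrightarrow> x + 0" by (intro tendsto_intros \<delta>)
      then show ?thesis
        unfolding filterlim_at using \<delta>(1) by (simp add: less_imp_neq[symmetric] eventually_True)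
    qed
    ultimately have "(\<lambda>k. (F (x + \<delta> k) - F x) / ((x + \<delta> k) - x)) \<longlonglongrightarrow> \<phi> x"
      by (rule filterlim_compose)
    then show ?thesis by (simp add: \<phi>k_def)
  qed
  have \<phi>kb: "\<bar>\<phi>k k x\<bar> \<le> L" for k x
    unfolding \<phi>k_def using L(2)[of "x + \<delta> k" x] \<delta>(1)[of k]
    by (simp add: abs_divide divide_le_eq)
  have \<phi>b: "\<bar>\<phi> x\<bar> \<le> L" for x
    by (rule LIMSEQ_le_const2[OF tendsto_rabs[OF \<phi>lim]]) (use \<phi>kb in auto)
  obtain B where B: "B > 0" "\<And>x. x \<in> {a..b} \<Longrightarrow> norm (g x) \<le> B"
    using bounded_primitive_diff_bound[OF prim] by metis
  have "((\<lambda>t. \<phi> (\<eta> t) * g t) has_integral (F (\<eta> y) - F (\<eta> x))) {x..y}"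
    if xy: "a \<le> x" "x \<le> y" "y \<le> b" for x y
  proof -
    have hk: "((\<lambda>t. \<phi>k k (\<eta> t) * g t) has_integral (Fk k (\<eta> y) - Fk k (\<eta> x))) {x..y}" for k
      using pk[of k] xy unfolding bounded_primitive_def by auto
    have 1: "(\<lambda>t. \<phi>k k (\<eta> t) * g t) integrable_on {x..y}" for k
      using hk by (rule has_integral_integrable)
    have 2: "(\<lambda>_. L * B) integrable_on {x..y}" by (rule integrable_const_ivl)
    have 3: "norm (\<phi>k k (\<eta> t) * g t) \<le> L * B" if "t \<in> {x..y}" for k t
      using \<phi>kb[of k "\<eta> t"] B(2)[of t] that xy L(1) by (simp add: abs_mult mult_mono)
    have 4: "(\<lambda>k. \<phi>k k (\<eta> t) * g t) \<longlonglongrightarrow> \<phi> (\<eta> t) * g t" for t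
      by (intro tendsto_intros \<phi>lim)
    note dc = dominated_convergence[OF 1 2 3 4]
    have "(\<lambda>k. integral {x..y} (\<lambda>t. \<phi>k k (\<eta> t) * g t)) \<longlonglongrightarrow> integral {x..y} (\<lambda>t. \<phi> (\<eta> t) * g t)"
      using dc(2) by simp
    moreover have "(\<lambda>k. integral {x..y} (\<lambda>t. \<phi>k k (\<eta> t) * g t)) \<longlonglongrightarrow> F (\<eta> y) - F (\<eta> x)"
      using tendsto_diff[OF Flim[of "\<eta> y"] Flim[of "\<eta> x"]] integral_unique[OF hk] by simp
    ultimately have "integral {x..y} (\<lambda>t. \<phi> (\<eta> t) * g t) = F (\<eta> y) - F (\<eta> x)"
      using LIMSEQ_unique by blast
    then show ?thesis using dc(1) by (simp add: has_integral_integrable_integral)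
  qed
  moreover have "\<forall>t\<in>{a..b}. norm (\<phi> (\<eta> t) * g t) \<le> L * B"
    using \<phi>b B L(1) by (auto simp: abs_mult intro!: mult_mono)
  ultimately show ?thesis unfolding bounded_primitive_def by blast
qed

section \<open>Angles and rotations in the plane\<close>

definition dir :: "real \<Rightarrow> real \<times> real" where
  "dir \<phi> = (cos \<phi>, sin \<phi>)"

definition rot90 :: "real \<times> real \<Rightarrow> real \<times> real" where
  "rot90 z = (- snd z, fst z)"

definition rotate_by :: "real \<Rightarrow> real \<times> real \<Rightarrow> real \<times> real" where
  "rotate_by \<alpha> z = (cos \<alpha> * fst z - sin \<alpha> * snd z, sin \<alpha> * fst z + cos \<alpha> * snd z)"

lemma rotate_by_dir: "rotate_by \<alpha> (r *\<^sub>R dir \<phi>) = r *\<^sub>R dir (\<alpha> + \<phi>)"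
  by (simp add: rotate_by_def dir_def cos_add sin_add algebra_simps)

lemma rotate_by_add: "rotate_by \<alpha> (rotate_by \<beta> z) = rotate_by (\<alpha> + \<beta>) z"
  by (simp add: rotate_by_def cos_add sin_add algebra_simps)

lemma rotate_by_0 [simp]: "rotate_by 0 z = z"
  by (simp add: rotate_by_def)

lemma norm_dir [simp]: "norm (dir \<phi>) = 1"
  by (simp add: dir_def norm_Pair)

lemma dir_nonzero [simp]: "dir \<phi> \<noteq> 0"
  using norm_dir[of \<phi>] by fastforce

lemma rotate_by_continuous: "continuous_on UNIV (rotate_by \<alpha>)"
  unfolding rotate_by_def by (intro continuous_intros)

lemma ang_eq_Arg2pi: "ang z = Arg2pi (Complex (fst z) (snd z))"
proof (cases "z = 0")
  case True
  then show ?thesis by (simp add: ang_def zero_complex.code[symmetric] Arg_zero)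
next
  case False
  let ?c = "Complex (fst z) (snd z)"
  have c: "?c \<noteq> 0" using False by (simp add: Complex_eq_0 prod_eq_iff)
  have "Arg2pi ?c = (if Arg ?c < 0 then Arg ?c + 2 * pi else Arg ?c)"
  proof (rule Arg2pi_unique)
    have "exp (\<i> * of_real (Arg ?c + 2 * pi)) = exp (\<i> * of_real (Arg ?c))"
      by (simp add: ring_distribs exp_add mult.commute)
    then show "of_real (cmod ?c) * exp (\<i> * of_real (if Arg ?c < 0 then Arg ?c + 2 * pi else Arg ?c)) = ?c"
      using Arg_eq[OF c] by auto
  qed (use c mpi_less_Arg[of ?c] Arg_le_pi[of ?c] pi_gt_zero in auto)
  then show ?thesis by (simp add: ang_def Let_def)
qed

lemma ang_bounds: "0 \<le> ang z" "ang z < 2 * pi"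
  using Arg2pi by (auto simp: ang_eq_Arg2pi)

lemma polar_form: "z = norm z *\<^sub>R dir (ang z)"
proof -
  have "norm z = cmod (Complex (fst z) (snd z))"
    by (simp add: norm_prod_def cmod_def)
  then show ?thesis
    using cos_Arg2pi[of "Complex (fst z) (snd z)"] sin_Arg2pi[of "Complex (fst z) (snd z)"]
    by (simp add: dir_def ang_eq_Arg2pi prod_eq_iff)
qed

lemma ang_dir:
  assumes "r > 0" "0 \<le> \<phi>" "\<phi> < 2 * pi"
  shows "ang (r *\<^sub>R dir \<phi>) = \<phi>"
  unfolding ang_eq_Arg2pi
  by (rule Arg2pi_unique[of r]) (use assms in \<open>auto simp: dir_def exp_Euler complex_eq_iff cos_of_real sin_of_real\<close>)

text \<open>\<open>Arg\<close> is continuous off the closed nonpositive real axis and equals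
  \<open>pi\<close> on that axis except at the origin, so it is a piecewise continuous patchwork
  over Borel sets.\<close>

lemma ang_measurable: "ang \<in> borel_measurable borel"
proof -
  have "(\<lambda>z. if z \<in> \<real>\<^sub>\<le>\<^sub>0 then pi else Arg z) \<in> borel_measurable borel"
    by (rule borel_measurable_continuous_on_if) (auto intro: continuous_on_Arg)
  then have "(\<lambda>z. if z = 0 then 0 else if z \<in> \<real>\<^sub>\<le>\<^sub>0 then pi else Arg z) \<in> borel_measurable borel"
    by measurable
  moreover have "(\<lambda>z. if z = 0 then 0 else if z \<in> \<real>\<^sub>\<le>\<^sub>0 then pi else Arg z) = Arg"
  proof (rule ext)
    fix z
    have "Arg z = pi" if "z \<noteq> 0" "z \<in> \<real>\<^sub>\<le>\<^sub>0"
      using that Arg_eq_pi[of z] by (auto simp: complex_nonpos_Reals_iff complex_eq_iff)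
    then show "(if z = 0 then 0 else if z \<in> \<real>\<^sub>\<le>\<^sub>0 then pi else Arg z) = Arg z"
      by (auto simp: Arg_zero)
  qed
  ultimately have A: "Arg \<in> borel_measurable borel" by simp
  have c: "continuous_on UNIV (\<lambda>z. Complex (fst z) (snd z))"
    unfolding Complex_eq by (intro continuous_intros)
  have [measurable]: "(\<lambda>z. Arg (Complex (fst z) (snd z))) \<in> borel_measurable borel"
    using measurable_compose[OF borel_measurable_continuous_onI[OF c] A] .
  show ?thesis unfolding ang_def Let_def by measurable
qed

section \<open>Rotation invariance of planar Lebesgue measure\<close>

lemma emeasure_translation_real:
  fixes S :: "real set"
  assumes "S \<in> sets borel"
  shows "emeasure lborel ((\<lambda>x. c + x) -` S) = emeasure lborel S"
proof -
  have "emeasure lborel S = emeasure (distr lborel borel ((+) c)) S"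
    by (simp add: lborel_distr_plus)
  also have "\<dots> = emeasure lborel ((\<lambda>x. c + x) -` S)"
    using assms by (subst emeasure_distr) auto
  finally show ?thesis by simp
qed

lemma emeasure_plane_horizontal:
  fixes E :: "(real \<times> real) set"
  assumes "E \<in> sets borel"
  shows "emeasure lborel E = (\<integral>\<^sup>+y. emeasure lborel ((\<lambda>x. (x, y)) -` E) \<partial>lborel)"
proof -
  have "E \<in> sets (lborel \<Otimes>\<^sub>M lborel)" using assms unfolding lborel_prod by simp
  from lborel_pair.emeasure_pair_measure_alt2[OF this] show ?thesis by (simp add: lborel_prod)
qed

lemma emeasure_plane_vertical:
  fixes E :: "(real \<times> real) set"
  assumes "E \<in> sets borel"
  shows "emeasure lborel E = (\<integral>\<^sup>+x. emeasure lborel (Pair x -` E) \<partial>lborel)"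
proof -
  have "E \<in> sets (lborel \<Otimes>\<^sub>M lborel)" using assms unfolding lborel_prod by simp
  from lborel.emeasure_pair_measure_alt[OF this] show ?thesis by (simp add: lborel_prod)
qed

lemma borel_slice:
  fixes E :: "(real \<times> real) set"
  assumes "E \<in> sets borel"
  shows "(\<lambda>x. (x, y)) -` E \<in> sets borel" "Pair x -` E \<in> sets borel"
proof -
  have "(\<lambda>x. (x, y)) \<in> borel \<rightarrow>\<^sub>M borel" "Pair x \<in> borel \<rightarrow>\<^sub>M borel"
    by (auto intro!: borel_measurable_continuous_onI continuous_intros)
  from measurable_sets[OF this(1) assms] measurable_sets[OF this(2) assms]
  show "(\<lambda>x. (x, y)) -` E \<in> sets borel" "Pair x -` E \<in> sets borel" by auto
qed

text \<open>A shear translates every slice parallel to its direction, so integrating over slices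
  reduces the claim to translation invariance on the line.\<close>

lemma emeasure_shear:
  fixes E :: "(real \<times> real) set"
  assumes E: "E \<in> sets borel"
  shows "emeasure lborel ((\<lambda>z. (fst z + k * snd z, snd z)) -` E) = emeasure lborel E"
    and "emeasure lborel ((\<lambda>z. (fst z, snd z + k * fst z)) -` E) = emeasure lborel E"
proof -
  have "(\<lambda>z::real\<times>real. (fst z + k * snd z, snd z)) \<in> borel \<rightarrow>\<^sub>M borel"
    by (intro borel_measurable_continuous_onI continuous_intros)
  from measurable_sets[OF this E]
  have 1: "(\<lambda>z. (fst z + k * snd z, snd z)) -` E \<in> sets borel" by simp
  have "(\<lambda>z::real\<times>real. (fst z, snd z + k * fst z)) \<in> borel \<rightarrow>\<^sub>M borel"
    by (intro borel_measurable_continuous_onI continuous_intros)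
  from measurable_sets[OF this E]
  have 2: "(\<lambda>z. (fst z, snd z + k * fst z)) -` E \<in> sets borel" by simp
  have "(\<lambda>x. (x, y)) -` (\<lambda>z. (fst z + k * snd z, snd z)) -` E
      = (\<lambda>x. k * y + x) -` ((\<lambda>x. (x, y)) -` E)" for y
    by (auto simp: add.commute)
  then have "emeasure lborel ((\<lambda>x. (x, y)) -` (\<lambda>z. (fst z + k * snd z, snd z)) -` E)
      = emeasure lborel ((\<lambda>x. (x, y)) -` E)" for y
    using emeasure_translation_real[OF borel_slice(1)[OF E], of "k * y" y] by simp
  then show "emeasure lborel ((\<lambda>z. (fst z + k * snd z, snd z)) -` E) = emeasure lborel E"
    by (simp add: emeasure_plane_horizontal[OF 1] emeasure_plane_horizontal[OF E])
  have "Pair x -` (\<lambda>z. (fst z, snd z + k * fst z)) -` E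
      = (\<lambda>y. k * x + y) -` (Pair x -` E)" for x
    by (auto simp: add.commute)
  then have "emeasure lborel (Pair x -` (\<lambda>z. (fst z, snd z + k * fst z)) -` E)
      = emeasure lborel (Pair x -` E)" for x
    using emeasure_translation_real[OF borel_slice(2)[OF E], of "k * x" x] by simp
  then show "emeasure lborel ((\<lambda>z. (fst z, snd z + k * fst z)) -` E) = emeasure lborel E"
    by (simp add: emeasure_plane_vertical[OF 2] emeasure_plane_vertical[OF E])
qed

lemma borel_rotate_vimage:
  assumes "E \<in> sets borel" shows "rotate_by \<alpha> -` E \<in> sets borel"
  using measurable_sets[OF borel_measurable_continuous_onI[OF rotate_by_continuous] assms, of \<alpha>] by simp

text \<open>A rotation by an angle in \<open>(-\<pi>, \<pi>)\<close> is a product of three shears.\<close>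

lemma emeasure_rotate_half:
  assumes E: "E \<in> sets borel" and "cos (\<alpha> / 2) \<noteq> 0"
  shows "emeasure lborel (rotate_by \<alpha> -` E) = emeasure lborel E"
proof -
  \<comment> \<open>A horizontal shear by \<open>- tan (\<alpha> / 2)\<close> is applied before and
    after a vertical shear by \<open>sin \<alpha>\<close>. The half-angle identities
    \<open>st\<close> and \<open>tc\<close> turn the entries of the product into those of the
    rotation matrix.\<close>
  define t where "t = tan (\<alpha> / 2)"
  let ?X = "\<lambda>z::real\<times>real. (fst z + (- t) * snd z, snd z)"
  let ?Y = "\<lambda>z::real\<times>real. (fst z, snd z + sin \<alpha> * fst z)"
  have s: "sin \<alpha> = 2 * sin (\<alpha>/2) * cos (\<alpha>/2)" and c: "cos \<alpha> = 1 - 2 * (sin (\<alpha>/2))\<^sup>2"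
    using sin_double[of "\<alpha>/2"] cos_double_sin[of "\<alpha>/2"] by simp_all
  have t: "t * cos (\<alpha>/2) = sin (\<alpha>/2)" using assms(2) by (simp add: t_def tan_def)
  have st: "t * sin \<alpha> = 1 - cos \<alpha>" 
  proof -
    have "t * sin \<alpha> = 2 * sin (\<alpha>/2) * (t * cos (\<alpha>/2))" unfolding s by (simp only: ac_simps)
    then show ?thesis unfolding t c by (simp add: power2_eq_square)
  qed
  have tc: "t * (1 + cos \<alpha>) = sin \<alpha>"
  proof -
    have "1 + cos \<alpha> = 2 * (cos (\<alpha>/2))\<^sup>2" using cos_double_cos[of "\<alpha>/2"] by simp
    then have "t * (1 + cos \<alpha>) = 2 * (t * cos (\<alpha>/2)) * cos (\<alpha>/2)"
      by (simp only: power2_eq_square ac_simps)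
    then show ?thesis unfolding t s .
  qed
  have eq: "rotate_by \<alpha> z = ?X (?Y (?X z))" for z
  proof -
    obtain x y where z: "z = (x, y)" by (cases z)
    have "x - t * y - t * (y + sin \<alpha> * (x - t * y)) = (1 - t * sin \<alpha>) * x - t * (2 - t * sin \<alpha>) * y"
      by (simp add: algebra_simps)
    also have "\<dots> = cos \<alpha> * x - sin \<alpha> * y"
    proof -
      have "1 - t * sin \<alpha> = cos \<alpha>" "2 - t * sin \<alpha> = 1 + cos \<alpha>" using st by simp_all
      then show ?thesis by (simp only: tc)
    qed
    finally have 1: "x - t * y - t * (y + sin \<alpha> * (x - t * y)) = cos \<alpha> * x - sin \<alpha> * y" .
    have "y + sin \<alpha> * (x - t * y) = sin \<alpha> * x + (1 - t * sin \<alpha>) * y" by (simp add: algebra_simps)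
    then have 2: "y + sin \<alpha> * (x - t * y) = sin \<alpha> * x + cos \<alpha> * y" using st by simp
    show ?thesis using 1 2 by (simp add: rotate_by_def z)
  qed
  have X: "?X -` S \<in> sets borel" if "S \<in> sets borel" for S
  proof -
    have "?X \<in> borel \<rightarrow>\<^sub>M borel" by (intro borel_measurable_continuous_onI continuous_intros)
    from measurable_sets[OF this that] show ?thesis by simp
  qed
  have Y: "?Y -` S \<in> sets borel" if "S \<in> sets borel" for S
  proof -
    have "?Y \<in> borel \<rightarrow>\<^sub>M borel" by (intro borel_measurable_continuous_onI continuous_intros)
    from measurable_sets[OF this that] show ?thesis by simp
  qed
  have "rotate_by \<alpha> -` E = ?X -` (?Y -` (?X -` E))" by (auto simp: eq)
  then show ?thesis
    using emeasure_shear(1)[OF Y[OF X[OF E]], of "- t"] emeasure_shear(2)[OF X[OF E], of "sin \<alpha>"]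
      emeasure_shear(1)[OF E, of "- t"] by simp
qed

text \<open>Halving the angle brings it into the interval from \<open>- pi\<close> to
  \<open>pi\<close>, where the shear coefficient \<open>tan (\<alpha> / 4)\<close> is finite; the
  half rotation is then applied twice.\<close>

lemma emeasure_rotate:
  assumes E: "E \<in> sets borel" and "\<bar>\<alpha>\<bar> < 2 * pi"
  shows "emeasure lborel (rotate_by \<alpha> -` E) = emeasure lborel E"
proof -
  have "cos (\<alpha> / 2 / 2) \<noteq> 0"
    using cos_gt_zero_pi[of "\<alpha> / 2 / 2"] assms(2) by (simp add: abs_less_iff)
  note half = emeasure_rotate_half[OF _ this]
  have "rotate_by \<alpha> -` E = rotate_by (\<alpha>/2) -` (rotate_by (\<alpha>/2) -` E)"
    unfolding vimage_def by (simp add: rotate_by_add)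
  then show ?thesis using half[OF E] half[OF borel_rotate_vimage[OF E]] by simp
qed

lemma fst_snd_borel [measurable]:
  "(fst :: real \<times> real \<Rightarrow> real) \<in> borel_measurable borel"
  "(snd :: real \<times> real \<Rightarrow> real) \<in> borel_measurable borel"
  by (auto intro!: borel_measurable_continuous_onI continuous_intros)

text \<open>Used to sandwich a thin sector: the triangle with strict upper edge fits inside it, the
  one with nonstrict edge covers it.\<close>

lemma emeasure_triangle:
  assumes "a \<ge> 0" "k \<ge> 0"
  shows "emeasure lborel {z::real\<times>real. 0 < fst z \<and> fst z \<le> a \<and> 0 < snd z \<and> snd z \<le> k * fst z} = ennreal (k * a\<^sup>2 / 2)"
    and "emeasure lborel {z::real\<times>real. 0 < fst z \<and> fst z \<le> a \<and> 0 < snd z \<and> snd z < k * fst z} = ennreal (k * a\<^sup>2 / 2)"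
proof -
  have int: "(\<integral>\<^sup>+x. ennreal (k * x) * indicator {0..a} x \<partial>lborel) = ennreal (k * a\<^sup>2 / 2)"
  proof -
    have "((\<lambda>x. k * x\<^sup>2 / 2) has_real_derivative k * x) (at x)" for x
      by (auto intro!: derivative_eq_intros)
    then show ?thesis
      using nn_integral_FTC_Icc[of "\<lambda>x. k * x" 0 a "\<lambda>x. k * x\<^sup>2 / 2"] assms by auto
  qed
  let ?A = "{z::real\<times>real. 0 < fst z \<and> fst z \<le> a \<and> 0 < snd z \<and> snd z \<le> k * fst z}"
  let ?B = "{z::real\<times>real. 0 < fst z \<and> fst z \<le> a \<and> 0 < snd z \<and> snd z < k * fst z}"
  have A: "?A \<in> sets borel" and B: "?B \<in> sets borel" by simp_all
  have "emeasure lborel (Pair x -` ?A) = ennreal (k * x) * indicator {0..a} x" for x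
  proof -
    have "Pair x -` ?A = (if 0 < x \<and> x \<le> a then {0<..k*x} else {})" by auto
    then show ?thesis using assms by (auto simp: indicator_def)
  qed
  then show "emeasure lborel ?A = ennreal (k * a\<^sup>2 / 2)"
    using int by (simp add: emeasure_plane_vertical[OF A])
  have "emeasure lborel (Pair x -` ?B) = ennreal (k * x) * indicator {0..a} x" for x
  proof -
    have "Pair x -` ?B = (if 0 < x \<and> x \<le> a then {0<..<k*x} else {})" by auto
    then show ?thesis using assms by (auto simp: indicator_def)
  qed
  then show "emeasure lborel ?B = ennreal (k * a\<^sup>2 / 2)"
    using int by (simp add: emeasure_plane_vertical[OF B])
qed

section \<open>Planar gauges\<close>

text \<open>An asymmetric norm on the plane. Homogeneity is restricted to nonnegative factors
  because the convex sets to be described need not be symmetric about the origin.\<close>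

locale planar_gauge =
  fixes g :: "real \<times> real \<Rightarrow> real"
  assumes hom: "r \<ge> 0 \<Longrightarrow> g (r *\<^sub>R z) = r * g z"
    and subadd: "g (x + y) \<le> g x + g y"
    and pos: "z \<noteq> 0 \<Longrightarrow> g z > 0"
begin

lemma zero [simp]: "g 0 = 0"
  using hom[of 0 0] by simp

lemma nonneg: "g z \<ge> 0"
  using pos[of z] by (cases "z = 0") auto

text \<open>Both signs of each axis direction enter because \<open>g (- z)\<close> may differ from
  \<open>g z\<close>. The sum serves at once as a bound for \<open>g\<close> on unit vectors and as
  a Lipschitz constant.\<close>

definition lip :: real where
  "lip = g (1,0) + g (-1,0) + g (0,1) + g (0,-1)"

lemma lip_pos: "lip > 0"
  unfolding lip_def using pos[of "(1,0)"] nonneg[of "(-1,0)"] nonneg[of "(0,1)"] nonneg[of "(0,-1)"]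
  by (simp add: zero_prod_def)

lemma upper: "g z \<le> lip * norm z"
proof -
  obtain a b where z: "z = (a, b)" by (cases z)
  have "g (a, 0) \<le> \<bar>a\<bar> * (g (1,0) + g (-1,0))"
    using hom[of "\<bar>a\<bar>" "(1,0)"] hom[of "\<bar>a\<bar>" "(-1,0)"] nonneg[of "(1,0)"] nonneg[of "(-1,0)"]
    by (cases "a \<ge> 0") (auto simp: distrib_left mult_nonpos_nonneg)
  also have "\<dots> \<le> norm z * (g (1,0) + g (-1,0))"
    using norm_fst_le[of a b] nonneg[of "(1,0)"] nonneg[of "(-1,0)"] by (intro mult_right_mono) (auto simp: z)
  finally have 1: "g (a, 0) \<le> norm z * (g (1,0) + g (-1,0))" .
  have "g (0, b) \<le> \<bar>b\<bar> * (g (0,1) + g (0,-1))"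
    using hom[of "\<bar>b\<bar>" "(0,1)"] hom[of "\<bar>b\<bar>" "(0,-1)"] nonneg[of "(0,1)"] nonneg[of "(0,-1)"]
    by (cases "b \<ge> 0") (auto simp: distrib_left mult_nonpos_nonneg)
  also have "\<dots> \<le> norm z * (g (0,1) + g (0,-1))"
    using norm_snd_le[of b a] nonneg[of "(0,1)"] nonneg[of "(0,-1)"] by (intro mult_right_mono) (auto simp: z)
  finally have 2: "g (0, b) \<le> norm z * (g (0,1) + g (0,-1))" .
  have "g z \<le> g (a, 0) + g (0, b)" using subadd[of "(a,0)" "(0,b)"] by (simp add: z)
  then show ?thesis using 1 2 by (simp add: lip_def algebra_simps)
qed

lemma lipschitz: "lip-lipschitz_on UNIV g"
proof (rule lipschitz_onI)
  fix x y
  have "g x \<le> g y + g (x - y)" "g y \<le> g x + g (y - x)"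
    using subadd[of y "x - y"] subadd[of x "y - x"] by simp_all
  then show "dist (g x) (g y) \<le> lip * dist x y"
    using upper[of "x - y"] upper[of "y - x"]
    by (simp add: dist_real_def dist_norm norm_minus_commute abs_le_iff)
qed (use lip_pos in simp)

lemma continuous: "continuous_on A g"
  using lipschitz_on_continuous_on[OF lipschitz] continuous_on_subset by blast

lemma lower:
  obtains \<delta> where "\<delta> > 0" "\<And>z. g z \<ge> \<delta> * norm z"
proof -
  have "compact (sphere (0::real\<times>real) 1)" by simp
  moreover have "sphere (0::real\<times>real) 1 \<noteq> {}" using norm_dir[of 0] by force
  ultimately obtain z0 where z0: "z0 \<in> sphere 0 1" "\<And>z. z \<in> sphere 0 1 \<Longrightarrow> g z0 \<le> g z"
    using continuous_attains_inf[OF _ _ continuous] by meson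
  have "g z0 * norm z \<le> g z" for z
  proof (cases "z = 0")
    case False
    then have "g z0 \<le> g (z /\<^sub>R norm z)" by (intro z0) simp
    also have "\<dots> = g z / norm z" by (simp add: hom divide_inverse mult.commute)
    finally show ?thesis using False by (simp add: field_simps)
  qed simp
  moreover have "g z0 > 0" using z0(1) by (intro pos) auto
  ultimately show thesis using that by blast
qed

definition K :: "(real \<times> real) set" where "K = {z. g z \<le> 1}"

lemma compact_K: "compact K"
proof -
  obtain \<delta> where \<delta>: "\<delta> > 0" "\<And>z. g z \<ge> \<delta> * norm z" using lower by blast
  have "norm z \<le> 1 / \<delta>" if "z \<in> K" for z
    using \<delta>(2)[of z] that \<delta>(1) by (simp add: K_def field_simps)
  then have "bounded K" using bounded_iff by blast
  moreover have "closed K" unfolding K_def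
    by (intro closed_Collect_le continuous continuous_intros)
  ultimately show ?thesis by (simp add: compact_eq_bounded_closed)
qed

lemma interior_K: "interior K = {z. g z < 1}"
proof
  have "open {z. g z < 1}" by (intro open_Collect_less continuous continuous_intros)
  then show "{z. g z < 1} \<subseteq> interior K" by (intro interior_maximal) (auto simp: K_def)
  show "interior K \<subseteq> {z. g z < 1}"
  proof
    fix z assume z: "z \<in> interior K"
    then obtain e where e: "e > 0" "ball z e \<subseteq> K" by (meson mem_interior)
    show "z \<in> {z. g z < 1}"
    proof (cases "z = 0")
      case False
      \<comment> \<open>The factor \<open>s > 1\<close> keeps \<open>s *\<^sub>R z\<close> within
        the ball contained in \<open>K\<close>, while homogeneity makes the gauge strictly larger
        there.\<close>
      define s where "s = 1 + e / (2 * norm z)"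
      have s: "s > 1" using e(1) False by (simp add: s_def)
      have "dist z (s *\<^sub>R z) = e / 2"
      proof -
        have "s *\<^sub>R z - z = (e / (2 * norm z)) *\<^sub>R z" by (simp add: s_def algebra_simps)
        then have "norm (s *\<^sub>R z - z) = e / 2" using e(1) False by simp
        then show ?thesis by (simp add: dist_norm norm_minus_commute)
      qed
      then have "s *\<^sub>R z \<in> K" using e by auto
      then have "s * g z \<le> 1" using s by (simp add: K_def hom)
      moreover have "g z < s * g z" using s pos[OF False] by simp
      ultimately show ?thesis by simp
    qed simp
  qed
qed

lemma frontier_K: "frontier K = {z. g z = 1}"
  unfolding frontier_def interior_K closure_closed[OF compact_imp_closed[OF compact_K]]
  by (auto simp: K_def)

section \<open>Radial function and boundary points in polar coordinates\<close>

definition \<rho> :: "real \<Rightarrow> real" where "\<rho> \<phi> = 1 / g (dir \<phi>)"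

definition bd :: "real \<Rightarrow> real \<times> real" where "bd \<phi> = \<rho> \<phi> *\<^sub>R dir \<phi>"

lemma g_dir_pos: "g (dir \<phi>) > 0" by (rule pos) simp

lemma \<rho>_pos: "\<rho> \<phi> > 0" by (simp add: \<rho>_def g_dir_pos)

lemma g_bd [simp]: "g (bd \<phi>) = 1"
  using \<rho>_pos[of \<phi>] g_dir_pos[of \<phi>] by (simp add: bd_def hom) (simp add: \<rho>_def)

lemma dir_lipschitz: "norm (dir x - dir y) \<le> 2 * \<bar>x - y\<bar>"
proof -
  have "norm (cos x - cos y) \<le> 1 * norm (x - y)"
    by (rule field_differentiable_bound[of UNIV cos "\<lambda>x. - sin x" 1])
       (auto intro!: derivative_eq_intros)
  moreover have "norm (sin x - sin y) \<le> 1 * norm (x - y)"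
    by (rule field_differentiable_bound[of UNIV sin cos 1])
       (auto intro!: derivative_eq_intros)
  ultimately show ?thesis
    using norm_Pair_le[of "cos x - cos y" "sin x - sin y"] by (simp add: dir_def)
qed

lemma \<rho>_bounds:
  obtains lo hi where "lo > 0" "\<And>\<phi>. lo \<le> \<rho> \<phi>" "\<And>\<phi>. \<rho> \<phi> \<le> hi"
proof -
  obtain \<delta> where \<delta>: "\<delta> > 0" "\<And>z. g z \<ge> \<delta> * norm z" using lower by blast
  have "1 / lip \<le> \<rho> \<phi>" for \<phi>
    using upper[of "dir \<phi>"] g_dir_pos[of \<phi>] lip_pos by (simp add: \<rho>_def frac_le)
  moreover have "\<rho> \<phi> \<le> 1 / \<delta>" for \<phi>
    using \<delta>(2)[of "dir \<phi>"] g_dir_pos[of \<phi>] \<delta>(1) by (simp add: \<rho>_def frac_le)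
  ultimately show thesis using that[of "1 / lip" "1 / \<delta>"] lip_pos by simp
qed

lemma \<rho>_lipschitz:
  obtains L where "L \<ge> 0" "\<And>x y. \<bar>\<rho> x - \<rho> y\<bar> \<le> L * \<bar>x - y\<bar>"
proof -
  obtain lo hi where b: "lo > 0" "\<And>\<phi>. lo \<le> \<rho> \<phi>" "\<And>\<phi>. \<rho> \<phi> \<le> hi" using \<rho>_bounds by blast
  have hi: "hi > 0" using b(1) b(2)[of 0] b(3)[of 0] by simp
  have "\<bar>\<rho> x - \<rho> y\<bar> \<le> (hi * hi * (lip * 2)) * \<bar>x - y\<bar>" for x y
  proof -
    have "\<rho> x - \<rho> y = \<rho> x * \<rho> y * (g (dir y) - g (dir x))"
      using g_dir_pos[of x] g_dir_pos[of y] by (simp add: \<rho>_def field_simps)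
    then have "\<bar>\<rho> x - \<rho> y\<bar> = \<rho> x * \<rho> y * \<bar>g (dir y) - g (dir x)\<bar>"
      using \<rho>_pos[of x] \<rho>_pos[of y] by (simp add: abs_mult)
    also have "\<dots> \<le> (hi * hi) * (lip * (2 * \<bar>x - y\<bar>))"
    proof (intro mult_mono b)
      have "\<bar>g (dir y) - g (dir x)\<bar> \<le> lip * norm (dir y - dir x)"
        using lipschitz_onD[OF lipschitz, of "dir y" "dir x"] by (simp add: dist_norm)
      also have "\<dots> \<le> lip * (2 * \<bar>x - y\<bar>)"
        using dir_lipschitz[of y x] lip_pos by (simp add: abs_minus_commute)
      finally show "\<bar>g (dir y) - g (dir x)\<bar> \<le> lip * (2 * \<bar>x - y\<bar>)" .
    qed (use hi \<rho>_pos less_imp_le in auto)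
    finally show ?thesis by (simp add: mult.assoc)
  qed
  then show thesis using that[of "hi * hi * (lip * 2)"] hi lip_pos by simp
qed

lemma \<rho>_continuous: "continuous_on A \<rho>"
proof -
  obtain L where "L \<ge> 0" "\<And>x y. \<bar>\<rho> x - \<rho> y\<bar> \<le> L * \<bar>x - y\<bar>" using \<rho>_lipschitz by blast
  then have "L-lipschitz_on A \<rho>" by (intro lipschitz_onI) (auto simp: dist_real_def)
  then show ?thesis by (rule lipschitz_on_continuous_on)
qed

lemma dir_periodic: "dir (\<phi> + 2 * pi) = dir \<phi>"
  by (simp add: dir_def)

lemma \<rho>_periodic: "\<rho> (\<phi> + 2 * pi) = \<rho> \<phi>"
  by (simp add: \<rho>_def dir_periodic)

text \<open>By the area formula in polar coordinates this is twice the area swept from angle 0. It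
  is an antiderivative on the whole line, so negative angles and angles beyond one turn are covered
  and periodicity is unrolled. The link with Lebesgue measure is
  \<open>sector_measure\<close>.\<close>

definition area :: "real \<Rightarrow> real" where
  "area = (SOME I. I 0 = 0 \<and> (\<forall>x. (I has_real_derivative (\<rho> x)\<^sup>2) (at x)))"

lemma area_0 [simp]: "area 0 = 0"
  and area_deriv: "(area has_real_derivative (\<rho> x)\<^sup>2) (at x)"
proof -
  have "continuous_on UNIV (\<lambda>x. (\<rho> x)\<^sup>2)" by (intro continuous_intros \<rho>_continuous)
  then obtain I where I: "\<And>x. (I has_real_derivative (\<rho> x)\<^sup>2) (at x)"
    using continuous_antiderivative by blast
  have "((\<lambda>x. I x - I 0) has_real_derivative (\<rho> x)\<^sup>2) (at x)" for x
    using DERIV_diff[OF I DERIV_const] by simp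
  then have "\<exists>I. I 0 = 0 \<and> (\<forall>x. (I has_real_derivative (\<rho> x)\<^sup>2) (at x))"
    by (intro exI[of _ "\<lambda>x. I x - I 0"]) auto
  then have "area 0 = 0 \<and> (\<forall>x. (area has_real_derivative (\<rho> x)\<^sup>2) (at x))"
    unfolding area_def by (rule someI_ex)
  then show "area 0 = 0" "(area has_real_derivative (\<rho> x)\<^sup>2) (at x)" by auto
qed

lemma area_strict_mono: "x < y \<Longrightarrow> area x < area y"
  by (rule DERIV_pos_imp_increasing[of x y area]) (assumption, metis area_deriv \<rho>_pos zero_less_power)

text \<open>The derivative of \<open>area\<close> is bounded below by a positive constant. The
  resulting linear growth gives surjectivity, and later the Lipschitz bound for the inverse
  \<open>iarea\<close>.\<close>

lemma area_expanding:
  obtains c where "c > 0" "\<And>x y. c * \<bar>x - y\<bar> \<le> \<bar>area x - area y\<bar>"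
proof -
  obtain lo hi where b: "lo > 0" "\<And>\<phi>. lo \<le> \<rho> \<phi>" "\<And>\<phi>. \<rho> \<phi> \<le> hi" using \<rho>_bounds by blast
  have *: "lo\<^sup>2 * (y - x) \<le> area y - area x" if xy: "x < y" for x y
  proof -
    obtain z where "area y - area x = (y - x) * (\<rho> z)\<^sup>2"
      using MVT2[OF xy, of area "\<lambda>x. (\<rho> x)\<^sup>2"] area_deriv by blast
    moreover have "lo\<^sup>2 \<le> (\<rho> z)\<^sup>2" using b by (intro power_mono) auto
    ultimately show ?thesis using xy by (simp add: mult.commute mult_left_mono)
  qed
  have "lo\<^sup>2 * \<bar>x - y\<bar> \<le> \<bar>area x - area y\<bar>" for x y
    using *[of x y] *[of y x] by (cases x y rule: linorder_cases) auto
  then show thesis using that[of "lo\<^sup>2"] b(1) by simp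
qed

lemma area_continuous: "continuous_on A area"
  by (rule DERIV_continuous_on) (use area_deriv has_field_derivative_at_within in blast)

lemma area_bij: "bij area"
proof (rule bijI)
  show "inj area" by (rule linorder_injI) (use area_strict_mono in force)
  show "surj area"
    unfolding surj_def
  proof
    fix y
    obtain c where c: "c > 0" "\<And>x y. c * \<bar>x - y\<bar> \<le> \<bar>area x - area y\<bar>" using area_expanding by blast
    define r where "r = \<bar>y\<bar> / c"
    have r: "c * r = \<bar>y\<bar>" "r \<ge> 0" using c(1) by (auto simp: r_def)
    have "area r \<ge> \<bar>y\<bar>" "area (-r) \<le> - \<bar>y\<bar>"
      using c(2)[of r 0] c(2)[of "-r" 0] r area_strict_mono[of 0 r] area_strict_mono[of "-r" 0]
      by (cases "r = 0"; simp)+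
    then obtain x where "area x = y"
      using IVT'[of area "-r" y r] area_continuous[of "{-r..r}"] r by fastforce
    then show "\<exists>x. y = area x" by blast
  qed
qed

definition iarea :: "real \<Rightarrow> real" where "iarea = inv area"

lemma area_iarea [simp]: "area (iarea \<eta>) = \<eta>"
  unfolding iarea_def using area_bij by (simp add: bij_is_surj surj_f_inv_f)

lemma iarea_area [simp]: "iarea (area x) = x"
  unfolding iarea_def using area_bij by (simp add: bij_is_inj)

lemma area_less_iff: "area x < area y \<longleftrightarrow> x < y"
  using area_strict_mono by (metis less_asym' linorder_neqE_linordered_idom)

lemma area_periodic: "area (\<phi> + 2 * pi) = area \<phi> + area (2 * pi)"
proof -
  have "((\<lambda>x. area (x + 2 * pi) - area x) has_real_derivative 0) (at x)" for x
  proof -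
    have "((\<lambda>x. area (x + 2 * pi)) has_real_derivative (\<rho> (x + 2 * pi))\<^sup>2) (at x)"
      using area_deriv[of "x + 2 * pi"] by (simp add: DERIV_shift)
    from DERIV_diff[OF this area_deriv[of x]] show ?thesis by (simp add: \<rho>_periodic)
  qed
  then have "area (\<phi> + 2 * pi) - area \<phi> = area (0 + 2 * pi) - area 0"
    by (rule DERIV_isconst_all[rule_format])
  then show ?thesis by simp
qed

end

section \<open>Sector areas and convex trigonometric functions\<close>

context planar_gauge
begin

lemma sector_borel: "sector K \<phi> \<in> sets borel"
proof -
  have "K \<in> sets borel" using compact_K by (simp add: borel_compact)
  moreover have "{z. ang z \<le> \<phi>} \<in> sets borel" using ang_measurable by measurable
  moreover have "sector K \<phi> = K \<inter> ({0} \<union> {z. ang z \<le> \<phi>})" by (auto simp: sector_def)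
  ultimately show ?thesis by auto
qed

lemma sector_fmeasurable: "sector K \<phi> \<in> fmeasurable lborel"
proof (rule fmeasurableI)
  show "sector K \<phi> \<in> sets lborel" using sector_borel by simp
  have "emeasure lborel (sector K \<phi>) \<le> emeasure lborel K"
    using compact_K by (intro emeasure_mono) (auto simp: sector_def borel_compact)
  also have "\<dots> < \<infinity>" using emeasure_compact_finite[OF compact_K] by simp
  finally show "emeasure lborel (sector K \<phi>) < \<infinity>" .
qed

text \<open>Rotating by \<open>\<alpha>\<close> moves the difference of the sectors to the positive
  x-axis, where it lies between two right triangles: an inner one with hypotenuse \<open>lo\<close>
  and angle \<open>\<delta>\<close>, and an outer one with base \<open>hi\<close> and slope
  \<open>tan \<delta>\<close>.\<close>

lemma sector_diff_bounds:
  assumes "0 \<le> \<alpha>" "\<alpha> < \<beta>" "\<beta> \<le> 2 * pi" "\<beta> - \<alpha> < pi / 2" "lo > 0"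
    and b: "\<And>\<phi>. \<alpha> \<le> \<phi> \<Longrightarrow> \<phi> \<le> \<beta> \<Longrightarrow> lo \<le> \<rho> \<phi> \<and> \<rho> \<phi> \<le> hi"
  defines "\<delta> \<equiv> \<beta> - \<alpha>"
  shows "lo\<^sup>2 * (sin \<delta> * cos \<delta>) / 2 \<le> measure lborel (sector K \<beta>) - measure lborel (sector K \<alpha>)"
    and "measure lborel (sector K \<beta>) - measure lborel (sector K \<alpha>) \<le> hi\<^sup>2 * tan \<delta> / 2"
proof -
  have \<delta>: "0 < \<delta>" "\<delta> < pi / 2" using assms by (auto simp: \<delta>_def)
  have cs: "cos \<delta> > 0" "sin \<delta> > 0" "tan \<delta> > 0"
    using \<delta> by (auto intro!: cos_gt_zero sin_gt_zero tan_gt_zero)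
  define D where "D = sector K \<beta> - sector K \<alpha>"
  have D: "D \<in> sets borel" unfolding D_def using sector_borel by auto
  have D_iff: "z \<in> D \<longleftrightarrow> z \<in> K \<and> z \<noteq> 0 \<and> \<alpha> < ang z \<and> ang z \<le> \<beta>" for z
    by (auto simp: D_def sector_def)
  have mD: "measure lborel (sector K \<beta>) - measure lborel (sector K \<alpha>) = measure lborel D"
  proof -
    have "sector K \<alpha> \<subseteq> sector K \<beta>" using assms(2) by (auto simp: sector_def)
    moreover have "sector K \<alpha> \<in> sets lborel" using sector_borel by simp
    ultimately show ?thesis
      unfolding D_def using measurable_measure_Diff[OF sector_fmeasurable[of \<beta>]] by simp
  qed
  define E where "E = rotate_by \<alpha> -` D"
  have E: "E \<in> sets borel" unfolding E_def by (rule borel_rotate_vimage[OF D])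
  have "emeasure lborel E = emeasure lborel D"
    unfolding E_def by (rule emeasure_rotate[OF D]) (use assms in auto)
  moreover have "emeasure lborel D \<noteq> \<infinity>"
    using fmeasurable_Diff[OF sector_fmeasurable[of \<beta>], of "sector K \<alpha>"] sector_borel
    by (auto simp: D_def fmeasurable_def)
  ultimately have Em: "emeasure lborel E = ennreal (measure lborel D)"
    by (simp add: emeasure_eq_ennreal_measure)
  \<comment> \<open>A point of \<open>?T1\<close> at angle \<open>\<psi>\<close> has norm
    \<open>fst z / cos \<psi>\<close>, at most
    \<open>lo * cos \<delta> / cos \<psi> \<le> lo\<close>. The lower edge is left out of both
    triangles because \<open>D\<close> contains only angles strictly above
    \<open>\<alpha>\<close>.\<close>
  let ?T1 = "{z::real\<times>real. 0 < fst z \<and> fst z \<le> lo * cos \<delta> \<and> 0 < snd z \<and> snd z < tan \<delta> * fst z}"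
  let ?T2 = "{z::real\<times>real. 0 < fst z \<and> fst z \<le> hi \<and> 0 < snd z \<and> snd z \<le> tan \<delta> * fst z}"
  have "?T1 \<subseteq> E"
  proof
    fix z :: "real \<times> real" assume z: "z \<in> ?T1"
    define \<psi> where "\<psi> = arctan (snd z / fst z)"
    have "snd z / fst z < tan \<delta>" using z by (simp add: divide_less_eq)
    then have "\<psi> < arctan (tan \<delta>)" unfolding \<psi>_def by (simp add: arctan_less_iff)
    moreover have "arctan (tan \<delta>) = \<delta>" using \<delta> by (intro arctan_tan) auto
    ultimately have \<psi>: "0 < \<psi>" "\<psi> < \<delta>" using z by (auto simp: \<psi>_def)
    have c\<psi>: "cos \<psi> > 0" using \<psi> \<delta> by (intro cos_gt_zero) auto
    define r where "r = fst z / cos \<psi>"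
    have r: "r > 0" using z c\<psi> by (simp add: r_def)
    have "r * sin \<psi> = fst z * tan \<psi>" by (simp add: r_def tan_def)
    also have "\<dots> = snd z" using z by (simp add: \<psi>_def tan_arctan)
    finally have zr: "z = r *\<^sub>R dir \<psi>" using c\<psi> by (simp add: dir_def r_def prod_eq_iff)
    have rz: "rotate_by \<alpha> z = r *\<^sub>R dir (\<alpha> + \<psi>)" unfolding zr by (rule rotate_by_dir)
    have an: "ang (rotate_by \<alpha> z) = \<alpha> + \<psi>"
      unfolding rz by (rule ang_dir) (use r \<psi> assms in \<open>auto simp: \<delta>_def\<close>)
    have "r \<le> lo"
    proof -
      have "cos \<delta> \<le> cos \<psi>" using \<psi> \<delta> by (intro cos_monotone_0_pi_le) auto
      then have "lo * cos \<delta> \<le> lo * cos \<psi>" using \<open>lo > 0\<close> by simp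
      then have "fst z \<le> lo * cos \<psi>" using z by auto
      then show ?thesis using c\<psi> by (simp add: r_def divide_le_eq)
    qed
    also have "lo \<le> \<rho> (\<alpha> + \<psi>)" using b[of "\<alpha> + \<psi>"] \<psi> by (simp add: \<delta>_def)
    finally have "r * g (dir (\<alpha> + \<psi>)) \<le> 1"
      using g_dir_pos[of "\<alpha> + \<psi>"] by (simp add: \<rho>_def field_simps)
    then have "rotate_by \<alpha> z \<in> K" using r by (simp add: rz K_def hom)
    moreover have "rotate_by \<alpha> z \<noteq> 0" using r by (simp add: rz)
    ultimately show "z \<in> E" using an \<psi> by (simp add: E_def D_iff \<delta>_def)
  qed
  then have "emeasure lborel ?T1 \<le> emeasure lborel E"
    using E by (intro emeasure_mono) auto
  then have "ennreal (tan \<delta> * (lo * cos \<delta>)\<^sup>2 / 2) \<le> ennreal (measure lborel D)"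
    unfolding Em using emeasure_triangle(2)[of "lo * cos \<delta>" "tan \<delta>"] cs \<open>lo > 0\<close> by simp
  then have "tan \<delta> * (lo * cos \<delta>)\<^sup>2 / 2 \<le> measure lborel D"
    by (simp add: ennreal_le_iff)
  moreover have "tan \<delta> * (lo * cos \<delta>)\<^sup>2 = lo\<^sup>2 * (sin \<delta> * cos \<delta>)"
    using cs by (simp add: tan_def power2_eq_square)
  ultimately show "lo\<^sup>2 * (sin \<delta> * cos \<delta>) / 2 \<le> measure lborel (sector K \<beta>) - measure lborel (sector K \<alpha>)"
    unfolding mD by simp
  have hi: "hi > 0" using b[of \<alpha>] assms \<rho>_pos[of \<alpha>] by force
  have "E \<subseteq> ?T2"
  proof
    fix z assume "z \<in> E"
    then have y: "rotate_by \<alpha> z \<in> D" by (simp add: E_def)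
    define \<phi> where "\<phi> = ang (rotate_by \<alpha> z)"
    define r where "r = norm (rotate_by \<alpha> z)"
    have \<phi>: "\<alpha> < \<phi>" "\<phi> \<le> \<beta>" and r: "r > 0" using y by (auto simp: D_iff \<phi>_def r_def)
    have rz: "rotate_by \<alpha> z = r *\<^sub>R dir \<phi>" unfolding r_def \<phi>_def by (rule polar_form)
    have "z = rotate_by (-\<alpha>) (rotate_by \<alpha> z)" by (simp add: rotate_by_add)
    also have "\<dots> = r *\<^sub>R dir (\<phi> - \<alpha>)" unfolding rz by (simp add: rotate_by_dir)
    finally have z: "z = r *\<^sub>R dir (\<phi> - \<alpha>)" .
    have c: "cos (\<phi> - \<alpha>) > 0" "sin (\<phi> - \<alpha>) > 0"
      using \<phi> \<delta> by (auto intro!: cos_gt_zero sin_gt_zero simp: \<delta>_def)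
    have "r * g (dir \<phi>) \<le> 1" using y r by (simp add: D_iff rz K_def hom)
    then have "r \<le> \<rho> \<phi>" using g_dir_pos[of \<phi>] by (simp add: \<rho>_def field_simps)
    also have "\<dots> \<le> hi" using b[of \<phi>] \<phi> by simp
    finally have "r * cos (\<phi> - \<alpha>) \<le> hi * 1" using c hi r by (intro mult_mono) auto
    moreover have "tan (\<phi> - \<alpha>) \<le> tan \<delta>"
    proof (cases "\<phi> = \<beta>")
      case False
      then show ?thesis using \<phi> \<delta> by (intro less_imp_le tan_monotone) (auto simp: \<delta>_def)
    qed (simp add: \<delta>_def)
    then have "sin (\<phi> - \<alpha>) \<le> tan \<delta> * cos (\<phi> - \<alpha>)" using c by (simp add: tan_def divide_le_eq)
    then have "r * sin (\<phi> - \<alpha>) \<le> tan \<delta> * (r * cos (\<phi> - \<alpha>))"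
      using mult_left_mono[of _ _ r] r by (simp add: ac_simps)
    ultimately show "z \<in> ?T2" using r c by (simp add: z dir_def)
  qed
  moreover have "?T2 \<in> sets lborel" by simp
  ultimately have "emeasure lborel E \<le> emeasure lborel ?T2" by (rule emeasure_mono)
  then have "ennreal (measure lborel D) \<le> ennreal (tan \<delta> * hi\<^sup>2 / 2)"
    unfolding Em using emeasure_triangle(1)[of hi "tan \<delta>"] cs hi by simp
  then have "measure lborel D \<le> tan \<delta> * hi\<^sup>2 / 2"
    using cs by (subst (asm) ennreal_le_iff) auto
  then show "measure lborel (sector K \<beta>) - measure lborel (sector K \<alpha>) \<le> hi\<^sup>2 * tan \<delta> / 2"
    unfolding mD by (simp add: mult.commute)
qed

text \<open>Near \<open>x\<close> the radial function stays between \<open>\<rho> x - L * d\<close>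
  and \<open>\<rho> x + L * d\<close> at distance \<open>d\<close>. With these radii the triangle
  bounds, divided by \<open>d\<close>, have the common limit \<open>(\<rho> x)\<^sup>2 / 2\<close>.
  The derivative is taken within one turn because \<open>sector\<close> measures angles by
  \<open>ang\<close>.\<close>

lemma sector_deriv:
  assumes x: "x \<in> {0..2*pi}"
  shows "((\<lambda>\<phi>. measure lborel (sector K \<phi>)) has_real_derivative (\<rho> x)\<^sup>2 / 2) (at x within {0..2*pi})"
proof -
  define m where "m \<phi> = measure lborel (sector K \<phi>)" for \<phi>
  let ?F = "at x within {0..2*pi}"
  obtain L where L: "L \<ge> 0" "\<And>x y. \<bar>\<rho> x - \<rho> y\<bar> \<le> L * \<bar>x - y\<bar>" using \<rho>_lipschitz by blast
  define low where "low d = (\<rho> x - L * d)\<^sup>2 * (sin d / d * cos d) / 2" for d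
  define up where "up d = (\<rho> x + L * d)\<^sup>2 * (sin d / d / cos d) / 2" for d
  have sinc: "((\<lambda>d::real. sin d / d) \<longlongrightarrow> 1) (at 0)"
    using DERIV_sin[of "0::real"] by (simp add: has_field_derivative_iff)
  have low: "(low \<longlongrightarrow> (\<rho> x)\<^sup>2 / 2) (at 0)"
  proof -
    have "(low \<longlongrightarrow> (\<rho> x - L * 0)\<^sup>2 * (1 * cos 0) / 2) (at 0)"
      unfolding low_def by (intro tendsto_intros sinc) auto
    then show ?thesis by simp
  qed
  have up: "(up \<longlongrightarrow> (\<rho> x)\<^sup>2 / 2) (at 0)"
  proof -
    have "(up \<longlongrightarrow> (\<rho> x + L * 0)\<^sup>2 * (1 / cos 0) / 2) (at 0)"
      unfolding up_def by (intro tendsto_intros sinc) auto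
    then show ?thesis by simp
  qed
  have abs: "filterlim (\<lambda>y. \<bar>y - x\<bar>) (at 0) ?F"
    unfolding filterlim_at
  proof
    show "eventually (\<lambda>y. \<bar>y - x\<bar> \<in> UNIV \<and> \<bar>y - x\<bar> \<noteq> 0) ?F"
      by (simp add: eventually_at_filter)
    have "((\<lambda>y. \<bar>y - x\<bar>) \<longlongrightarrow> \<bar>x - x\<bar>) ?F" by (intro tendsto_intros)
    then show "((\<lambda>y. \<bar>y - x\<bar>) \<longlongrightarrow> 0) ?F" by simp
  qed
  \<comment> \<open>The last two conditions are what the triangle bounds require: an angle below
    \<open>pi / 2\<close> and a positive inner radius.\<close>
  have near: "eventually (\<lambda>y. y \<in> {0..2*pi} \<and> y \<noteq> x \<and> \<bar>y - x\<bar> < pi / 2 \<and> L * \<bar>y - x\<bar> < \<rho> x) ?F"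
  proof -
    have 1: "((\<lambda>y. \<bar>y - x\<bar>) \<longlongrightarrow> \<bar>x - x\<bar>) ?F" "((\<lambda>y. L * \<bar>y - x\<bar>) \<longlongrightarrow> L * \<bar>x - x\<bar>) ?F"
      by (intro tendsto_intros)+
    have "eventually (\<lambda>y. \<bar>y - x\<bar> < pi / 2) ?F" "eventually (\<lambda>y. L * \<bar>y - x\<bar> < \<rho> x) ?F"
      using order_tendstoD(2)[OF 1(1), of "pi/2"] order_tendstoD(2)[OF 1(2), of "\<rho> x"] \<rho>_pos by auto
    moreover have "eventually (\<lambda>y. y \<in> {0..2*pi} \<and> y \<noteq> x) ?F"
      by (simp add: eventually_at_filter)
    ultimately show ?thesis by eventually_elim auto
  qed
  have bounds: "low \<bar>y - x\<bar> \<le> (m y - m x) / (y - x) \<and> (m y - m x) / (y - x) \<le> up \<bar>y - x\<bar>"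
    if y: "y \<in> {0..2*pi}" "y \<noteq> x" "\<bar>y - x\<bar> < pi / 2" "L * \<bar>y - x\<bar> < \<rho> x" for y
  proof -
    define d where "d = \<bar>y - x\<bar>"
    define \<alpha> where "\<alpha> = min x y" define \<beta> where "\<beta> = max x y"
    have d: "\<beta> - \<alpha> = d" "d > 0" using y by (auto simp: d_def \<alpha>_def \<beta>_def)
    have q: "(m y - m x) / (y - x) = (m \<beta> - m \<alpha>) / d"
      using y(2) by (cases "x < y") (auto simp: \<alpha>_def \<beta>_def d_def min_def max_def divide_simps algebra_simps)
    have b: "\<rho> x - L * d \<le> \<rho> \<phi> \<and> \<rho> \<phi> \<le> \<rho> x + L * d" if "\<alpha> \<le> \<phi>" "\<phi> \<le> \<beta>" for \<phi>
    proof -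
      have "\<bar>\<phi> - x\<bar> \<le> d" using that by (auto simp: \<alpha>_def \<beta>_def d_def)
      then have "L * \<bar>\<phi> - x\<bar> \<le> L * d" using L(1) by (rule mult_left_mono)
      then show ?thesis using L(2)[of \<phi> x] by (auto simp: abs_le_iff)
    qed
    have h4: "\<beta> - \<alpha> < pi/2" unfolding d(1) using y(3) by (simp add: d_def)
    have h: "0 \<le> \<alpha>" "\<alpha> < \<beta>" "\<beta> \<le> 2*pi" "\<rho> x - L * d > 0"
      using y x by (auto simp: \<alpha>_def \<beta>_def d_def)
    note s = sector_diff_bounds[OF h(1-3) h4 h(4) b, unfolded d(1), folded m_def]
    have "low d = (\<rho> x - L * d)\<^sup>2 * (sin d * cos d) / 2 / d" by (simp add: low_def)
    also have "\<dots> \<le> (m \<beta> - m \<alpha>) / d" using s(1) d(2) by (intro divide_right_mono) auto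
    finally have 1: "low d \<le> (m \<beta> - m \<alpha>) / d" .
    have "(m \<beta> - m \<alpha>) / d \<le> (\<rho> x + L * d)\<^sup>2 * tan d / 2 / d"
      using s(2) d(2) by (intro divide_right_mono) auto
    also have "\<dots> = up d" by (simp add: up_def tan_def)
    finally show ?thesis using 1 q by (simp add: d_def)
  qed
  have "((\<lambda>y. (m y - m x) / (y - x)) \<longlongrightarrow> (\<rho> x)\<^sup>2 / 2) ?F"
  proof (rule tendsto_sandwich)
    show "eventually (\<lambda>y. low \<bar>y - x\<bar> \<le> (m y - m x) / (y - x)) ?F"
      using near by eventually_elim (use bounds in auto)
    show "eventually (\<lambda>y. (m y - m x) / (y - x) \<le> up \<bar>y - x\<bar>) ?F"
      using near by eventually_elim (use bounds in auto)
    show "((\<lambda>y. low \<bar>y - x\<bar>) \<longlongrightarrow> (\<rho> x)\<^sup>2 / 2) ?F" by (rule filterlim_compose[OF low abs])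
    show "((\<lambda>y. up \<bar>y - x\<bar>) \<longlongrightarrow> (\<rho> x)\<^sup>2 / 2) ?F" by (rule filterlim_compose[OF up abs])
  qed
  then show ?thesis unfolding has_field_derivative_iff m_def .
qed

text \<open>Both sides have the same derivative on one turn. They agree at 0 because
  \<open>sector K 0\<close> lies on the x-axis, which is a null set.\<close>

lemma sector_measure:
  assumes "\<phi> \<in> {0..2*pi}"
  shows "measure lborel (sector K \<phi>) = area \<phi> / 2"
proof -
  have "((\<lambda>\<phi>. measure lborel (sector K \<phi>) - area \<phi> / 2) has_real_derivative 0) (at x within {0..2*pi})"
    if "x \<in> {0..2*pi}" for x
    using DERIV_diff[OF sector_deriv[OF that] DERIV_cdivide[OF has_field_derivative_at_within[OF area_deriv[of x]], where c = 2]]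
    by simp
  then have "\<exists>c. \<forall>x\<in>{0..2*pi}. measure lborel (sector K x) - area x / 2 = c"
    by (intro has_field_derivative_zero_constant) auto
  then obtain c where c: "\<And>x. x \<in> {0..2*pi} \<Longrightarrow> measure lborel (sector K x) - area x / 2 = c"
    by blast
  have "measure lborel (sector K 0) = 0"
  proof -
    let ?Z = "{z::real\<times>real. snd z = 0}"
    have Z: "?Z \<in> sets borel"
      by (intro borel_closed closed_Collect_eq continuous_intros)
    have "Pair x -` ?Z = {0}" for x :: real by auto
    then have "emeasure lborel ?Z = 0" by (simp add: emeasure_plane_vertical[OF Z])
    moreover have "sector K 0 \<subseteq> ?Z"
    proof
      fix z assume "z \<in> sector K 0"
      then have "z = 0 \<or> ang z = 0" using ang_bounds(1)[of z] by (auto simp: sector_def)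
      then show "z \<in> ?Z"
        using arg_cong[OF polar_form[of z], of snd] by (auto simp: dir_def)
    qed
    ultimately have "emeasure lborel (sector K 0) = 0"
      using emeasure_mono[of "sector K 0" ?Z lborel] Z by simp
    then show ?thesis by (simp add: measure_def)
  qed
  then show ?thesis using c[of 0] c[OF assms] by simp
qed

lemma measure_K: "measure lborel K = area (2 * pi) / 2"
proof -
  have "sector K (2 * pi) = K" using ang_bounds(2) by (auto simp: sector_def less_imp_le)
  then show ?thesis using sector_measure[of "2 * pi"] by simp
qed

lemma area_periodic_int: "area (\<phi> + 2 * pi * of_int n) = area \<phi> + area (2 * pi) * of_int n"
proof (induction n)
  case (nonneg n)
  show ?case
  proof (induction n)
    case (Suc n)
    then show ?case using area_periodic[of "\<phi> + 2 * pi * real n"] by (simp add: algebra_simps)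
  qed simp
next
  case (neg n)
  show ?case
  proof (induction n)
    case 0
    then show ?case using area_periodic[of "\<phi> - 2 * pi"] by simp
  next
    case (Suc n)
    then show ?case using area_periodic[of "\<phi> + 2 * pi * of_int (- int (Suc (Suc n)))"]
      by (simp add: algebra_simps)
  qed
qed

lemma bd_periodic_int: "bd (\<phi> + 2 * pi * of_int n) = bd \<phi>"
proof -
  have "dir (\<phi> + 2 * pi * of_int n) = dir \<phi>"
    unfolding dir_def using cos_int_2pin[of n] sin_int_2pin[of n] by (simp add: cos_add sin_add)
  then show ?thesis by (simp add: bd_def \<rho>_def)
qed

text \<open>The pair of convex cosine and sine of \<open>K\<close> in explicit form: the boundary
  point at which twice the swept area is \<open>\<eta>\<close>. It avoids both the definite
  description and the reduction modulo the period.\<close>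

definition trig :: "real \<Rightarrow> real \<times> real" where "trig \<eta> = bd (iarea \<eta>)"

lemma g_trig [simp]: "g (trig \<eta>) = 1" by (simp add: trig_def)

lemma bd_ang:
  assumes "g P = 1" shows "bd (ang P) = P"
proof -
  have P: "P = norm P *\<^sub>R dir (ang P)" by (rule polar_form)
  then have "g P = norm P * g (dir (ang P))" by (metis hom norm_ge_zero)
  then have "norm P = \<rho> (ang P)" using assms g_dir_pos[of "ang P"] by (simp add: \<rho>_def field_simps)
  then show ?thesis using P by (simp add: bd_def)
qed

lemma trig_area_ang: "g P = 1 \<Longrightarrow> trig (area (ang P)) = P"
  by (simp add: trig_def bd_ang)

text \<open>The reduced parameter lies in one period, so its angle \<open>\<phi>\<close> lies in the
  range of \<open>ang\<close>. Conversely the sector measure determines the angle, since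
  \<open>area\<close> is injective, and a boundary point is determined by its angle.\<close>

lemma cvx_cossin_K: "cvx_cossin K \<theta> = trig \<theta>"
proof -
  define S where "S = measure lborel K"
  define n where "n = floor (\<theta> / (2 * S))"
  define \<theta>' where "\<theta>' = \<theta> - 2 * S * of_int n"
  have S: "2 * S = area (2 * pi)" "S > 0"
    using measure_K area_strict_mono[of 0 "2 * pi"] by (auto simp: S_def)
  have "of_int n \<le> \<theta> / (2 * S)" "\<theta> / (2 * S) < of_int n + 1" by (auto simp: n_def)
  then have "0 \<le> \<theta>'" "\<theta>' < 2 * S"
    using S(2) by (auto simp: \<theta>'_def field_simps)
  then have t: "0 \<le> \<theta>'" "\<theta>' < area (2 * pi)" using S(1) by auto
  define \<phi> where "\<phi> = iarea \<theta>'"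
  have \<phi>: "0 \<le> \<phi>" "\<phi> < 2 * pi"
    using area_less_iff[of \<phi> 0] area_less_iff[of \<phi> "2 * pi"] t by (auto simp: \<phi>_def not_less)
  have "area (\<phi> + 2 * pi * of_int n) = \<theta>"
    unfolding area_periodic_int by (simp add: \<phi>_def \<theta>'_def S)
  then have tr: "trig \<theta> = bd \<phi>"
    unfolding trig_def by (metis bd_periodic_int iarea_area)
  have a: "ang (bd \<phi>) = \<phi>" unfolding bd_def using \<phi> \<rho>_pos by (intro ang_dir)
  have "(THE P. P \<in> frontier K \<and> measure lborel (sector K (ang P)) = \<theta>' / 2) = bd \<phi>"
  proof (rule the_equality)
    show "bd \<phi> \<in> frontier K \<and> measure lborel (sector K (ang (bd \<phi>))) = \<theta>' / 2"
      using sector_measure[of \<phi>] \<phi> by (simp add: frontier_K a) (simp add: \<phi>_def)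
    fix P assume P: "P \<in> frontier K \<and> measure lborel (sector K (ang P)) = \<theta>' / 2"
    then have "area (ang P) = \<theta>'" using sector_measure[of "ang P"] ang_bounds[of P] by simp
    then have "ang P = \<phi>" unfolding \<phi>_def by (metis iarea_area)
    then show "P = bd \<phi>" using bd_ang[of P] P by (simp add: frontier_K)
  qed
  then show ?thesis
    unfolding cvx_cossin_def Let_def tr by (simp add: S_def n_def \<theta>'_def)
qed

end

section \<open>Derivatives of convex trigonometric functions\<close>

lemma rot90_inner_self [simp]: "rot90 z \<bullet> z = 0" "z \<bullet> rot90 z = 0"
  by (auto simp: rot90_def inner_prod_def)

lemma rot90_inner_swap: "rot90 x \<bullet> y = - (rot90 y \<bullet> x)"
  by (auto simp: rot90_def inner_prod_def)

lemma norm_rot90 [simp]: "norm (rot90 z) = norm z"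
  by (simp add: rot90_def norm_prod_def add.commute)

lemma dir_rot90_decomp: "q = (q \<bullet> dir \<phi>) *\<^sub>R dir \<phi> + (q \<bullet> rot90 (dir \<phi>)) *\<^sub>R rot90 (dir \<phi>)"
proof -
  obtain a b where q: "q = (a, b)" by (cases q)
  let ?c = "cos \<phi>" and ?s = "sin \<phi>"
  have sc: "?s * ?s + ?c * ?c = 1" using sin_cos_squared_add[of \<phi>] by (simp add: power2_eq_square)
  have "(a * c + b * s) * c + (b * c - a * s) * (- s) = a * (s * s + c * c)"
    "(a * c + b * s) * s + (b * c - a * s) * c = b * (s * s + c * c)" for c s :: real
    by (simp_all add: algebra_simps)
  from this[of ?c ?s] have "(a * ?c + b * ?s) * ?c + (b * ?c - a * ?s) * (- ?s) = a"
    "(a * ?c + b * ?s) * ?s + (b * ?c - a * ?s) * ?c = b"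
    by (simp_all only: sc mult_1_right)
  then show ?thesis by (simp add: q dir_def rot90_def inner_prod_def)
qed

context planar_gauge
begin

text \<open>Right derivative of \<open>g\<close> at \<open>dir \<phi>\<close> along the tangent line
  of the unit circle. For a convex function the difference quotients increase with \<open>t\<close>,
  so the right derivative is their infimum; it exists even where \<open>g\<close> is not
  differentiable.\<close>

definition slope :: "real \<Rightarrow> real" where
  "slope \<phi> = Inf ((\<lambda>t. (g (dir \<phi> + t *\<^sub>R rot90 (dir \<phi>)) - g (dir \<phi>)) / t) ` {0<..})"

lemma tangent_convex: "convex_on UNIV (\<lambda>t. g (z + t *\<^sub>R w))"
proof (rule convex_onI)
  fix t x y :: real assume t: "0 < t" "t < 1"
  have "z + ((1 - t) *\<^sub>R x + t *\<^sub>R y) *\<^sub>R w = (1 - t) *\<^sub>R (z + x *\<^sub>R w) + t *\<^sub>R (z + y *\<^sub>R w)"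
    by (simp add: algebra_simps)
  then show "g (z + ((1 - t) *\<^sub>R x + t *\<^sub>R y) *\<^sub>R w) \<le> (1 - t) * g (z + x *\<^sub>R w) + t * g (z + y *\<^sub>R w)"
    using subadd[of "(1 - t) *\<^sub>R (z + x *\<^sub>R w)" "t *\<^sub>R (z + y *\<^sub>R w)"] t by (simp add: hom)
qed auto

lemma slope_support: "g (dir \<phi> + t *\<^sub>R rot90 (dir \<phi>)) \<ge> g (dir \<phi>) + slope \<phi> * t"
proof -
  let ?\<psi> = "\<lambda>t. g (dir \<phi> + t *\<^sub>R rot90 (dir \<phi>))"
  have eq: "(\<lambda>t. (?\<psi> 0 - ?\<psi> t) / (0 - t)) = (\<lambda>t. (?\<psi> t - g (dir \<phi>)) / t)"
    by (auto simp: fun_eq_iff divide_simps)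
  have "?\<psi> 0 + slope \<phi> * (t - 0) \<le> ?\<psi> t"
    using convex_le_Inf_differential[OF tangent_convex[of "dir \<phi>" "rot90 (dir \<phi>)"], of 0 t]
    unfolding eq Int_UNIV_right slope_def by simp
  then show ?thesis by simp
qed

lemma slope_right_limit:
  "((\<lambda>t. (g (dir \<phi> + t *\<^sub>R rot90 (dir \<phi>)) - g (dir \<phi>)) / t) \<longlongrightarrow> slope \<phi>) (at_right 0)"
proof -
  let ?\<psi> = "\<lambda>t. g (dir \<phi> + t *\<^sub>R rot90 (dir \<phi>))"
  define s where "s t = (?\<psi> t - g (dir \<phi>)) / t" for t
  have sl: "slope \<phi> = Inf (s ` {0<..})" by (simp add: slope_def s_def)
  have ge: "slope \<phi> \<le> s t" if "t > 0" for t
    using slope_support[of \<phi> t] that by (simp add: s_def le_divide_eq)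
  have mono: "s t \<le> s u" if "0 < t" "t < u" for t u
    using convex_on_slope_le(1)[OF tangent_convex[of "dir \<phi>" "rot90 (dir \<phi>)"], of 0 u t] that
    by (simp add: s_def divide_simps) (simp add: algebra_simps)
  have "(s \<longlongrightarrow> slope \<phi>) (at_right 0)"
  proof (rule order_tendstoI)
    fix a assume "a < slope \<phi>"
    then show "eventually (\<lambda>t. a < s t) (at_right 0)"
      using ge by (auto simp: eventually_at_filter intro!: always_eventually intro: less_le_trans)
  next
    fix a assume "slope \<phi> < a"
    then obtain u where u: "u > 0" "s u < a"
      unfolding sl using cInf_lessD[of "s ` {0<..}" a] by auto
    have "eventually (\<lambda>t. t \<in> {0<..<u}) (at_right 0)" using u(1) by (rule eventually_at_right_real)
    then show "eventually (\<lambda>t. s t < a) (at_right 0)"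
      by eventually_elim (use mono u in fastforce)
  qed
  then show ?thesis by (simp add: s_def[abs_def])
qed

text \<open>A one-sided gradient of \<open>g\<close> at \<open>dir \<phi>\<close>: Euler's identity
  for homogeneous functions fixes the radial component, and the right derivative selects the
  tangential one. If \<open>g\<close> is the support function of \<Omega>, it is a point of \<Omega>
  that maximizes the linear form \<open>dir \<phi>\<close>.\<close>

definition subgrad :: "real \<Rightarrow> real \<times> real" where
  "subgrad \<phi> = g (dir \<phi>) *\<^sub>R dir \<phi> + slope \<phi> *\<^sub>R rot90 (dir \<phi>)"

lemma inner_dir_dir [simp]: "dir \<phi> \<bullet> dir \<phi> = 1"
  by (metis norm_dir norm_eq_1)

lemma subgrad_le: "subgrad \<phi> \<bullet> q \<le> g q"
proof -
  define e where "e = dir \<phi>"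
  define a where "a = q \<bullet> e" define b where "b = q \<bullet> rot90 e"
  have q: "q = a *\<^sub>R e + b *\<^sub>R rot90 e" unfolding a_def b_def e_def by (rule dir_rot90_decomp)
  \<comment> \<open>\<open>slope_support\<close> controls \<open>g\<close> only where the component
    along \<open>e\<close> is positive. Adding \<open>l *\<^sub>R e\<close> moves \<open>q\<close>
    into that half-plane, and subadditivity removes the shift again.\<close>
  define l where "l = \<bar>a\<bar> + 1"
  have al: "a + l > 0" "l \<ge> 0" by (auto simp: l_def)
  have "q + l *\<^sub>R e = (a + l) *\<^sub>R (e + (b / (a + l)) *\<^sub>R rot90 e)"
  proof -
    have "(a + l) * (b / (a + l)) = b" using al by simp
    then show ?thesis by (subst q) (simp add: scaleR_add_right scaleR_add_left del: times_divide_eq_right)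
  qed
  then have "g (q + l *\<^sub>R e) = (a + l) * g (e + (b / (a + l)) *\<^sub>R rot90 e)"
    using al hom by simp
  also have "\<dots> \<ge> (a + l) * (g e + slope \<phi> * (b / (a + l)))"
    using slope_support[of \<phi> "b / (a + l)"] al by (simp add: e_def)
  finally have "g (q + l *\<^sub>R e) \<ge> (a + l) * g e + slope \<phi> * b"
    using al by (simp add: distrib_left)
  moreover have "g (q + l *\<^sub>R e) \<le> g q + l * g e" using subadd[of q "l *\<^sub>R e"] hom al by simp
  ultimately have "a * g e + slope \<phi> * b \<le> g q" by (simp add: algebra_simps)
  moreover have "subgrad \<phi> \<bullet> q = a * g e + slope \<phi> * b"
    by (simp add: subgrad_def a_def b_def e_def inner_add_left inner_add_right inner_commute)
  ultimately show ?thesis by simp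
qed

lemma subgrad_bd: "subgrad \<phi> \<bullet> bd \<phi> = 1"
  using g_dir_pos[of \<phi>] by (simp add: subgrad_def bd_def inner_add_left \<rho>_def)

lemma norm_subgrad: "norm (subgrad \<phi>) \<le> lip"
proof (cases "subgrad \<phi> = 0")
  case False
  have "norm (subgrad \<phi>) * norm (subgrad \<phi>) \<le> lip * norm (subgrad \<phi>)"
    using subgrad_le[of \<phi> "subgrad \<phi>"] upper[of "subgrad \<phi>"]
    by (simp add: dot_square_norm power2_eq_square)
  then show ?thesis using False by simp
qed (use lip_pos in simp)

lemma dir_has_vector_derivative: "(dir has_vector_derivative rot90 (dir \<phi>)) (at \<phi> within A)"
proof -
  have "(cos has_vector_derivative - sin \<phi>) (at \<phi> within A)" "(sin has_vector_derivative cos \<phi>) (at \<phi> within A)"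
    unfolding has_real_derivative_iff_has_vector_derivative[symmetric]
    by (rule has_field_derivative_at_within[OF DERIV_cos] has_field_derivative_at_within[OF DERIV_sin])+
  from has_vector_derivative_Pair[OF this] show ?thesis by (simp add: dir_def[abs_def] rot90_def)
qed

text \<open>The circle and its tangent line differ by \<open>o(x - \<phi>)\<close>, and
  \<open>g\<close> is Lipschitz, so the right derivative along the tangent carries over to the
  circle.\<close>

lemma g_dir_right_derivative: "((\<lambda>x. g (dir x)) has_real_derivative slope \<phi>) (at_right \<phi>)"
proof -
  let ?\<psi> = "\<lambda>t. g (dir \<phi> + t *\<^sub>R rot90 (dir \<phi>))"
  have shift: "filterlim (\<lambda>x. x - \<phi>) (at_right 0) (at_right \<phi>)"
    unfolding filterlim_at
  proof
    show "eventually (\<lambda>x. x - \<phi> \<in> {0<..} \<and> x - \<phi> \<noteq> 0) (at_right \<phi>)"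
      by (auto simp: eventually_at_filter)
    have "((\<lambda>x. x - \<phi>) \<longlongrightarrow> \<phi> - \<phi>) (at_right \<phi>)" by (intro tendsto_intros)
    then show "((\<lambda>x. x - \<phi>) \<longlongrightarrow> 0) (at_right \<phi>)" by simp
  qed
  have 1: "((\<lambda>x. (?\<psi> (x - \<phi>) - g (dir \<phi>)) / (x - \<phi>)) \<longlongrightarrow> slope \<phi>) (at_right \<phi>)"
    by (rule filterlim_compose[OF slope_right_limit shift])
  have d: "((\<lambda>x. (dir x - (dir \<phi> + (x - \<phi>) *\<^sub>R rot90 (dir \<phi>))) /\<^sub>R norm (x - \<phi>)) \<longlongrightarrow> 0) (at_right \<phi>)"
    using dir_has_vector_derivative[of \<phi> "{\<phi><..}"]
    unfolding has_vector_derivative_def has_derivative_within by (simp add: inverse_eq_divide)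
  have "((\<lambda>x. (g (dir x) - ?\<psi> (x - \<phi>)) / (x - \<phi>)) \<longlongrightarrow> 0) (at_right \<phi>)"
  proof (rule Lim_null_comparison)
    show "((\<lambda>x. lip * norm ((dir x - (dir \<phi> + (x - \<phi>) *\<^sub>R rot90 (dir \<phi>))) /\<^sub>R norm (x - \<phi>))) \<longlongrightarrow> 0) (at_right \<phi>)"
      using tendsto_mult_right_zero[OF tendsto_norm_zero[OF d]] by simp
    show "eventually (\<lambda>x. norm ((g (dir x) - ?\<psi> (x - \<phi>)) / (x - \<phi>))
       \<le> lip * norm ((dir x - (dir \<phi> + (x - \<phi>) *\<^sub>R rot90 (dir \<phi>))) /\<^sub>R norm (x - \<phi>))) (at_right \<phi>)"
    proof (rule always_eventually, rule allI)
      fix x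
      have "\<bar>g (dir x) - ?\<psi> (x - \<phi>)\<bar> \<le> lip * norm (dir x - (dir \<phi> + (x - \<phi>) *\<^sub>R rot90 (dir \<phi>)))"
        using lipschitz_onD[OF lipschitz, of "dir x" "dir \<phi> + (x - \<phi>) *\<^sub>R rot90 (dir \<phi>)"]
        by (simp add: dist_norm)
      then have "\<bar>g (dir x) - ?\<psi> (x - \<phi>)\<bar> / \<bar>x - \<phi>\<bar> \<le>
          lip * norm (dir x - (dir \<phi> + (x - \<phi>) *\<^sub>R rot90 (dir \<phi>))) / \<bar>x - \<phi>\<bar>"
        by (intro divide_right_mono) auto
      then show "norm ((g (dir x) - ?\<psi> (x - \<phi>)) / (x - \<phi>))
       \<le> lip * norm ((dir x - (dir \<phi> + (x - \<phi>) *\<^sub>R rot90 (dir \<phi>))) /\<^sub>R norm (x - \<phi>))"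
        by (simp add: abs_mult abs_inverse divide_inverse mult_ac)
    qed
  qed
  from tendsto_add[OF 1 this] show ?thesis
    unfolding has_field_derivative_iff by (simp add: diff_divide_distrib)
qed

text \<open>In vector form the right derivative of \<open>bd\<close> is
  \<open>(\<rho> \<phi>)\<^sup>2 *\<^sub>R rot90 (subgrad \<phi>)\<close>; the two parts are its
  coordinates, obtained by the quotient rule.\<close>

lemma bd_right_derivative:
  "((\<lambda>x. fst (bd x)) has_real_derivative - (\<rho> \<phi>)\<^sup>2 * snd (subgrad \<phi>)) (at_right \<phi>)"
  "((\<lambda>x. snd (bd x)) has_real_derivative (\<rho> \<phi>)\<^sup>2 * fst (subgrad \<phi>)) (at_right \<phi>)"
proof -
  have gp: "g (dir \<phi>) \<noteq> 0" using g_dir_pos[of \<phi>] by simp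
  have c: "(cos has_real_derivative - sin \<phi>) (at_right \<phi>)"
    and s: "(sin has_real_derivative cos \<phi>) (at_right \<phi>)"
    using DERIV_cos[of \<phi>] DERIV_sin[of \<phi>] has_field_derivative_at_within by blast+
  have "((\<lambda>x. cos x / g (dir x)) has_real_derivative
     ((- sin \<phi>) * g (dir \<phi>) - cos \<phi> * slope \<phi>) / (g (dir \<phi>) * g (dir \<phi>))) (at_right \<phi>)"
    by (rule DERIV_divide[OF c g_dir_right_derivative gp])
  moreover have "(\<lambda>x. cos x / g (dir x)) = (\<lambda>x. fst (bd x))"
    by (auto simp: bd_def \<rho>_def dir_def)
  moreover have "((- sin \<phi>) * g (dir \<phi>) - cos \<phi> * slope \<phi>) / (g (dir \<phi>) * g (dir \<phi>)) = - (\<rho> \<phi>)\<^sup>2 * snd (subgrad \<phi>)"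
    using gp by (simp add: \<rho>_def subgrad_def dir_def rot90_def power2_eq_square divide_simps; simp add: algebra_simps)
  ultimately show "((\<lambda>x. fst (bd x)) has_real_derivative - (\<rho> \<phi>)\<^sup>2 * snd (subgrad \<phi>)) (at_right \<phi>)"
    by simp
  have "((\<lambda>x. sin x / g (dir x)) has_real_derivative
     (cos \<phi> * g (dir \<phi>) - sin \<phi> * slope \<phi>) / (g (dir \<phi>) * g (dir \<phi>))) (at_right \<phi>)"
    by (rule DERIV_divide[OF s g_dir_right_derivative gp])
  moreover have "(\<lambda>x. sin x / g (dir x)) = (\<lambda>x. snd (bd x))"
    by (auto simp: bd_def \<rho>_def dir_def)
  moreover have "(cos \<phi> * g (dir \<phi>) - sin \<phi> * slope \<phi>) / (g (dir \<phi>) * g (dir \<phi>)) = (\<rho> \<phi>)\<^sup>2 * fst (subgrad \<phi>)"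
    using gp by (simp add: \<rho>_def subgrad_def dir_def rot90_def power2_eq_square divide_simps; simp add: algebra_simps)
  ultimately show "((\<lambda>x. snd (bd x)) has_real_derivative (\<rho> \<phi>)\<^sup>2 * fst (subgrad \<phi>)) (at_right \<phi>)"
    by simp
qed

lemma iarea_lipschitz:
  obtains L where "L > 0" "\<And>x y. \<bar>iarea x - iarea y\<bar> \<le> L * \<bar>x - y\<bar>"
proof -
  obtain c where c: "c > 0" "\<And>x y. c * \<bar>x - y\<bar> \<le> \<bar>area x - area y\<bar>" using area_expanding by blast
  have "\<bar>iarea x - iarea y\<bar> \<le> (1 / c) * \<bar>x - y\<bar>" for x y
    using c(2)[of "iarea x" "iarea y"] c(1) by (simp add: field_simps)
  then show thesis using that[of "1 / c"] c(1) by simp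
qed

lemma iarea_deriv: "(iarea has_real_derivative 1 / (\<rho> (iarea \<eta>))\<^sup>2) (at \<eta>)"
proof -
  obtain L where L: "L > 0" "\<And>x y. \<bar>iarea x - iarea y\<bar> \<le> L * \<bar>x - y\<bar>" using iarea_lipschitz by blast
  then have "L-lipschitz_on UNIV iarea" by (intro lipschitz_onI) (auto simp: dist_real_def)
  then have "isCont iarea \<eta>"
    using lipschitz_on_continuous_on continuous_on_eq_continuous_at by blast
  then have "(iarea has_real_derivative inverse ((\<rho> (iarea \<eta>))\<^sup>2)) (at \<eta>)"
    using area_deriv[of "iarea \<eta>"] \<rho>_pos[of "iarea \<eta>"]
    by (intro DERIV_inverse_function[where f = area and a = "\<eta> - 1" and b = "\<eta> + 1"]) auto
  then show ?thesis by (simp add: divide_inverse)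
qed

lemma iarea_strict_mono: "x < y \<Longrightarrow> iarea x < iarea y"
  using area_less_iff[of "iarea x" "iarea y"] by simp

text \<open>Passing from the angle to twice the swept area cancels the factor
  \<open>(\<rho> \<phi>)\<^sup>2\<close>. This generalizes the derivatives of sine and cosine, the
  velocity being a rotated point of the dual body.\<close>

lemma trig_right_derivative:
  "((\<lambda>x. fst (trig x)) has_real_derivative - snd (subgrad (iarea \<eta>))) (at_right \<eta>)"
  "((\<lambda>x. snd (trig x)) has_real_derivative fst (subgrad (iarea \<eta>))) (at_right \<eta>)"
proof -
  \<comment> \<open>Since \<open>iarea\<close> increases, it maps right neighbourhoods to right
    neighbourhoods, as the one-sided chain rule requires.\<close>
  have sub: "iarea ` {\<eta><..} \<subseteq> {iarea \<eta><..}" using iarea_strict_mono by auto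
  have i: "(iarea has_real_derivative 1 / (\<rho> (iarea \<eta>))\<^sup>2) (at_right \<eta>)"
    using iarea_deriv has_field_derivative_at_within by blast
  have r: "(\<rho> (iarea \<eta>))\<^sup>2 \<noteq> 0" using \<rho>_pos[of "iarea \<eta>"] by simp
  show "((\<lambda>x. fst (trig x)) has_real_derivative - snd (subgrad (iarea \<eta>))) (at_right \<eta>)"
    using DERIV_image_chain[OF has_field_derivative_subset[OF bd_right_derivative(1) sub] i] r
    by (simp add: o_def trig_def)
  show "((\<lambda>x. snd (trig x)) has_real_derivative fst (subgrad (iarea \<eta>))) (at_right \<eta>)"
    using DERIV_image_chain[OF has_field_derivative_subset[OF bd_right_derivative(2) sub] i] r
    by (simp add: o_def trig_def)
qed

lemma subgrad_trig: "subgrad (iarea \<eta>) \<bullet> trig \<eta> = 1"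
  by (simp add: trig_def subgrad_bd)

lemma trig_lipschitz:
  obtains L where "L > 0" "\<And>x y. norm (trig x - trig y) \<le> L * \<bar>x - y\<bar>"
proof -
  obtain L where L: "L > 0" "\<And>x y. \<bar>iarea x - iarea y\<bar> \<le> L * \<bar>x - y\<bar>" using iarea_lipschitz by blast
  obtain R where R: "R \<ge> 0" "\<And>x y. \<bar>\<rho> x - \<rho> y\<bar> \<le> R * \<bar>x - y\<bar>" using \<rho>_lipschitz by blast
  obtain lo hi where b: "lo > 0" "\<And>\<phi>. lo \<le> \<rho> \<phi>" "\<And>\<phi>. \<rho> \<phi> \<le> hi" using \<rho>_bounds by blast
  have hi: "hi > 0" using b(1) b(2)[of 0] b(3)[of 0] by simp
  have bd: "norm (bd x - bd y) \<le> (R + hi * 2) * \<bar>x - y\<bar>" for x y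
  proof -
    have "bd x - bd y = (\<rho> x - \<rho> y) *\<^sub>R dir x + \<rho> y *\<^sub>R (dir x - dir y)"
      by (simp add: bd_def algebra_simps)
    then have "norm (bd x - bd y) \<le> \<bar>\<rho> x - \<rho> y\<bar> + \<rho> y * norm (dir x - dir y)"
      using norm_triangle_ineq[of "(\<rho> x - \<rho> y) *\<^sub>R dir x" "\<rho> y *\<^sub>R (dir x - dir y)"] \<rho>_pos[of y] by simp
    also have "\<dots> \<le> R * \<bar>x - y\<bar> + hi * (2 * \<bar>x - y\<bar>)"
      using R(2)[of x y] b(3)[of y] dir_lipschitz[of x y] hi by (intro add_mono mult_mono) auto
    finally show ?thesis by (simp add: algebra_simps)
  qed
  have "norm (trig x - trig y) \<le> ((R + hi * 2) * L) * \<bar>x - y\<bar>" for x y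
  proof -
    have "norm (trig x - trig y) \<le> (R + hi * 2) * \<bar>iarea x - iarea y\<bar>" unfolding trig_def by (rule bd)
    also have "\<dots> \<le> (R + hi * 2) * (L * \<bar>x - y\<bar>)" using L(2) R(1) hi by (intro mult_left_mono) auto
    finally show ?thesis by (simp add: mult.assoc)
  qed
  then show thesis using that[of "(R + hi * 2) * L"] R(1) hi L(1) by (simp add: add_nonneg_pos)
qed

lemma trig_continuous: "continuous_on A trig"
proof -
  obtain L where L: "L > 0" "\<And>x y. norm (trig x - trig y) \<le> L * \<bar>x - y\<bar>" using trig_lipschitz by blast
  then have "L-lipschitz_on A trig" by (intro lipschitz_onI) (auto simp: dist_norm)
  then show ?thesis by (rule lipschitz_on_continuous_on)
qed

text \<open>The right derivative of \<open>trig\<close> serves for increasing and decreasing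
  \<open>\<eta>\<close> alike, because the limit of the difference quotients is taken under the time
  integral and not along the curve.\<close>

lemma bounded_primitive_trig:
  assumes "bounded_primitive a b \<eta> v"
  shows "bounded_primitive a b (\<lambda>t. trig (\<eta> t)) (\<lambda>t. v t *\<^sub>R rot90 (subgrad (iarea (\<eta> t))))"
proof -
  obtain L where L: "L > 0" "\<And>x y. norm (trig x - trig y) \<le> L * \<bar>x - y\<bar>" using trig_lipschitz by blast
  have "\<bar>fst (trig x) - fst (trig y)\<bar> \<le> L * \<bar>x - y\<bar>" "\<bar>snd (trig x) - snd (trig y)\<bar> \<le> L * \<bar>x - y\<bar>" for x y
    using norm_fst_le[of "fst (trig x - trig y)" "snd (trig x - trig y)"]
      norm_snd_le[of "snd (trig x - trig y)" "fst (trig x - trig y)"] L(2)[of x y]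
    unfolding prod.collapse by auto
  then have lip: "L-lipschitz_on UNIV (\<lambda>x. fst (trig x))" "L-lipschitz_on UNIV (\<lambda>x. snd (trig x))"
    using L(1) by (auto intro!: lipschitz_onI simp: dist_real_def)
  show ?thesis
    using bounded_primitive_Pair[OF
      bounded_primitive_chain_right_derivative[OF assms lip(1) trig_right_derivative(1)]
      bounded_primitive_chain_right_derivative[OF assms lip(2) trig_right_derivative(2)]]
    by (simp add: rot90_def mult.commute)
qed

text \<open>The wedge is twice the signed area of a triangle with one vertex at the origin, and
  \<open>y - x\<close> is twice the area of the corresponding sector. Analytically, the derivative
  \<open>trig x \<bullet> subgrad (iarea t)\<close> of the wedge equals 1 at \<open>t = x\<close>
  and deviates from 1 by at most a multiple of \<open>\<bar>t - x\<bar>\<close>.\<close>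

lemma trig_wedge:
  obtains C where "C > 0" "\<And>x y. \<bar>rot90 (trig x) \<bullet> trig y - (y - x)\<bar> \<le> C * (y - x)\<^sup>2"
proof -
  obtain L where L: "L > 0" "\<And>x y. norm (trig x - trig y) \<le> L * \<bar>x - y\<bar>" using trig_lipschitz by blast
  have *: "\<bar>rot90 (trig x) \<bullet> trig y - (y - x)\<bar> \<le> (L * lip) * (y - x)\<^sup>2" if "x \<le> y" for x y
  proof -
    define w where "w t = rot90 (subgrad (iarea t))" for t
    have "bounded_primitive x y (\<lambda>t. t) (\<lambda>t. 1)"
      unfolding bounded_primitive_def
    proof (intro conjI allI impI exI[of _ 1])
      fix s t :: real assume "x \<le> s \<and> s \<le> t \<and> t \<le> y"
      then show "((\<lambda>t. 1) has_integral t - s) {s..t}"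
        using has_integral_const_real[of "1::real" s t] by simp
    qed auto
    from bounded_primitive_trig[OF this]
    have "bounded_primitive x y (\<lambda>t. trig t) w" by (simp add: w_def[abs_def])
    then have "(w has_integral (trig y - trig x)) {x..y}"
      using \<open>x \<le> y\<close> by (simp add: bounded_primitive_def)
    from has_integral_linear[OF this bounded_linear_inner_right[of "rot90 (trig x)"]]
    have i: "((\<lambda>t. rot90 (trig x) \<bullet> w t) has_integral rot90 (trig x) \<bullet> trig y) {x..y}"
      by (simp add: o_def inner_diff_right)
    have c: "((\<lambda>t. 1::real) has_integral (y - x)) {x..y}"
      using has_integral_const_real[of "1::real" x y] \<open>x \<le> y\<close> by simp
    have "norm (rot90 (trig x) \<bullet> trig y - (y - x)) \<le> (L * lip * (y - x)) * measure lborel {x..y}"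
    proof (rule has_integral_bound_real[where S = "{}", OF _ _ has_integral_diff[OF i c]])
      fix t assume "t \<in> {x..y} - {}"
      then have t: "t \<in> {x..y}" by simp
      have "rot90 (trig x) \<bullet> w t = trig x \<bullet> subgrad (iarea t)"
        by (simp add: w_def rot90_def inner_prod_def)
      also have "\<dots> - 1 = (trig x - trig t) \<bullet> subgrad (iarea t)"
        using subgrad_trig[of t] by (simp add: inner_diff_left inner_diff_right inner_commute)
      finally have "norm (rot90 (trig x) \<bullet> w t - 1) \<le> norm (trig x - trig t) * norm (subgrad (iarea t))"
        by (simp add: Cauchy_Schwarz_ineq2)
      also have "\<dots> \<le> (L * (y - x)) * lip"
      proof (intro mult_mono norm_subgrad)
        have "norm (trig x - trig t) \<le> L * \<bar>x - t\<bar>" by (rule L)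
        also have "\<dots> \<le> L * (y - x)" using t L(1) by (intro mult_left_mono) auto
        finally show "norm (trig x - trig t) \<le> L * (y - x)" .
      qed (use L(1) \<open>x \<le> y\<close> in auto)
      finally show "norm (rot90 (trig x) \<bullet> w t - 1) \<le> L * lip * (y - x)" by (simp add: ac_simps)
    qed (use L(1) lip_pos \<open>x \<le> y\<close> in auto)
    then show ?thesis using \<open>x \<le> y\<close> by (simp add: power2_eq_square mult.assoc)
  qed
  have "\<bar>rot90 (trig x) \<bullet> trig y - (y - x)\<bar> \<le> (L * lip) * (y - x)\<^sup>2" for x y
  proof (cases "x \<le> y")
    case False
    then show ?thesis
      using *[of y x] rot90_inner_swap[of "trig x" "trig y"] by (simp add: power2_commute[of x y])
  qed (rule *)
  then show thesis using that[of "L * lip"] L(1) lip_pos by simp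
qed

text \<open>\<open>ang\<close> jumps across the positive x-axis. A continuous complex logarithm
  along the curve supplies an angle that does not, and \<open>area\<close> turns this angle into the
  parameter.\<close>

lemma trig_lift:
  fixes P :: "real \<Rightarrow> real \<times> real"
  assumes P: "continuous_on {a..b} P" and gP: "\<And>t. t \<in> {a..b} \<Longrightarrow> g (P t) = 1"
  obtains \<xi> where "continuous_on {a..b} \<xi>" "\<And>t. t \<in> {a..b} \<Longrightarrow> P t = trig (\<xi> t)"
proof -
  define c where "c t = Complex (fst (P t)) (snd (P t))" for t
  have "continuous_on {a..b} c"
    unfolding c_def Complex_eq by (intro continuous_intros P)
  moreover have "c t \<noteq> 0" if "t \<in> {a..b}" for t
  proof -
    have "P t \<noteq> 0" using gP[OF that] by auto
    then show ?thesis by (simp add: c_def complex_eq_iff prod_eq_iff)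
  qed
  ultimately obtain l where l: "continuous_on {a..b} l" "\<And>t. t \<in> {a..b} \<Longrightarrow> c t = exp (l t)"
    using continuous_logarithm_on_contractible[of "{a..b}" c] convex_imp_contractible[of "{a..b}"] by auto
  show thesis
  proof (rule that[of "\<lambda>t. area (Im (l t))"])
    show "continuous_on {a..b} (\<lambda>t. area (Im (l t)))"
      by (rule continuous_on_compose2[OF area_continuous[of UNIV]]) (auto intro!: continuous_intros l)
    fix t assume t: "t \<in> {a..b}"
    define r where "r = exp (Re (l t))"
    have "fst (P t) = r * cos (Im (l t))" "snd (P t) = r * sin (Im (l t))"
      using l(2)[OF t] by (auto simp: c_def complex_eq_iff Re_exp Im_exp r_def)
    then have Pr: "P t = r *\<^sub>R dir (Im (l t))" by (simp add: dir_def prod_eq_iff)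
    have "r * g (dir (Im (l t))) = 1" using gP[OF t] by (simp add: Pr hom r_def)
    then have "r = \<rho> (Im (l t))" using g_dir_pos[of "Im (l t)"] by (simp add: \<rho>_def field_simps)
    then show "P t = trig (area (Im (l t)))" by (simp add: trig_def bd_def Pr)
  qed
qed

end

section \<open>Support functions and polar sets\<close>

context planar_gauge
begin

text \<open>The swept area \<open>E\<close> determines a curve on the boundary: lifting it as \<open>trig \<circ> \<xi>\<close>, the
  wedge estimate shows that \<open>\<xi> - E\<close> is constant.\<close>

lemma trig_reparam:
  assumes P: "bounded_primitive a b P w" and gP: "\<And>t. t \<in> {a..b} \<Longrightarrow> g (P t) = 1"
    and E: "bounded_primitive a b E (\<lambda>t. rot90 (P t) \<bullet> w t)"
  obtains \<eta>0 where "\<And>t. t \<in> {a..b} \<Longrightarrow> P t = trig (\<eta>0 + (E t - E a))"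
proof -
  have Pc: "continuous_on {a..b} P" using bounded_primitive_continuous[OF P] .
  obtain \<xi> where \<xi>c: "continuous_on {a..b} \<xi>" and \<xi>: "\<And>t. t \<in> {a..b} \<Longrightarrow> P t = trig (\<xi> t)"
    using trig_lift[OF Pc gP] by blast
  obtain C where C: "C > 0" "\<And>x y. \<bar>rot90 (trig x) \<bullet> trig y - (y - x)\<bar> \<le> C * (y - x)\<^sup>2"
    using trig_wedge by blast
  obtain B where B: "B > 0" "\<And>x y. x \<in> {a..b} \<Longrightarrow> y \<in> {a..b} \<Longrightarrow> norm (P y - P x) \<le> B * \<bar>y - x\<bar>"
    using bounded_primitive_diff_bound[OF P] by metis
  obtain \<delta>0 where \<delta>0: "\<delta>0 > 0" "\<And>z. g z \<ge> \<delta>0 * norm z" using lower by blast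
  define N where "N = 1 / \<delta>0"
  have N: "N > 0" using \<delta>0(1) by (simp add: N_def)
  have PN: "norm (P t) \<le> N" if "t \<in> {a..b}" for t
    using \<delta>0(1) \<delta>0(2)[of "P t"] gP[OF that] by (auto simp: N_def field_simps)
  have "uniformly_continuous_on {a..b} \<xi>"
    by (rule compact_uniformly_continuous[OF \<xi>c]) auto
  \<comment> \<open>For \<open>\<bar>D\<bar> < 1 / (2 * C)\<close> the quadratic error
    \<open>C * D\<^sup>2\<close> of the wedge estimate is at most \<open>\<bar>D\<bar> / 2\<close>.
    It can then be absorbed, which yields a local Lipschitz bound for \<open>\<xi>\<close>.\<close>
  moreover have "1 / (2 * C) > 0" using C(1) by simp
  ultimately obtain d where "d > 0"
    and d: "\<And>x y. x \<in> {a..b} \<Longrightarrow> y \<in> {a..b} \<Longrightarrow> dist y x < d \<Longrightarrow> dist (\<xi> y) (\<xi> x) < 1 / (2 * C)"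
    unfolding uniformly_continuous_on_def by metis
  let ?e = "\<lambda>t. rot90 (P t) \<bullet> w t"
  define G where "G t = \<xi> t - E t" for t
  have const: "G a = G u" if u: "u \<in> {a..b}" for u
  proof (rule bounded_primitive_const_test[where a = a and b = u and G = G and R = "N + 1" and d = d and C = "C * (2 * N * B)\<^sup>2"])
    show "a \<le> u" using u by simp
    show "bounded_primitive a u (\<lambda>t. (P t, E t)) (\<lambda>t. (w t, ?e t))"
      by (rule bounded_primitive_subinterval[OF bounded_primitive_Pair[OF P E]]) (use u in auto)
    show "continuous_on {a..u} G"
      unfolding G_def
      using continuous_on_subset[OF \<xi>c, of "{a..u}"]
        continuous_on_subset[OF bounded_primitive_continuous[OF E], of "{a..u}"] u
      by (auto intro!: continuous_intros)
    show "N + 1 \<ge> 0" using N by simp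
    fix r s assume rs: "a \<le> r" "r < s" "s \<le> u" "s - r < d"
    then have r: "r \<in> {a..b}" and s: "s \<in> {a..b}" using u by auto
    let ?N = "norm ((P s, E s) - (P r, E r) - (s - r) *\<^sub>R (w r, ?e r))"
    define z where "z = P s - P r - (s - r) *\<^sub>R w r"
    define y where "y = E s - E r - (s - r) * ?e r"
    have zy: "norm z \<le> ?N" "\<bar>y\<bar> \<le> ?N"
      using norm_fst_le[of z y] norm_snd_le[of y z] by (auto simp: z_def y_def)
    define D where "D = \<xi> s - \<xi> r"
    have W: "\<bar>rot90 (P r) \<bullet> (P s - P r) - D\<bar> \<le> C * D\<^sup>2"
      using C(2)[of "\<xi> r" "\<xi> s"] \<xi>[OF r] \<xi>[OF s] by (simp add: D_def inner_diff_right)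
    have "\<bar>D\<bar> < 1 / (2 * C)" using d[OF r s] rs by (simp add: D_def dist_real_def)
    then have "C * \<bar>D\<bar> \<le> 1 / 2" using C(1) by (simp add: field_simps)
    then have "C * \<bar>D\<bar> * \<bar>D\<bar> \<le> 1 / 2 * \<bar>D\<bar>" by (intro mult_right_mono) auto
    then have "C * D\<^sup>2 \<le> \<bar>D\<bar> / 2" by (simp add: power2_eq_square mult.assoc abs_mult_self_eq)
    moreover have "\<bar>rot90 (P r) \<bullet> (P s - P r)\<bar> \<le> N * (B * (s - r))"
    proof -
      have "\<bar>rot90 (P r) \<bullet> (P s - P r)\<bar> \<le> norm (rot90 (P r)) * norm (P s - P r)"
        by (rule Cauchy_Schwarz_ineq2)
      also have "\<dots> \<le> N * (B * (s - r))"
        using PN[OF r] B(2)[OF r s] rs N by (intro mult_mono) auto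
      finally show ?thesis .
    qed
    ultimately have "\<bar>D\<bar> \<le> 2 * N * B * (s - r)" using W by (auto simp: abs_le_iff)
    then have "\<bar>D\<bar>\<^sup>2 \<le> (2 * N * B * (s - r))\<^sup>2" by (intro power_mono) auto
    then have "C * D\<^sup>2 \<le> C * (2 * N * B * (s - r))\<^sup>2" using C(1) by simp
    then have CD: "C * D\<^sup>2 \<le> C * (2 * N * B)\<^sup>2 * (s - r)\<^sup>2" by (simp add: power_mult_distrib)
    \<comment> \<open>The first-order terms cancel because the velocity of \<open>E\<close> is
      \<open>rot90 (P r) \<bullet> w r\<close>. What is left is the wedge error and the remainders
      of \<open>P\<close> and of \<open>E\<close>.\<close>
    have "G s - G r = (D - rot90 (P r) \<bullet> (P s - P r)) + rot90 (P r) \<bullet> z - y"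
      by (simp add: G_def D_def z_def y_def inner_diff_right algebra_simps)
    moreover have "\<bar>rot90 (P r) \<bullet> z\<bar> \<le> N * ?N"
    proof -
      have "\<bar>rot90 (P r) \<bullet> z\<bar> \<le> norm (rot90 (P r)) * norm z" by (rule Cauchy_Schwarz_ineq2)
      also have "\<dots> \<le> N * ?N" using PN[OF r] zy N by (intro mult_mono) auto
      finally show ?thesis .
    qed
    ultimately show "\<bar>G s - G r\<bar> \<le> (N + 1) * ?N + C * (2 * N * B)\<^sup>2 * (s - r)\<^sup>2"
      using W CD zy(2) by (simp add: algebra_simps)
  qed (use \<open>d > 0\<close> in auto)
  have "P t = trig (\<xi> a + (E t - E a))" if "t \<in> {a..b}" for t
    using const[OF that] \<xi>[OF that] by (simp add: G_def algebra_simps)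
  then show thesis using that by blast
qed

end

section \<open>Support functions, bipolars and the Minkowski functional\<close>

definition support_fun :: "(real \<times> real) set \<Rightarrow> real \<times> real \<Rightarrow> real" where
  "support_fun S h = (SUP x\<in>S. h \<bullet> x)"

lemma polar_eq: "polar S = {p. \<forall>x\<in>S. p \<bullet> x \<le> 1}"
  by (auto simp: polar_def inner_prod_def)

lemma support_attained:
  assumes "compact S" "S \<noteq> {}"
  obtains x where "x \<in> S" "h \<bullet> x = support_fun S h"
proof -
  have "continuous_on S (\<lambda>x. h \<bullet> x)" by (intro continuous_intros)
  then obtain x where x: "x \<in> S" "\<And>y. y \<in> S \<Longrightarrow> h \<bullet> y \<le> h \<bullet> x"
    using continuous_attains_sup[OF assms] by blast
  then have "support_fun S h = h \<bullet> x"
    unfolding support_fun_def by (intro cSup_eq_maximum) auto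
  then show thesis using that x by simp
qed

lemma support_upper:
  assumes "compact S" "x \<in> S"
  shows "h \<bullet> x \<le> support_fun S h"
proof -
  have "continuous_on S (\<lambda>x. h \<bullet> x)" by (intro continuous_intros)
  then have "bdd_above ((\<lambda>x. h \<bullet> x) ` S)"
    by (intro bounded_imp_bdd_above compact_imp_bounded compact_continuous_image assms(1))
  then show ?thesis unfolding support_fun_def using assms(2) by (rule cSUP_upper2[OF _ _ order_refl])
qed

lemma support_le_iff:
  assumes "compact S" "S \<noteq> {}"
  shows "support_fun S h \<le> c \<longleftrightarrow> (\<forall>x\<in>S. h \<bullet> x \<le> c)"
  using support_attained[OF assms, of h] support_upper[OF assms(1), of _ h] by (metis order_trans)

lemma planar_gauge_support:
  assumes S: "compact S" and 0: "0 \<in> interior S"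
  shows "planar_gauge (support_fun S)"
proof
  have ne: "S \<noteq> {}" using 0 interior_subset by blast
  fix x y z :: "real \<times> real" and r :: real
  show "support_fun S (r *\<^sub>R z) = r * support_fun S z" if "r \<ge> 0"
  proof (rule antisym)
    show "support_fun S (r *\<^sub>R z) \<le> r * support_fun S z"
      using support_upper[OF S, of _ z] that by (auto simp: support_le_iff[OF S ne] mult_left_mono)
    obtain x where "x \<in> S" "z \<bullet> x = support_fun S z" using support_attained[OF S ne] by blast
    then show "r * support_fun S z \<le> support_fun S (r *\<^sub>R z)"
      using support_upper[OF S, of x "r *\<^sub>R z"] by simp
  qed
  show "support_fun S (x + y) \<le> support_fun S x + support_fun S y"
    using support_upper[OF S, of _ x] support_upper[OF S, of _ y]
    by (auto simp: support_le_iff[OF S ne] inner_add_left intro: add_mono)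
  show "support_fun S z > 0" if "z \<noteq> 0"
  proof -
    obtain e where e: "e > 0" "ball 0 e \<subseteq> S" using 0 by (meson mem_interior)
    define x where "x = (e / (2 * norm z)) *\<^sub>R z"
    have "norm x = e / 2" using that e(1) by (simp add: x_def)
    then have "x \<in> S" using e by auto
    moreover have "z \<bullet> x > 0" using that e(1) by (simp add: x_def)
    ultimately show ?thesis using support_upper[OF S, of x z] by simp
  qed
qed

lemma polar_eq_K:
  assumes "compact S" "0 \<in> interior S"
  shows "polar S = planar_gauge.K (support_fun S)"
proof -
  interpret planar_gauge "support_fun S" by (rule planar_gauge_support[OF assms])
  have "S \<noteq> {}" using assms(2) interior_subset by blast
  then show ?thesis using support_le_iff[OF assms(1)] by (simp add: K_def polar_eq)
qed

lemma polar_compact_interior: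
  assumes "compact S" "0 \<in> interior S"
  shows "compact (polar S)" "0 \<in> interior (polar S)"
proof -
  interpret planar_gauge "support_fun S" by (rule planar_gauge_support[OF assms])
  show "compact (polar S)" "0 \<in> interior (polar S)"
    unfolding polar_eq_K[OF assms] using compact_K interior_K by auto
qed

text \<open>A point outside \<open>S\<close> is separated from \<open>S\<close> by a hyperplane.
  Because \<open>0\<close> lies in \<open>S\<close>, the separating level \<open>b\<close> is
  negative, so division by \<open>b\<close> reverses the inequalities and turns the normal into an
  element of the polar set that excludes the point.\<close>

lemma bipolar:
  assumes "compact S" "convex S" "0 \<in> S"
  shows "polar (polar S) = S"
proof
  show "S \<subseteq> polar (polar S)" by (auto simp: polar_eq inner_commute)
  show "polar (polar S) \<subseteq> S"
  proof (rule subsetI, rule ccontr)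
    fix z assume z: "z \<in> polar (polar S)" "z \<notin> S"
    obtain a b where ab: "a \<bullet> z < b" "\<forall>x\<in>S. b < a \<bullet> x"
      using separating_hyperplane_closed_point[of S z] assms z(2) compact_imp_closed by blast
    have b: "b < 0" using ab(2) assms(3) by force
    have "(a /\<^sub>R b) \<bullet> x \<le> 1" if "x \<in> S" for x
      using ab(2) that b by (force simp: field_simps)
    then have "a /\<^sub>R b \<in> polar S" by (simp add: polar_eq)
    then have "z \<bullet> (a /\<^sub>R b) \<le> 1" using z(1) unfolding polar_eq[of "polar S"] by blast
    then show False using ab(1) b by (simp add: field_simps inner_commute)
  qed
qed

lemma mink_polar:
  assumes "compact S" "0 \<in> interior S"
  shows "mink (polar S) h = support_fun S h"
proof -
  interpret planar_gauge "support_fun S" by (rule planar_gauge_support[OF assms])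
  have "h \<in> (\<lambda>z. r *\<^sub>R z) ` polar S \<longleftrightarrow> support_fun S h \<le> r" if r: "r > 0" for r
  proof
    assume "h \<in> (\<lambda>z. r *\<^sub>R z) ` polar S"
    then obtain z where "h = r *\<^sub>R z" "support_fun S z \<le> 1"
      by (auto simp: polar_eq_K[OF assms] K_def)
    then show "support_fun S h \<le> r" using r by (simp add: hom)
  next
    assume "support_fun S h \<le> r"
    then have "support_fun S (h /\<^sub>R r) \<le> 1" using r by (simp add: hom field_simps)
    then have "h /\<^sub>R r \<in> polar S" by (simp add: polar_eq_K[OF assms] K_def)
    moreover have "h = r *\<^sub>R (h /\<^sub>R r)" using r by simp
    ultimately show "h \<in> (\<lambda>z. r *\<^sub>R z) ` polar S" by blast
  qed
  then have eq: "{r. r > 0 \<and> h \<in> (\<lambda>z. r *\<^sub>R z) ` polar S} = {r. r > 0 \<and> support_fun S h \<le> r}"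
    by auto
  show ?thesis unfolding mink_def eq
  proof (rule cInf_eq_non_empty)
    show "{r. r > 0 \<and> support_fun S h \<le> r} \<noteq> {}"
      using nonneg[of h] by (auto intro!: exI[of _ "support_fun S h + 1"])
    show "y \<le> support_fun S h" if "\<And>x. x \<in> {r. r > 0 \<and> support_fun S h \<le> r} \<Longrightarrow> y \<le> x" for y
    \<comment> \<open>For \<open>h = 0\<close> the support function vanishes and does not belong to
      the set of positive \<open>r\<close>. The infimum is then not attained, hence the
      approximation by \<open>e\<close>.\<close>
    proof (rule field_le_epsilon)
      fix e :: real assume "e > 0"
      then show "y \<le> support_fun S h + e" using nonneg[of h] by (intro that) auto
    qed
  qed auto
qed

section \<open>Pontryagin's maximum condition on the Heisenberg group\<close>

lemma bounded_primitive_cong: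
  assumes "\<And>t. t \<in> {a..b} \<Longrightarrow> h t = h' t" "\<And>t. t \<in> {a..b} \<Longrightarrow> w t = w' t"
  shows "bounded_primitive a b h w \<longleftrightarrow> bounded_primitive a b h' w'"
proof -
  have *: "(w has_integral (h y - h x)) {x..y} \<longleftrightarrow> (w' has_integral (h' y - h' x)) {x..y}"
    if "a \<le> x" "x \<le> y" "y \<le> b" for x y
  proof -
    have "h y - h x = h' y - h' x" using assms(1)[of x] assms(1)[of y] that by simp
    then show ?thesis using has_integral_cong[of "{x..y}" w w'] assms(2) that by simp
  qed
  have "(\<exists>B. \<forall>x\<in>{a..b}. norm (w x) \<le> B) \<longleftrightarrow> (\<exists>B. \<forall>x\<in>{a..b}. norm (w' x) \<le> B)"
    using assms(2) by simp
  then show ?thesis unfolding bounded_primitive_def using * by blast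
qed

text \<open>The equation for \<open>p\<close> expresses the planar coordinates through
  \<open>p\<close>. For the third one, \<open>snd (p s) * snd (U s)\<close> is half of
  \<open>p s \<bullet> U s\<close>, which is known, minus \<open>1 / (2 * c)\<close> times the
  derivative of \<open>fst (p s) * snd (p s)\<close>; the factors 1/2 in the third coordinate come
  from here.\<close>

lemma coordinate_formulas:
  fixes p U :: "real \<Rightarrow> real \<times> real"
  assumes p: "bounded_primitive 0 T p (\<lambda>t. c *\<^sub>R rot90 (U t))" and "c \<noteq> 0"
    and v: "v3 integrable_on {0..T}"
    and pU: "\<And>t. t \<in> {0..T} \<Longrightarrow> p t \<bullet> U t = H - c * v3 t"
    and t: "t \<in> {0..T}"
  shows "integral {0..t} (\<lambda>s. fst (U s)) = (snd (p t) - snd (p 0)) / c"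
    and "integral {0..t} (\<lambda>s. snd (U s)) = - (fst (p t) - fst (p 0)) / c"
    and "integral {0..t} (\<lambda>s. v3 s + integral {0..s} (\<lambda>r. fst (U r)) * snd (U s)) =
      H * t / (2 * c) + integral {0..t} v3 / 2
      - (fst (p t) * snd (p t) - fst (p 0) * snd (p 0)) / (2 * c\<^sup>2)
      + snd (p 0) * (fst (p t) - fst (p 0)) / c\<^sup>2"
proof -
  have p1: "bounded_primitive 0 T (\<lambda>t. fst (p t)) (\<lambda>t. - c * snd (U t))"
    using bounded_primitive_linear[OF p bounded_linear_fst] by (simp add: rot90_def)
  have p2: "bounded_primitive 0 T (\<lambda>t. snd (p t)) (\<lambda>t. c * fst (U t))"
    using bounded_primitive_linear[OF p bounded_linear_snd] by (simp add: rot90_def)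
  have x1: "((\<lambda>s. fst (U s)) has_integral (snd (p u) - snd (p 0)) / c) {0..u}"
    and x2: "((\<lambda>s. snd (U s)) has_integral - (fst (p u) - fst (p 0)) / c) {0..u}"
    if "u \<in> {0..T}" for u
  proof -
    have "((\<lambda>t. c * fst (U t)) has_integral snd (p u) - snd (p 0)) {0..u}"
      using p2 that unfolding bounded_primitive_def by auto
    from has_integral_divide[OF this, of c]
    show "((\<lambda>s. fst (U s)) has_integral (snd (p u) - snd (p 0)) / c) {0..u}"
      using \<open>c \<noteq> 0\<close> by simp
    have "((\<lambda>t. - c * snd (U t)) has_integral fst (p u) - fst (p 0)) {0..u}"
      using p1 that unfolding bounded_primitive_def by auto
    from has_integral_divide[OF this, of "- c"]
    show "((\<lambda>s. snd (U s)) has_integral - (fst (p u) - fst (p 0)) / c) {0..u}"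
      using \<open>c \<noteq> 0\<close> by (simp add: diff_divide_distrib)
  qed
  show 1: "integral {0..t} (\<lambda>s. fst (U s)) = (snd (p t) - snd (p 0)) / c"
    using x1[OF t] by (rule integral_unique)
  show 2: "integral {0..t} (\<lambda>s. snd (U s)) = - (fst (p t) - fst (p 0)) / c"
    using x2[OF t] by (rule integral_unique)
  have "((\<lambda>s. (- c * snd (U s)) * snd (p s) + fst (p s) * (c * fst (U s))) has_integral
      fst (p t) * snd (p t) - fst (p 0) * snd (p 0)) {0..t}"
    using bounded_primitive_mult[OF p1 p2] t unfolding bounded_primitive_def by auto
  note i2 = has_integral_divide[OF this, of "2 * c\<^sup>2"]
  have "v3 integrable_on {0..t}" using t by (intro integrable_subinterval_real[OF v]) auto
  then have "(v3 has_integral integral {0..t} v3) {0..t}" by (rule integrable_integral)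
  note i1 = has_integral_divide[OF this, of 2]
  have i4: "((\<lambda>s. H / (2 * c)) has_integral H * t / (2 * c)) {0..t}"
    using has_integral_const_real[of "H / (2 * c)" 0 t] t by (simp add: mult.commute)
  note i3 = has_integral_mult_right[OF x2[OF t], of "- snd (p 0) / c"]
  have "((\<lambda>s. v3 s + integral {0..s} (\<lambda>r. fst (U r)) * snd (U s)) has_integral
      H * t / (2 * c) + integral {0..t} v3 / 2
      - (fst (p t) * snd (p t) - fst (p 0) * snd (p 0)) / (2 * c\<^sup>2)
      + (- snd (p 0) / c) * (- (fst (p t) - fst (p 0)) / c)) {0..t}"
  proof (rule has_integral_eq[OF _ has_integral_add[OF has_integral_diff[OF has_integral_add[OF i4 i1] i2] i3]])
    fix s assume "s \<in> {0..t}"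
    then have s: "s \<in> {0..T}" using t by auto
    have X: "integral {0..s} (\<lambda>r. fst (U r)) = (snd (p s) - snd (p 0)) / c"
      using x1[OF s] by (rule integral_unique)
    have H: "H = c * v3 s + fst (p s) * fst (U s) + snd (p s) * snd (U s)"
      using pU[OF s] by (simp add: inner_prod_def)
    show "H / (2 * c) + v3 s / 2 - ((- c * snd (U s)) * snd (p s) + fst (p s) * (c * fst (U s))) / (2 * c\<^sup>2)
        + - snd (p 0) / c * snd (U s) = v3 s + integral {0..s} (\<lambda>r. fst (U r)) * snd (U s)"
      unfolding X H using \<open>c \<noteq> 0\<close> by (simp add: field_simps power2_eq_square)
  qed
  moreover have "(- s / c) * (- x / c) = s * x / c\<^sup>2" for s x :: real by (simp add: power2_eq_square)
  ultimately show "integral {0..t} (\<lambda>s. v3 s + integral {0..s} (\<lambda>r. fst (U r)) * snd (U s)) =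
      H * t / (2 * c) + integral {0..t} v3 / 2
      - (fst (p t) * snd (p t) - fst (p 0) * snd (p 0)) / (2 * c\<^sup>2)
      + snd (p 0) * (fst (p t) - fst (p 0)) / c\<^sup>2"
    by (simp only: integral_unique)
qed

lemma argmax_on_SUP:
  assumes "v \<in> argmax_on S g" shows "(SUP w\<in>S. g w) = g v"
  using assms unfolding argmax_on_def by (intro cSup_eq_maximum) auto

section \<open>The maximum condition and its decoupling\<close>

locale heisenberg_control =
  fixes \<Omega> :: "(real \<times> real) set" and f :: "real \<Rightarrow> real" and m M :: real
  assumes comp: "compact \<Omega>" and conv: "convex \<Omega>" and int0: "0 \<in> interior \<Omega>"
    and m_pos: "m > 0" and M_pos: "M > 0"
    and f_cont: "continuous_on {-m..M} f" and f_pos: "\<forall>v \<in> {-m<..<M}. f v > 0"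
begin

lemma zero_in: "0 \<in> \<Omega>" using int0 interior_subset by blast

text \<open>\<open>Pol\<close> and \<open>Om\<close> are named after the unit balls: the support
  function of \<Omega> has unit ball \<open>polar \<Omega>\<close>, and that of
  \<open>polar \<Omega>\<close> has unit ball \<Omega> by the bipolar theorem.\<close>

sublocale Pol: planar_gauge "support_fun \<Omega>"
  by (rule planar_gauge_support[OF comp int0])

sublocale Om: planar_gauge "support_fun (polar \<Omega>)"
  by (rule planar_gauge_support[OF polar_compact_interior[OF comp int0]])

lemma polar_K: "polar \<Omega> = Pol.K"
  by (rule polar_eq_K[OF comp int0])

lemma Om_K: "\<Omega> = Om.K"
  using polar_eq_K[OF polar_compact_interior[OF comp int0]] bipolar[OF comp conv zero_in] by simp

lemma cs_polar: "cos_cvx (polar \<Omega>) \<eta> = fst (Pol.trig \<eta>)" "sin_cvx (polar \<Omega>) \<eta> = snd (Pol.trig \<eta>)"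
  by (simp_all add: cos_cvx_def sin_cvx_def polar_K Pol.cvx_cossin_K)

lemma cs_Om: "cos_cvx \<Omega> \<theta> = fst (Om.trig \<theta>)" "sin_cvx \<Omega> \<theta> = snd (Om.trig \<theta>)"
  by (subst Om_K, simp add: cos_cvx_def sin_cvx_def Om.cvx_cossin_K)+

lemma circ_set_iff: "\<theta> \<in> circ_set \<Omega> \<eta> \<longleftrightarrow> Pol.trig \<eta> \<bullet> Om.trig \<theta> = 1"
  by (simp add: circ_set_def cs_polar cs_Om inner_prod_def)

lemma trig_Om_in: "Om.trig \<theta> \<in> \<Omega>"
  by (subst Om_K) (simp add: Om.K_def)

text \<open>The subgradient inequality on the polar set says that the point lies in the bipolar.
  This is what makes the velocity of \<open>Pol.trig\<close> realizable by admissible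
  controls.\<close>

lemma subgrad_in: "Pol.subgrad \<phi> \<in> \<Omega>"
proof -
  have "Pol.subgrad \<phi> \<bullet> p \<le> 1" if "p \<in> polar \<Omega>" for p
    using Pol.subgrad_le[of \<phi> p] that by (simp add: polar_K Pol.K_def)
  then have "Pol.subgrad \<phi> \<in> polar (polar \<Omega>)" unfolding polar_eq[of "polar \<Omega>"] by blast
  then show ?thesis using bipolar[OF comp conv zero_in] by simp
qed

text \<open>Positivity is given inside the interval only; at the endpoints, where \<open>f\<close>
  may vanish, continuity carries over the weak inequality.\<close>

lemma f_nonneg: "v \<in> {-m..M} \<Longrightarrow> f v \<ge> 0"
proof (rule continuous_ge_on_closure[of "{-m<..<M}" f v 0])
  have "closure {-m<..<M} = {-m..M}" using m_pos M_pos by simp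
  then show "continuous_on (closure {-m<..<M}) f" using f_cont by simp
  show "v \<in> {-m..M} \<Longrightarrow> v \<in> closure {-m<..<M}" using m_pos M_pos by simp
qed (use f_pos in \<open>force intro: less_imp_le\<close>)

lemma argmax_exists:
  obtains v where "v \<in> argmax_on {-m..M} (\<lambda>v. a * f v + c * v)"
proof -
  have "continuous_on {-m..M} (\<lambda>v. a * f v + c * v)" by (intro continuous_intros f_cont)
  moreover have "{-m..M} \<noteq> {}" using m_pos M_pos by simp
  ultimately obtain v where "v \<in> {-m..M}" "\<forall>w\<in>{-m..M}. a * f w + c * w \<le> a * f v + c * v"
    using continuous_attains_sup[OF compact_Icc] by blast
  then show thesis by (intro that[of v]) (simp add: argmax_on_def)
qed

text \<open>Decoupled maximum condition: \<open>\<omega>\<close> maximizes the form \<open>h\<close>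
  on \<Omega>, and \<open>v\<close> maximizes the scalar function that results from inserting the
  maximum. Where \<open>f v = 0\<close> the planar control vanishes and any maximizer
  \<open>\<omega>\<close> is a witness.\<close>

definition maximal :: "real \<times> real \<Rightarrow> real \<Rightarrow> real \<times> real \<Rightarrow> real \<Rightarrow> bool" where
  "maximal h c u v \<longleftrightarrow> (\<exists>\<omega>\<in>\<Omega>. u = f v *\<^sub>R \<omega> \<and> h \<bullet> \<omega> = support_fun \<Omega> h) \<and>
     v \<in> argmax_on {-m..M} (\<lambda>v. support_fun \<Omega> h * f v + c * v)"

lemma Uset_iff: "(u1, u2, v) \<in> Uset \<Omega> f m M \<longleftrightarrow> v \<in> {-m..M} \<and> (\<exists>\<omega>\<in>\<Omega>. (u1, u2) = f v *\<^sub>R \<omega>)"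
  by (simp add: Uset_def)

lemma maximal_exists: "\<exists>u v. maximal h c u v"
proof -
  have "\<Omega> \<noteq> {}" using zero_in by blast
  then obtain \<omega> where "\<omega> \<in> \<Omega>" "h \<bullet> \<omega> = support_fun \<Omega> h"
    using support_attained[OF comp] by blast
  then show ?thesis
    using argmax_exists[of "support_fun \<Omega> h" c] unfolding maximal_def by metis
qed

lemma maximal_inner:
  assumes "maximal h c u v"
  shows "h \<bullet> u = f v * support_fun \<Omega> h" "h \<bullet> u + c * v = (SUP w\<in>{-m..M}. support_fun \<Omega> h * f w + c * w)"
proof -
  obtain \<omega> where "u = f v *\<^sub>R \<omega>" "h \<bullet> \<omega> = support_fun \<Omega> h"
    and v: "v \<in> argmax_on {-m..M} (\<lambda>v. support_fun \<Omega> h * f v + c * v)"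
    using assms unfolding maximal_def by blast
  then show 1: "h \<bullet> u = f v * support_fun \<Omega> h" by (simp only: inner_scaleR_right)
  show "h \<bullet> u + c * v = (SUP w\<in>{-m..M}. support_fun \<Omega> h * f w + c * w)"
    unfolding argmax_on_SUP[OF v] 1 by (simp only: mult.commute)
qed

text \<open>Since \<open>f\<close> is nonnegative, the best planar control for fixed
  \<open>v\<close> contributes \<open>f v\<close> times the support function, so maximizing over the
  control set amounts to two successive maximizations.\<close>

lemma maximal_iff:
  "maximal h c u v \<longleftrightarrow> (fst u, snd u, v) \<in> Uset \<Omega> f m M \<and>
     (\<forall>(w1, w2, w3) \<in> Uset \<Omega> f m M. w1 * fst h + w2 * snd h + w3 * c \<le> fst u * fst h + snd u * snd h + v * c)"
  (is "_ \<longleftrightarrow> ?U \<and> ?max")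
proof
  assume mx: "maximal h c u v"
  then have v: "v \<in> argmax_on {-m..M} (\<lambda>v. support_fun \<Omega> h * f v + c * v)" by (simp add: maximal_def)
  have ?U using mx by (auto simp: maximal_def Uset_iff argmax_on_def)
  moreover have ?max
  proof clarify
    fix w1 w2 w3 assume "(w1, w2, w3) \<in> Uset \<Omega> f m M"
    then obtain \<omega> where w: "w3 \<in> {-m..M}" "\<omega> \<in> \<Omega>" "(w1, w2) = f w3 *\<^sub>R \<omega>" by (auto simp: Uset_iff)
    have "h \<bullet> (w1, w2) \<le> f w3 * support_fun \<Omega> h"
      unfolding w(3) using support_upper[OF comp w(2), of h] f_nonneg[OF w(1)] by (simp add: mult_left_mono)
    moreover have "support_fun \<Omega> h * f w3 + c * w3 \<le> support_fun \<Omega> h * f v + c * v"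
      using v w(1) by (simp add: argmax_on_def)
    ultimately have "h \<bullet> (w1, w2) + c * w3 \<le> h \<bullet> u + c * v"
      using maximal_inner(1)[OF mx] by (simp add: mult.commute)
    then show "w1 * fst h + w2 * snd h + w3 * c \<le> fst u * fst h + snd u * snd h + v * c"
      by (simp add: inner_prod_def mult.commute)
  qed
  ultimately show "?U \<and> ?max" by blast
next
  assume A: "?U \<and> ?max"
  then obtain \<omega> where v: "v \<in> {-m..M}" and \<omega>: "\<omega> \<in> \<Omega>" "u = f v *\<^sub>R \<omega>" by (auto simp: Uset_iff)
  have "\<Omega> \<noteq> {}" using zero_in by blast
  then obtain \<omega>1 where \<omega>1: "\<omega>1 \<in> \<Omega>" "h \<bullet> \<omega>1 = support_fun \<Omega> h"
    using support_attained[OF comp] by blast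
  have le: "f w * support_fun \<Omega> h + c * w \<le> f v * (h \<bullet> \<omega>) + c * v" if "w \<in> {-m..M}" for w
  proof -
    have "(fst (f w *\<^sub>R \<omega>1), snd (f w *\<^sub>R \<omega>1), w) \<in> Uset \<Omega> f m M"
      unfolding Uset_iff using \<omega>1(1) that by (intro conjI bexI[of _ \<omega>1]) (auto simp: prod_eq_iff)
    then have "fst (f w *\<^sub>R \<omega>1) * fst h + snd (f w *\<^sub>R \<omega>1) * snd h + w * c
        \<le> fst u * fst h + snd u * snd h + v * c" using A by blast
    then have "h \<bullet> (f w *\<^sub>R \<omega>1) + c * w \<le> h \<bullet> u + c * v"
      unfolding inner_prod_def inner_real_def by (simp only: mult.commute)
    then show ?thesis using \<omega>1(2) \<omega>(2) by simp
  qed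
  have "f v * (h \<bullet> \<omega>) \<le> f v * support_fun \<Omega> h"
    using support_upper[OF comp \<omega>(1), of h] f_nonneg[OF v] by (rule mult_left_mono)
  then have "v \<in> argmax_on {-m..M} (\<lambda>v. support_fun \<Omega> h * f v + c * v)"
    using le v by (force simp: argmax_on_def mult.commute)
  moreover have "\<exists>\<omega>\<in>\<Omega>. u = f v *\<^sub>R \<omega> \<and> h \<bullet> \<omega> = support_fun \<Omega> h"
  \<comment> \<open>If \<open>f v = 0\<close>, then \<open>u\<close> carries no information on
    \<open>\<omega>\<close> and the maximizer \<open>\<omega>1\<close> is substituted. Otherwise the
    comparison \<open>le\<close> at \<open>w = v\<close> can be divided by
    \<open>f v\<close>.\<close>
  proof (cases "f v = 0")
    case True
    then show ?thesis using \<omega>1 \<omega>(2) by auto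
  next
    case False
    then have "f v > 0" using f_nonneg[OF v] by simp
    then have "support_fun \<Omega> h \<le> h \<bullet> \<omega>" using le[OF v] by simp
    then show ?thesis using support_upper[OF comp \<omega>(1), of h] \<omega> by (intro bexI[of _ \<omega>]) auto
  qed
  ultimately show "maximal h c u v" by (simp add: maximal_def)
qed

lemma maximal_bounded:
  obtains B where "B > 0" "\<And>h c u v. maximal h c u v \<Longrightarrow> norm u \<le> B \<and> \<bar>v\<bar> \<le> B"
proof -
  obtain R where R: "R > 0" "\<forall>x\<in>\<Omega>. norm x \<le> R"
    using compact_imp_bounded[OF comp] bounded_pos by blast
  have "compact (f ` {-m..M})" by (rule compact_continuous_image[OF f_cont]) auto
  then obtain F where F: "F > 0" "\<forall>x\<in>f ` {-m..M}. norm x \<le> F"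
    using compact_imp_bounded bounded_pos by metis
  have "norm u \<le> F * R + m + M \<and> \<bar>v\<bar> \<le> F * R + m + M" if mx: "maximal h c u v" for h c u v
  proof -
    obtain \<omega> where \<omega>: "\<omega> \<in> \<Omega>" "u = f v *\<^sub>R \<omega>" and v: "v \<in> {-m..M}"
      using mx by (auto simp: maximal_def argmax_on_def)
    have "norm u = \<bar>f v\<bar> * norm \<omega>" by (simp add: \<omega>)
    also have "\<dots> \<le> F * R" using F R \<omega> v by (intro mult_mono) auto
    finally have "norm u \<le> F * R" .
    moreover have "F * R > 0" using F R by simp
    ultimately show ?thesis using v m_pos M_pos by auto
  qed
  moreover have "F * R + m + M > 0" using mult_pos_pos[OF F(1) R(1)] m_pos M_pos by linarith
  ultimately show thesis using that by blast
qed

text \<open>Working form of an extremal: the maximum condition is required at every time of the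
  interval, the planar components are vectors, and the third covector component is a number
  \<open>c\<close>, so that the adjoint equation reads
  \<open>p' = c *\<^sub>R rot90 U\<close>.\<close>

definition extremal ::
  "real \<Rightarrow> (real \<Rightarrow> real) \<Rightarrow> (real \<Rightarrow> real) \<Rightarrow> (real \<Rightarrow> real) \<Rightarrow>
   (real \<Rightarrow> real \<times> real) \<Rightarrow> real \<Rightarrow> (real \<Rightarrow> real \<times> real) \<Rightarrow> (real \<Rightarrow> real) \<Rightarrow> bool" where
  "extremal T x1 x2 x3 p c U v3 \<longleftrightarrow>
     U \<in> borel_measurable (lebesgue_on {0..T}) \<and> v3 \<in> borel_measurable (lebesgue_on {0..T}) \<and>
     bounded_primitive 0 T p (\<lambda>t. c *\<^sub>R rot90 (U t)) \<and>
     (\<forall>t\<in>{0..T}. maximal (p t) c (U t) (v3 t) \<and> (p t, c) \<noteq> 0 \<and>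
        x1 t = integral {0..t} (\<lambda>s. fst (U s)) \<and> x2 t = integral {0..t} (\<lambda>s. snd (U s)) \<and>
        x3 t = integral {0..t} (\<lambda>s. v3 s + x1 s * snd (U s)))"

text \<open>Controls are changed on a null set so that the maximum condition holds at every time.\<close>

lemma pmp_imp_extremal:
  assumes "T > 0" and pmp: "pmp_extremal \<Omega> f m M T x1 x2 x3 h1 h2 h3 u1 u2 u3"
  obtains U v3 where "extremal T x1 x2 x3 (\<lambda>t. (h1 t, h2 t)) (h3 0) U v3"
proof -
  define c where "c = h3 0"
  define p where "p t = (h1 t, h2 t)" for t
  have h3: "h3 t = c" if "t \<in> {0..T}" for t
    using pmp that unfolding pmp_extremal_def c_def by blast
  define P where "P t \<longleftrightarrow> maximal (p t) (h3 t) (u1 t, u2 t) (u3 t)" for t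
  have "AE t in lborel. t \<in> {0..T} \<longrightarrow> P t"
    unfolding P_def maximal_iff p_def fst_conv snd_conv
    using pmp unfolding pmp_extremal_def by (elim conjE) assumption
  then obtain N0 where N0: "N0 \<in> null_sets lborel" "{t. \<not> (t \<in> {0..T} \<longrightarrow> P t)} \<subseteq> N0"
    by (auto simp: eventually_ae_filter)
  define N where "N = {t. \<not> (t \<in> {0..T} \<longrightarrow> P t)}"
  have N: "negligible N"
    unfolding N_def
    by (rule negligible_subset[OF _ N0(2)])
       (simp add: negligible_iff_null_sets null_sets_completionI[OF N0(1)])
  \<comment> \<open>These are arbitrary pointwise maximizers. They enter only on the null set
    \<open>N\<close>, so the new controls inherit measurability from the old ones.\<close>
  obtain U0 v0 where 0: "\<And>t. maximal (p t) c (U0 t) (v0 t)"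
  proof -
    have "\<forall>t. \<exists>u v. maximal (p t) c u v" using maximal_exists by blast
    then show thesis unfolding choice_iff using that by blast
  qed
  define U where "U t = (if t \<in> N then U0 t else (u1 t, u2 t))" for t
  define v3 where "v3 t = (if t \<in> N then v0 t else u3 t)" for t
  have off: "fst (U t) = u1 t" "snd (U t) = u2 t" "v3 t = u3 t" if "t \<notin> N" for t
    using that by (auto simp: U_def v3_def)
  have mx: "maximal (p t) c (U t) (v3 t)" if "t \<in> {0..T}" for t
    using 0[of t] that h3[OF that] by (auto simp: U_def v3_def N_def P_def)
  have "u1 measurable_on {0..T}" "u2 measurable_on {0..T}" "u3 measurable_on {0..T}"
    using pmp unfolding pmp_extremal_def by blast+
  then have "(\<lambda>t. fst (U t)) measurable_on {0..T}" "(\<lambda>t. snd (U t)) measurable_on {0..T}" "v3 measurable_on {0..T}"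
    by (auto intro: measurable_on_spike[OF _ N] simp: off)
  then have meas: "(\<lambda>t. fst (U t)) \<in> borel_measurable (lebesgue_on {0..T})"
    "(\<lambda>t. snd (U t)) \<in> borel_measurable (lebesgue_on {0..T})" "v3 \<in> borel_measurable (lebesgue_on {0..T})"
    by (simp_all add: measurable_on_iff_borel_measurable)
  then have Um: "U \<in> borel_measurable (lebesgue_on {0..T})"
    using borel_measurable_Pair[OF meas(1,2)] by simp
  obtain B where B: "B > 0" "\<And>t. t \<in> {0..T} \<Longrightarrow> norm (U t) \<le> B"
    using maximal_bounded mx by metis
  have Ub: "\<bar>fst (U t)\<bar> \<le> B" "\<bar>snd (U t)\<bar> \<le> B" if "t \<in> {0..T}" for t
    using norm_fst_le[of "fst (U t)" "snd (U t)"] norm_snd_le[of "snd (U t)" "fst (U t)"] B(2)[OF that] by auto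
  have "bounded_primitive 0 T (\<lambda>t. h1 0 + integral {0..t} (\<lambda>s. - c * snd (U s))) (\<lambda>s. - c * snd (U s))"
    by (rule bounded_primitive_integral[where B = "\<bar>c\<bar> * B"])
       (use meas Ub in \<open>auto simp: abs_mult intro!: mult_left_mono\<close>)
  moreover have "bounded_primitive 0 T (\<lambda>t. h2 0 + integral {0..t} (\<lambda>s. c * fst (U s))) (\<lambda>s. c * fst (U s))"
    by (rule bounded_primitive_integral[where B = "\<bar>c\<bar> * B"])
       (use meas Ub in \<open>auto simp: abs_mult intro!: mult_left_mono\<close>)
  ultimately have bp: "bounded_primitive 0 T (\<lambda>t. (h1 0 + integral {0..t} (\<lambda>s. - c * snd (U s)),
      h2 0 + integral {0..t} (\<lambda>s. c * fst (U s)))) (\<lambda>t. (- c * snd (U t), c * fst (U t)))"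
    by (rule bounded_primitive_Pair)
  have h12: "h1 t = h1 0 + integral {0..t} (\<lambda>s. - c * snd (U s))"
    "h2 t = h2 0 + integral {0..t} (\<lambda>s. c * fst (U s))" if t: "t \<in> {0..T}" for t
  proof -
    have "h1 t = h1 0 - integral {0..t} (\<lambda>s. h3 s * u2 s)" "h2 t = h2 0 + integral {0..t} (\<lambda>s. h3 s * u1 s)"
      using pmp t unfolding pmp_extremal_def by blast+
    moreover have "integral {0..t} (\<lambda>s. h3 s * u2 s) = integral {0..t} (\<lambda>s. c * snd (U s))"
      by (rule integral_spike[OF N]) (use off h3 t in auto)
    moreover have "integral {0..t} (\<lambda>s. h3 s * u1 s) = integral {0..t} (\<lambda>s. c * fst (U s))"
      by (rule integral_spike[OF N]) (use off h3 t in auto)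
    ultimately show "h1 t = h1 0 + integral {0..t} (\<lambda>s. - c * snd (U s))"
      "h2 t = h2 0 + integral {0..t} (\<lambda>s. c * fst (U s))" by simp_all
  qed
  have pp: "bounded_primitive 0 T p (\<lambda>t. c *\<^sub>R rot90 (U t))"
  proof (rule bounded_primitive_cong[THEN iffD1, OF _ _ bp])
    fix t assume t: "t \<in> {0..T}"
    show "(h1 0 + integral {0..t} (\<lambda>s. - c * snd (U s)), h2 0 + integral {0..t} (\<lambda>s. c * fst (U s))) = p t"
      unfolding p_def h12(1)[OF t, symmetric] h12(2)[OF t, symmetric] ..
  qed (simp add: rot90_def)
  have "extremal T x1 x2 x3 p c U v3"
    unfolding extremal_def
  proof (intro conjI ballI Um meas(3) pp mx)
    fix t assume t: "t \<in> {0..T}"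
    have x: "x1 t = integral {0..t} u1" "x2 t = integral {0..t} u2"
      "x3 t = integral {0..t} (\<lambda>s. u3 s + x1 s * u2 s)" "(h1 t, h2 t, h3 t) \<noteq> (0, 0, 0)"
      using pmp t unfolding pmp_extremal_def by blast+
    show "(p t, c) \<noteq> 0" using x(4) h3[OF t] by (auto simp: p_def zero_prod_def)
    show "x1 t = integral {0..t} (\<lambda>s. fst (U s))"
      unfolding x(1) by (rule integral_spike[OF N]) (use off in auto)
    show "x2 t = integral {0..t} (\<lambda>s. snd (U s))"
      unfolding x(2) by (rule integral_spike[OF N]) (use off in auto)
    show "x3 t = integral {0..t} (\<lambda>s. v3 s + x1 s * snd (U s))"
      unfolding x(3) by (rule integral_spike[OF N]) (use off in auto)
  qed auto
  then show thesis using that unfolding p_def c_def by blast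
qed

lemma extremal_imp_pmp:
  assumes "T > 0" and E: "extremal T x1 x2 x3 p c U v3"
  shows "pmp_extremal \<Omega> f m M T x1 x2 x3 (\<lambda>t. fst (p t)) (\<lambda>t. snd (p t)) (\<lambda>_. c)
    (\<lambda>t. fst (U t)) (\<lambda>t. snd (U t)) v3"
proof -
  have Um: "U \<in> borel_measurable (lebesgue_on {0..T})" and vm: "v3 \<in> borel_measurable (lebesgue_on {0..T})"
    and pp: "bounded_primitive 0 T p (\<lambda>t. c *\<^sub>R rot90 (U t))"
    using E by (auto simp: extremal_def)
  have "(\<lambda>t. fst (U t)) \<in> borel_measurable (lebesgue_on {0..T})"
    "(\<lambda>t. snd (U t)) \<in> borel_measurable (lebesgue_on {0..T})"
    by (auto intro!: measurable_compose[OF Um] borel_measurable_continuous_onI continuous_intros)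
  then have meas: "(\<lambda>t. fst (U t)) measurable_on {0..T}" "(\<lambda>t. snd (U t)) measurable_on {0..T}" "v3 measurable_on {0..T}"
    using vm by (simp_all add: measurable_on_iff_borel_measurable)
  have p: "fst (p t) = fst (p 0) - integral {0..t} (\<lambda>s. c * snd (U s))"
    "snd (p t) = snd (p 0) + integral {0..t} (\<lambda>s. c * fst (U s))" if t: "t \<in> {0..T}" for t
  proof -
    have "((\<lambda>s. c *\<^sub>R rot90 (U s)) has_integral p t - p 0) {0..t}"
      using pp t unfolding bounded_primitive_def by auto
    from has_integral_linear[OF this bounded_linear_fst] has_integral_linear[OF this bounded_linear_snd]
    have "((\<lambda>s. - (c * snd (U s))) has_integral fst (p t) - fst (p 0)) {0..t}"
      "((\<lambda>s. c * fst (U s)) has_integral snd (p t) - snd (p 0)) {0..t}"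
      by (simp_all add: o_def rot90_def)
    from integral_unique[OF has_integral_neg[OF this(1)]] integral_unique[OF this(2)]
    have i: "integral {0..t} (\<lambda>s. c * snd (U s)) = - (fst (p t) - fst (p 0))"
      "integral {0..t} (\<lambda>s. c * fst (U s)) = snd (p t) - snd (p 0)"
      by (simp_all only: minus_minus)
    show "fst (p t) = fst (p 0) - integral {0..t} (\<lambda>s. c * snd (U s))" unfolding i by simp
    show "snd (p t) = snd (p 0) + integral {0..t} (\<lambda>s. c * fst (U s))" unfolding i by simp
  qed
  have mx: "maximal (p t) c (U t) (v3 t)" and nz: "(p t, c) \<noteq> 0"
    and x: "x1 t = integral {0..t} (\<lambda>s. fst (U s))" "x2 t = integral {0..t} (\<lambda>s. snd (U s))"
      "x3 t = integral {0..t} (\<lambda>s. v3 s + x1 s * snd (U s))" if "t \<in> {0..T}" for t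
    using E that unfolding extremal_def by blast+
  show ?thesis
    unfolding pmp_extremal_def
  proof (intro conjI ballI meas)
    show "AE t in lborel. t \<in> {0..T} \<longrightarrow>
        (fst (U t), snd (U t), v3 t) \<in> Uset \<Omega> f m M \<and>
        (\<forall>(w1, w2, w3) \<in> Uset \<Omega> f m M.
            w1 * fst (p t) + w2 * snd (p t) + w3 * c \<le> fst (U t) * fst (p t) + snd (U t) * snd (p t) + v3 t * c)"
      by (intro AE_I2 impI) (rule mx[unfolded maximal_iff])
    show "(fst (p t), snd (p t), c) \<noteq> (0, 0, 0)" if "t \<in> {0..T}" for t
      using nz[OF that] by (auto simp: zero_prod_def prod_eq_iff)
  qed (use p x in \<open>simp_all only:\<close>)
qed

section \<open>From extremals to the three families of curves\<close>

lemma extremal_support_const: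
  assumes E: "extremal T x1 x2 x3 p c U v3" and t: "t \<in> {0..T}"
  shows "support_fun \<Omega> (p t) = support_fun \<Omega> (p 0)"
proof -
  have pp: "bounded_primitive 0 T p (\<lambda>t. c *\<^sub>R rot90 (U t))" using E by (simp add: extremal_def)
  have ppt: "bounded_primitive 0 t p (\<lambda>t. c *\<^sub>R rot90 (U t))"
    by (rule bounded_primitive_subinterval[OF pp]) (use t in auto)
  obtain R where R: "R > 0" "\<forall>x\<in>\<Omega>. norm x \<le> R"
    using compact_imp_bounded[OF comp] bounded_pos by blast
  have "support_fun \<Omega> (p 0) = support_fun \<Omega> (p t)"
  proof (rule bounded_primitive_const_test_subgradient[OF _ _ ppt, where R = R])
    show "continuous_on {0..t} (\<lambda>s. support_fun \<Omega> (p s))"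
      by (rule continuous_on_compose2[OF Pol.continuous bounded_primitive_continuous[OF ppt] subset_UNIV])
    \<comment> \<open>No order of \<open>r\<close> and \<open>s\<close> is assumed: the maximizer
      \<open>\<omega>\<close> at time \<open>r\<close> bounds the support function at
      \<open>p s\<close> from below for every \<open>s\<close>, as the two-sided test
      demands.\<close>
    fix r s assume r: "r \<in> {0..t}" and s: "s \<in> {0..t}"
    have "maximal (p r) c (U r) (v3 r)" using E r t by (simp add: extremal_def)
    then obtain \<omega> where \<omega>: "\<omega> \<in> \<Omega>" "U r = f (v3 r) *\<^sub>R \<omega>" "p r \<bullet> \<omega> = support_fun \<Omega> (p r)"
      by (auto simp: maximal_def)
    define z where "z = p s - p r - (s - r) *\<^sub>R c *\<^sub>R rot90 (U r)"
    have "rot90 (U r) \<bullet> \<omega> = 0" by (simp add: \<omega>(2) rot90_def inner_prod_def)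
    then have "z \<bullet> \<omega> = p s \<bullet> \<omega> - p r \<bullet> \<omega>" by (simp add: z_def inner_diff_left)
    then have "support_fun \<Omega> (p s) - support_fun \<Omega> (p r) \<ge> z \<bullet> \<omega>"
      using support_upper[OF comp \<omega>(1), of "p s"] \<omega>(3) by simp
    moreover have "\<bar>z \<bullet> \<omega>\<bar> \<le> norm z * norm \<omega>" by (rule Cauchy_Schwarz_ineq2)
    moreover have "norm z * norm \<omega> \<le> norm z * R" using R \<omega>(1) by (intro mult_left_mono) auto
    ultimately show "support_fun \<Omega> (p s) - support_fun \<Omega> (p r) \<ge>
        - R * norm (p s - p r - (s - r) *\<^sub>R c *\<^sub>R rot90 (U r))"
      unfolding z_def[symmetric] by (simp add: mult.commute)
  qed (use t R in auto)
  then show ?thesis by simp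
qed

text \<open>Conservation of the support function gives \<open>p = 0\<close> throughout, hence
  \<open>c \<noteq> 0\<close>, and \<open>c * v\<close> is maximal only at an endpoint. The maximum
  condition leaves \<open>\<omega>\<close> free here; that the planar coordinates vanish comes from
  the adjoint equation, which makes the integrals of \<open>U\<close> zero.\<close>

lemma extremal_curve1:
  assumes E: "extremal T x1 x2 x3 p c U v3" and "T > 0" and A: "support_fun \<Omega> (p 0) = 0"
  shows "curve1 m M T x1 x2 x3"
proof -
  have p0: "p t = 0" if "t \<in> {0..T}" for t
    using extremal_support_const[OF E that] A Pol.pos[of "p t"] by fastforce
  have c: "c \<noteq> 0" using E p0[of 0] \<open>T > 0\<close> by (auto simp: extremal_def zero_prod_def)
  have pp: "bounded_primitive 0 T p (\<lambda>t. c *\<^sub>R rot90 (U t))" using E by (simp add: extremal_def)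
  have mx: "maximal (p t) c (U t) (v3 t)" if "t \<in> {0..T}" for t using E that by (simp add: extremal_def)
  have v: "v3 t = (if c > 0 then M else - m)" if t: "t \<in> {0..T}" for t
  proof -
    have "v3 t \<in> argmax_on {-m..M} (\<lambda>v. c * v)"
      using mx[OF t] p0[OF t] by (simp add: maximal_def)
    then have a: "v3 t \<in> {-m..M}" "\<forall>w\<in>{-m..M}. c * w \<le> c * v3 t"
      unfolding argmax_on_def by auto
    have "c * M \<le> c * v3 t" "c * (- m) \<le> c * v3 t"
      using bspec[OF a(2), of M] bspec[OF a(2), of "- m"] m_pos M_pos by auto
    then show ?thesis
      using a(1) c mult_le_cancel_left_pos[of c M "v3 t"] mult_le_cancel_left_neg[of c "- m" "v3 t"]
      by (cases "c > 0") (simp_all only: if_True if_False, auto)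
  qed
  have x12: "x1 t = 0" "x2 t = 0" if t: "t \<in> {0..T}" for t
  proof -
    have "((\<lambda>s. c *\<^sub>R rot90 (U s)) has_integral p t - p 0) {0..t}"
      using pp t unfolding bounded_primitive_def by auto
    then have "((\<lambda>s. c *\<^sub>R rot90 (U s)) has_integral 0) {0..t}"
      using p0[OF t] p0[of 0] t by simp
    from has_integral_linear[OF this bounded_linear_fst] has_integral_linear[OF this bounded_linear_snd]
    have "((\<lambda>s. - c * snd (U s)) has_integral 0) {0..t}" "((\<lambda>s. c * fst (U s)) has_integral 0) {0..t}"
      by (simp_all add: o_def rot90_def)
    from has_integral_divide[OF this(1), of "- c"] has_integral_divide[OF this(2), of c]
    have "((\<lambda>s. snd (U s)) has_integral 0) {0..t}" "((\<lambda>s. fst (U s)) has_integral 0) {0..t}"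
      using c by simp_all
    then show "x1 t = 0" "x2 t = 0"
      using E t by (auto simp: extremal_def integral_unique)
  qed
  have "x3 t = (if c > 0 then M else - m) * t" if t: "t \<in> {0..T}" for t
  proof -
    have "x3 t = integral {0..t} (\<lambda>s. v3 s + x1 s * snd (U s))" using E t by (simp add: extremal_def)
    also have "\<dots> = integral {0..t} (\<lambda>s. if c > 0 then M else - m)"
      by (rule HK_integral_cong) (use t v x12 in auto)
    finally show ?thesis using t by (simp add: mult.commute)
  qed
  then show ?thesis using x12 unfolding curve1_def by (cases "c > 0") auto
qed

text \<open>For \<open>c = 0\<close> the covector is constant, so its normalization \<open>q\<close>
  is one fixed boundary point of the polar set and every \<open>\<omega>\<close> in use lies on the
  supporting line that \<open>q\<close> defines.\<close>

lemma extremal_curve2: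
  assumes E: "extremal T x1 x2 x3 p 0 U v3" and "T > 0" and A: "support_fun \<Omega> (p 0) \<noteq> 0"
  shows "curve2 \<Omega> f m M T x1 x2 x3"
proof -
  define a where "a = support_fun \<Omega> (p 0)"
  have a: "a > 0" using A Pol.nonneg[of "p 0"] by (simp add: a_def)
  define W where "W = (SUP v\<in>{-m..M}. f v)"
  have pp: "bounded_primitive 0 T p (\<lambda>t. 0 *\<^sub>R rot90 (U t))" and Um: "U \<in> borel_measurable (lebesgue_on {0..T})"
    and vm: "v3 \<in> borel_measurable (lebesgue_on {0..T})"
    using E by (auto simp: extremal_def)
  have p0: "p t = p 0" if t: "t \<in> {0..T}" for t
  proof -
    have "((\<lambda>s. 0) has_integral p t - p 0) {0..t}"
      using pp t unfolding bounded_primitive_def by auto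
    then have "p t - p 0 = 0" using has_integral_unique[OF _ has_integral_0] by blast
    then show ?thesis by simp
  qed
  define q where "q = p 0 /\<^sub>R a"
  have q: "support_fun \<Omega> q = 1" using a by (simp add: q_def Pol.hom a_def)
  define \<eta>0 where "\<eta>0 = Pol.area (ang q)"
  have \<eta>0: "Pol.trig \<eta>0 = q" unfolding \<eta>0_def by (rule Pol.trig_area_ang[OF q])
  have v: "v3 t \<in> argmax_on {-m..M} f" if t: "t \<in> {0..T}" for t
  proof -
    have "maximal (p t) 0 (U t) (v3 t)" using E t unfolding extremal_def by blast
    then have "v3 t \<in> argmax_on {-m..M} (\<lambda>v. a * f v)"
      by (simp add: maximal_def p0[OF t] a_def)
    then show ?thesis using a by (auto simp: argmax_on_def)
  qed
  have W: "f (v3 t) = W" if "t \<in> {0..T}" for t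
    using argmax_on_SUP[OF v[OF that]] by (simp add: W_def)
  \<comment> \<open>\<open>0\<close> lies strictly between \<open>- m\<close> and \<open>M\<close>,
    so \<open>f 0 > 0\<close>. This allows division of the control by \<open>W\<close>.\<close>
  have Wpos: "W > 0"
  proof -
    have "0 \<in> {0..T}" "0 \<in> {-m..M}" using \<open>T > 0\<close> m_pos M_pos by auto
    then have "f 0 \<le> f (v3 0)" using v[of 0] by (simp add: argmax_on_def)
    moreover have "f 0 > 0" using f_pos m_pos M_pos by simp
    ultimately show ?thesis using W[of 0] \<open>T > 0\<close> by simp
  qed
  \<comment> \<open>Of all parameters of the boundary point this one is given by an explicit Borel
    formula, so \<open>\<theta>\<close> is measurable without any selection argument.\<close>
  define \<theta> where "\<theta> t = Om.area (ang (U t /\<^sub>R W))" for t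
  have \<theta>: "Om.trig (\<theta> t) = U t /\<^sub>R W" "\<theta> t \<in> circ_set \<Omega> \<eta>0" if t: "t \<in> {0..T}" for t
  proof -
    obtain \<omega> where \<omega>: "\<omega> \<in> \<Omega>" "U t = f (v3 t) *\<^sub>R \<omega>" "p 0 \<bullet> \<omega> = a"
    proof -
      have "maximal (p t) 0 (U t) (v3 t)" using E t unfolding extremal_def by blast
      then show thesis using that unfolding maximal_def p0[OF t] a_def by blast
    qed
    have U: "U t /\<^sub>R W = \<omega>" using Wpos by (simp add: \<omega>(2) W[OF t])
    have q\<omega>: "q \<bullet> \<omega> = 1" using \<omega>(3) a by (simp add: q_def)
    have "q \<in> polar \<Omega>" using q by (simp add: polar_K Pol.K_def)
    \<comment> \<open>\<open>q \<bullet> \<omega> = 1\<close> with \<open>q\<close> in the polar set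
      puts \<open>\<omega>\<close> on the boundary of \<Omega>, where \<open>Om.trig\<close> reaches
      it.\<close>
    then have "1 \<le> support_fun (polar \<Omega>) \<omega>"
      using support_upper[OF polar_compact_interior(1)[OF comp int0], of q \<omega>] q\<omega> by (simp add: inner_commute)
    moreover have "support_fun (polar \<Omega>) \<omega> \<le> 1" using \<omega>(1) by (subst (asm) Om_K) (simp add: Om.K_def)
    ultimately have "Om.trig (Om.area (ang \<omega>)) = \<omega>" by (intro Om.trig_area_ang) simp
    then show 1: "Om.trig (\<theta> t) = U t /\<^sub>R W" by (simp add: \<theta>_def U)
    show "\<theta> t \<in> circ_set \<Omega> \<eta>0" unfolding circ_set_iff \<eta>0 1 U by (rule q\<omega>)
  qed
  have "\<theta> \<in> borel_measurable (lebesgue_on {0..T})"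
  proof -
    have [measurable]: "ang \<in> borel_measurable borel" "Om.area \<in> borel_measurable borel"
      by (auto intro: ang_measurable borel_measurable_continuous_onI Om.area_continuous)
    have [measurable]: "(\<lambda>t. U t /\<^sub>R W) \<in> borel_measurable (lebesgue_on {0..T})"
      using Um by measurable
    show ?thesis unfolding \<theta>_def by measurable
  qed
  then have meas: "\<theta> measurable_on {0..T}" "v3 measurable_on {0..T}"
    using vm by (simp_all add: measurable_on_iff_borel_measurable)
  have U: "U t = W *\<^sub>R Om.trig (\<theta> t)" if "t \<in> {0..T}" for t
    using \<theta>(1)[OF that] Wpos by simp
  have "x1 t = W * integral {0..t} (\<lambda>s. cos_cvx \<Omega> (\<theta> s)) \<and>
        x2 t = W * integral {0..t} (\<lambda>s. sin_cvx \<Omega> (\<theta> s)) \<and>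
        x3 t = integral {0..t} (\<lambda>s. v3 s + W * x1 s * sin_cvx \<Omega> (\<theta> s))" if t: "t \<in> {0..T}" for t
  proof -
    have x: "x1 t = integral {0..t} (\<lambda>s. fst (U s))" "x2 t = integral {0..t} (\<lambda>s. snd (U s))"
        "x3 t = integral {0..t} (\<lambda>s. v3 s + x1 s * snd (U s))"
      using E t by (auto simp: extremal_def)
    have "x1 t = integral {0..t} (\<lambda>s. W * cos_cvx \<Omega> (\<theta> s))"
      unfolding x(1) by (rule HK_integral_cong) (use U t in \<open>auto simp: cs_Om\<close>)
    moreover have "x2 t = integral {0..t} (\<lambda>s. W * sin_cvx \<Omega> (\<theta> s))"
      unfolding x(2) by (rule HK_integral_cong) (use U t in \<open>auto simp: cs_Om\<close>)
    moreover have "x3 t = integral {0..t} (\<lambda>s. v3 s + W * x1 s * sin_cvx \<Omega> (\<theta> s))"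
      unfolding x(3) by (rule HK_integral_cong) (use U t in \<open>auto simp: cs_Om\<close>)
    ultimately show ?thesis by simp
  qed
  then show ?thesis
    unfolding curve2_def Let_def W_def[symmetric] using meas \<theta>(2) v by blast
qed

text \<open>Shared by both directions, since it uses only the adjoint equation, the value of
  \<open>p \<bullet> U\<close> and the form of \<open>p\<close>. The definition of
  \<open>\<eta>\<close> gives \<open>a\<^sup>2 / c\<^sup>2 * (\<eta> - \<eta>0) = H * t / c -
  integral {0..t} v3\<close>, which eliminates the integral of \<open>v3\<close> from the third
  coordinate.\<close>

lemma coordinates_to_curve3:
  assumes "a > 0" "c \<noteq> 0" and p: "bounded_primitive 0 T p (\<lambda>t. c *\<^sub>R rot90 (U t))"
    and v: "v3 integrable_on {0..T}" and H: "H = (SUP v\<in>{-m..M}. a * f v + c * v)"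
    and pU: "\<And>t. t \<in> {0..T} \<Longrightarrow> p t \<bullet> U t = H - c * v3 t"
    and pt: "\<And>t. t \<in> {0..T} \<Longrightarrow> p t = a *\<^sub>R Pol.trig (\<eta>0 + H * c / a\<^sup>2 * t - c\<^sup>2 / a\<^sup>2 * integral {0..t} v3)"
    and t: "t \<in> {0..T}"
  defines "cs \<equiv> cos_cvx (polar \<Omega>)" and "sn \<equiv> sin_cvx (polar \<Omega>)"
    and "\<eta> \<equiv> \<eta>0 + H * c / a\<^sup>2 * t - c\<^sup>2 / a\<^sup>2 * integral {0..t} v3"
  shows "integral {0..t} (\<lambda>s. fst (U s)) = a / c * (sn \<eta> - sn \<eta>0)"
    and "integral {0..t} (\<lambda>s. snd (U s)) = a / c * (- cs \<eta> + cs \<eta>0)"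
    and "integral {0..t} (\<lambda>s. v3 s + integral {0..s} (\<lambda>r. fst (U r)) * snd (U s)) =
           H / c * t - 1/2 * a\<^sup>2 / c\<^sup>2 * (\<eta> - \<eta>0)
           + 1/2 * a\<^sup>2 / c\<^sup>2 * (2 * cs \<eta> * sn \<eta>0 - cs \<eta> * sn \<eta> - cs \<eta>0 * sn \<eta>0)"
proof -
  have cf: "integral {0..t} (\<lambda>s. fst (U s)) = (snd (p t) - snd (p 0)) / c"
    "integral {0..t} (\<lambda>s. snd (U s)) = - (fst (p t) - fst (p 0)) / c"
    "integral {0..t} (\<lambda>s. v3 s + integral {0..s} (\<lambda>r. fst (U r)) * snd (U s)) =
      H * t / (2 * c) + integral {0..t} v3 / 2
      - (fst (p t) * snd (p t) - fst (p 0) * snd (p 0)) / (2 * c\<^sup>2)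
      + snd (p 0) * (fst (p t) - fst (p 0)) / c\<^sup>2"
    using coordinate_formulas[OF p \<open>c \<noteq> 0\<close> v pU t] by blast+
  have pc: "fst (p t) = a * cs \<eta>" "snd (p t) = a * sn \<eta>" "fst (p 0) = a * cs \<eta>0" "snd (p 0) = a * sn \<eta>0"
    using pt[OF t] pt[of 0] t by (auto simp: cs_def sn_def cs_polar \<eta>_def)
  show "integral {0..t} (\<lambda>s. fst (U s)) = a / c * (sn \<eta> - sn \<eta>0)"
    unfolding cf(1) pc by (simp add: right_diff_distrib diff_divide_distrib)
  show "integral {0..t} (\<lambda>s. snd (U s)) = a / c * (- cs \<eta> + cs \<eta>0)"
    unfolding cf(2) pc using \<open>c \<noteq> 0\<close> by (simp add: field_simps)
  have e: "a\<^sup>2 / c\<^sup>2 * (\<eta> - \<eta>0) = H * t / c - integral {0..t} v3"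
    unfolding \<eta>_def using \<open>a > 0\<close> \<open>c \<noteq> 0\<close> by (simp add: field_simps power2_eq_square)
  have "H / c * t - 1/2 * a\<^sup>2 / c\<^sup>2 * (\<eta> - \<eta>0) = H * t / (2 * c) + integral {0..t} v3 / 2"
  proof -
    have "1/2 * a\<^sup>2 / c\<^sup>2 * (\<eta> - \<eta>0) = 1/2 * (a\<^sup>2 / c\<^sup>2 * (\<eta> - \<eta>0))" by simp
    then show ?thesis unfolding e by (simp add: field_simps)
  qed
  moreover have "- (a * x * (a * y) - a * z * (a * w)) / (2 * c\<^sup>2) + a * w * (a * x - a * z) / c\<^sup>2
      = 1/2 * a\<^sup>2 / c\<^sup>2 * (2 * x * w - x * y - z * w)" for x y z w :: real
    using \<open>c \<noteq> 0\<close> by (simp add: field_simps power2_eq_square)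
  from this[of "cs \<eta>" "sn \<eta>" "cs \<eta>0" "sn \<eta>0"]
  have "- (a * cs \<eta> * (a * sn \<eta>) - a * cs \<eta>0 * (a * sn \<eta>0)) / (2 * c\<^sup>2) + a * sn \<eta>0 * (a * cs \<eta> - a * cs \<eta>0) / c\<^sup>2
      = 1/2 * a\<^sup>2 / c\<^sup>2 * (2 * cs \<eta> * sn \<eta>0 - cs \<eta> * sn \<eta> - cs \<eta>0 * sn \<eta>0)" .
  ultimately show "integral {0..t} (\<lambda>s. v3 s + integral {0..s} (\<lambda>r. fst (U r)) * snd (U s)) =
           H / c * t - 1/2 * a\<^sup>2 / c\<^sup>2 * (\<eta> - \<eta>0)
           + 1/2 * a\<^sup>2 / c\<^sup>2 * (2 * cs \<eta> * sn \<eta>0 - cs \<eta> * sn \<eta> - cs \<eta>0 * sn \<eta>0)"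
    unfolding cf(3) pc by (simp only: minus_divide_left)
qed

lemma angle_primitive:
  assumes vm: "v3 \<in> borel_measurable (lebesgue_on {0..T})"
    and vB: "\<And>t. t \<in> {0..T} \<Longrightarrow> \<bar>v3 t\<bar> \<le> B"
  shows "bounded_primitive 0 T (\<lambda>t. \<eta>0 + k * t - l * integral {0..t} v3) (\<lambda>t. k - l * v3 t)"
proof -
  have int: "v3 integrable_on {0..T}" using bounded_measurable_integrable[OF vm] vB by auto
  have "bounded_primitive 0 T (\<lambda>t. \<eta>0 + integral {0..t} (\<lambda>t. k - l * v3 t)) (\<lambda>t. k - l * v3 t)"
  proof (rule bounded_primitive_integral)
    show "(\<lambda>t. k - l * v3 t) \<in> borel_measurable (lebesgue_on {0..T})" using vm by measurable
    fix t assume "t \<in> {0..T}"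
    then have "\<bar>l\<bar> * \<bar>v3 t\<bar> \<le> \<bar>l\<bar> * B" using vB by (intro mult_left_mono) auto
    then show "norm (k - l * v3 t) \<le> \<bar>k\<bar> + \<bar>l\<bar> * B" using abs_triangle_ineq4[of k "l * v3 t"] by (simp add: abs_mult)
  qed
  moreover have "\<eta>0 + integral {0..t} (\<lambda>t. k - l * v3 t) = \<eta>0 + k * t - l * integral {0..t} v3" if t: "t \<in> {0..T}" for t
  proof -
    have "v3 integrable_on {0..t}" using t by (intro integrable_subinterval_real[OF int]) auto
    then have "((\<lambda>t. k - l * v3 t) has_integral (k * t - l * integral {0..t} v3)) {0..t}"
      using has_integral_const_real[of k 0 t] t
      by (intro has_integral_diff has_integral_mult_right integrable_integral) (auto simp: mult.commute)
    then show ?thesis by (simp add: integral_unique)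
  qed
  ultimately show ?thesis
    by (rule bounded_primitive_cong[THEN iffD1, rotated 2]) auto
qed

lemma extremal_curve3:
  assumes E: "extremal T x1 x2 x3 p c U v3" and "T > 0" and A: "support_fun \<Omega> (p 0) = a" "a > 0" and c: "c \<noteq> 0"
  shows "curve3 \<Omega> f m M a c T x1 x2 x3"
proof -
  define H where "H = (SUP v\<in>{-m..M}. a * f v + c * v)"
  have pp: "bounded_primitive 0 T p (\<lambda>t. c *\<^sub>R rot90 (U t))"
    and vm: "v3 \<in> borel_measurable (lebesgue_on {0..T})"
    using E by (auto simp: extremal_def)
  have s: "support_fun \<Omega> (p t) = a" if "t \<in> {0..T}" for t
    using extremal_support_const[OF E that] A by simp
  have mx: "maximal (p t) c (U t) (v3 t)" if "t \<in> {0..T}" for t using E that by (simp add: extremal_def)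
  have pU: "p t \<bullet> U t = H - c * v3 t" if "t \<in> {0..T}" for t
    using maximal_inner(2)[OF mx[OF that]] s[OF that] by (simp add: H_def)
  obtain B where B: "\<And>t. t \<in> {0..T} \<Longrightarrow> \<bar>v3 t\<bar> \<le> B"
    using maximal_bounded mx by metis
  have vint: "v3 integrable_on {0..T}" using bounded_measurable_integrable[OF vm] B by auto
  define Q where "Q t = p t /\<^sub>R a" for t
  have Qp: "bounded_primitive 0 T Q (\<lambda>t. (c *\<^sub>R rot90 (U t)) /\<^sub>R a)"
    unfolding Q_def using bounded_primitive_linear[OF pp bounded_linear_scaleR_right] .
  have gQ: "support_fun \<Omega> (Q t) = 1" if "t \<in> {0..T}" for t
    using s[OF that] A(2) by (simp add: Q_def Pol.hom)
  \<comment> \<open>The expected parameter with initial value 0. Its velocity is the wedge of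
    \<open>Q\<close> with the velocity of \<open>Q\<close>, because
    \<open>p t \<bullet> U t = H - c * v3 t\<close>; this is the hypothesis of
    \<open>trig_reparam\<close>.\<close>
  define e where "e t = 0 + H * c / a\<^sup>2 * t - c\<^sup>2 / a\<^sup>2 * integral {0..t} v3" for t
  have e: "bounded_primitive 0 T e (\<lambda>t. H * c / a\<^sup>2 - c\<^sup>2 / a\<^sup>2 * v3 t)"
    unfolding e_def by (rule angle_primitive[OF vm B])
  have "bounded_primitive 0 T e (\<lambda>t. rot90 (Q t) \<bullet> ((c *\<^sub>R rot90 (U t)) /\<^sub>R a))"
  proof (rule bounded_primitive_cong[THEN iffD1, OF _ _ e])
    fix t assume t: "t \<in> {0..T}"
    have "rot90 (Q t) \<bullet> ((c *\<^sub>R rot90 (U t)) /\<^sub>R a) = c / a\<^sup>2 * (p t \<bullet> U t)"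
      by (simp add: rot90_def Q_def inner_prod_def power2_eq_square divide_inverse algebra_simps)
    also have "\<dots> = H * c / a\<^sup>2 - c\<^sup>2 / a\<^sup>2 * v3 t"
      unfolding pU[OF t] by (simp add: power2_eq_square diff_divide_distrib algebra_simps)
    finally show "H * c / a\<^sup>2 - c\<^sup>2 / a\<^sup>2 * v3 t = rot90 (Q t) \<bullet> ((c *\<^sub>R rot90 (U t)) /\<^sub>R a)" by simp
  qed simp
  then obtain \<eta>0 where \<eta>0: "\<And>t. t \<in> {0..T} \<Longrightarrow> Q t = Pol.trig (\<eta>0 + (e t - e 0))"
    using Pol.trig_reparam[OF Qp gQ] by blast
  have pt: "p t = a *\<^sub>R Pol.trig (\<eta>0 + H * c / a\<^sup>2 * t - c\<^sup>2 / a\<^sup>2 * integral {0..t} v3)" if t: "t \<in> {0..T}" for t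
  proof -
    have "p t = a *\<^sub>R Q t" using A(2) by (simp add: Q_def)
    moreover have "\<eta>0 + (e t - e 0) = \<eta>0 + H * c / a\<^sup>2 * t - c\<^sup>2 / a\<^sup>2 * integral {0..t} v3"
      by (simp add: e_def)
    ultimately show ?thesis using \<eta>0[OF t] by simp
  qed
  have x1: "x1 t = integral {0..t} (\<lambda>s. fst (U s))" if "t \<in> {0..T}" for t using E that by (simp add: extremal_def)
  have x2: "x2 t = integral {0..t} (\<lambda>s. snd (U s))" if "t \<in> {0..T}" for t using E that by (simp add: extremal_def)
  have x3: "x3 t = integral {0..t} (\<lambda>s. v3 s + integral {0..s} (\<lambda>r. fst (U r)) * snd (U s))" if t: "t \<in> {0..T}" for t
  proof -
    have "x3 t = integral {0..t} (\<lambda>s. v3 s + x1 s * snd (U s))" using E t by (simp add: extremal_def)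
    also have "\<dots> = integral {0..t} (\<lambda>s. v3 s + integral {0..s} (\<lambda>r. fst (U r)) * snd (U s))"
      by (rule HK_integral_cong) (use x1 t in auto)
    finally show ?thesis .
  qed
  note cc = coordinates_to_curve3[OF A(2) c pp vint H_def pU pt]
  show ?thesis
    unfolding curve3_def Let_def H_def[symmetric]
  proof (intro exI[of _ \<eta>0] exI[of _ v3] conjI ballI)
    show "v3 measurable_on {0..T}" using vm by (simp add: measurable_on_iff_borel_measurable)
    show "v3 t \<in> argmax_on {-m..M} (\<lambda>v. a * f v + c * v)" if "t \<in> {0..T}" for t
      using mx[OF that] s[OF that] by (simp add: maximal_def)
  qed (simp_all only: x1 x2 x3 cc)
qed

section \<open>From the three families of curves back to extremals\<close>

lemma extremal_of_curve1:
  assumes "T > 0" and C: "curve1 m M T x1 x2 x3"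
  obtains p c U v3 where "extremal T x1 x2 x3 p c U v3"
proof -
  obtain c v :: real where cv: "(c = 1 \<and> v = M) \<or> (c = -1 \<and> v = - m)"
    and x3: "\<forall>t\<in>{0..T}. x3 t = v * t"
    using C unfolding curve1_def by blast
  have x12: "\<forall>t\<in>{0..T}. x1 t = 0 \<and> x2 t = 0" using C by (simp add: curve1_def)
  \<comment> \<open>For the zero form every point of \<Omega> is a maximizer, so
    \<open>\<omega> = 0\<close> is allowed and produces no planar motion; the sign of
    \<open>c\<close> selects the endpoint.\<close>
  have "maximal 0 c 0 v"
    using zero_in cv m_pos M_pos by (auto simp: maximal_def argmax_on_def intro!: bexI[of _ 0])
  moreover have "bounded_primitive 0 T (\<lambda>t. 0 :: real \<times> real) (\<lambda>t. c *\<^sub>R rot90 0)"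
  proof -
    have "rot90 0 = 0" by (simp add: rot90_def zero_prod_def)
    then show ?thesis by (auto simp: bounded_primitive_def)
  qed
  ultimately have "extremal T x1 x2 x3 (\<lambda>t. 0) c (\<lambda>t. 0) (\<lambda>t. v)"
    unfolding extremal_def using x12 x3 cv by (auto simp: zero_prod_def mult.commute)
  then show thesis by (rule that)
qed

text \<open>With \<open>c = 0\<close> the planar covector may be rescaled freely, so the constant
  boundary point \<open>Pol.trig \<eta>0\<close> of the polar set serves as covector. Membership in
  \<open>circ_set\<close> is exactly its maximum condition on \<Omega>.\<close>

lemma extremal_of_curve2:
  assumes "T > 0" and C: "curve2 \<Omega> f m M T x1 x2 x3"
  obtains p c U v3 where "extremal T x1 x2 x3 p c U v3"
proof -
  define W where "W = (SUP v\<in>{-m..M}. f v)"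
  obtain \<eta>0 \<theta> v3 where \<theta>m: "\<theta> measurable_on {0..T}" and vm: "v3 measurable_on {0..T}"
    and \<theta>: "\<And>t. t \<in> {0..T} \<Longrightarrow> \<theta> t \<in> circ_set \<Omega> \<eta>0"
    and v: "\<And>t. t \<in> {0..T} \<Longrightarrow> v3 t \<in> argmax_on {-m..M} f"
    and x: "\<And>t. t \<in> {0..T} \<Longrightarrow> x1 t = W * integral {0..t} (\<lambda>s. cos_cvx \<Omega> (\<theta> s))"
      "\<And>t. t \<in> {0..T} \<Longrightarrow> x2 t = W * integral {0..t} (\<lambda>s. sin_cvx \<Omega> (\<theta> s))"
      "\<And>t. t \<in> {0..T} \<Longrightarrow> x3 t = integral {0..t} (\<lambda>s. v3 s + W * x1 s * sin_cvx \<Omega> (\<theta> s))"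
    using C unfolding curve2_def Let_def W_def by blast
  define U where "U t = W *\<^sub>R Om.trig (\<theta> t)" for t
  define q where "q = Pol.trig \<eta>0"
  have q: "support_fun \<Omega> q = 1" by (simp add: q_def)
  have mx: "maximal q 0 (U t) (v3 t)" if t: "t \<in> {0..T}" for t
  proof -
    have "f (v3 t) = W" using argmax_on_SUP[OF v[OF t]] by (simp add: W_def)
    moreover have "q \<bullet> Om.trig (\<theta> t) = 1" using \<theta>[OF t] by (simp add: circ_set_iff q_def)
    ultimately show ?thesis
      unfolding maximal_def U_def q using v[OF t] trig_Om_in by auto
  qed
  have "U \<in> borel_measurable (lebesgue_on {0..T})"
  proof -
    have "\<theta> \<in> borel_measurable (lebesgue_on {0..T})"
      using \<theta>m by (simp add: measurable_on_iff_borel_measurable)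
    then have "(\<lambda>t. Om.trig (\<theta> t)) \<in> borel_measurable (lebesgue_on {0..T})"
      by (rule measurable_compose) (rule borel_measurable_continuous_onI[OF Om.trig_continuous])
    then show ?thesis unfolding U_def by measurable
  qed
  moreover have "v3 \<in> borel_measurable (lebesgue_on {0..T})"
    using vm by (simp add: measurable_on_iff_borel_measurable)
  moreover have "bounded_primitive 0 T (\<lambda>t. q) (\<lambda>t. 0 *\<^sub>R rot90 (U t))"
    by (auto simp: bounded_primitive_def)
  moreover have "(q, 0::real) \<noteq> 0" using q by (auto simp: zero_prod_def[where 'a = "real \<times> real"])
  moreover have "x1 t = integral {0..t} (\<lambda>s. fst (U s))" "x2 t = integral {0..t} (\<lambda>s. snd (U s))"
    "x3 t = integral {0..t} (\<lambda>s. v3 s + x1 s * snd (U s))" if t: "t \<in> {0..T}" for t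
    using x[OF t] by (simp_all add: U_def cs_Om mult_ac)
  ultimately have "extremal T x1 x2 x3 (\<lambda>t. q) 0 U v3"
    unfolding extremal_def using mx by blast
  then show thesis by (rule that)
qed

lemma extremal_of_curve3:
  assumes "T > 0" "a > 0" "c \<noteq> 0" and C: "curve3 \<Omega> f m M a c T x1 x2 x3"
  obtains p U v3 where "extremal T x1 x2 x3 p c U v3"
proof -
  define H where "H = (SUP v\<in>{-m..M}. a * f v + c * v)"
  obtain \<eta>0 v3 where vm: "v3 measurable_on {0..T}"
    and v: "\<forall>t\<in>{0..T}. v3 t \<in> argmax_on {-m..M} (\<lambda>v. a * f v + c * v)"
    and x: "\<forall>t\<in>{0..T}. let \<eta> = \<eta>0 + H * c / a\<^sup>2 * t - c\<^sup>2 / a\<^sup>2 * integral {0..t} v3 in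
           x1 t = a / c * (sin_cvx (polar \<Omega>) \<eta> - sin_cvx (polar \<Omega>) \<eta>0) \<and>
           x2 t = a / c * (- cos_cvx (polar \<Omega>) \<eta> + cos_cvx (polar \<Omega>) \<eta>0) \<and>
           x3 t = H / c * t - 1/2 * a\<^sup>2 / c\<^sup>2 * (\<eta> - \<eta>0)
                  + 1/2 * a\<^sup>2 / c\<^sup>2 * (2 * cos_cvx (polar \<Omega>) \<eta> * sin_cvx (polar \<Omega>) \<eta>0
                    - cos_cvx (polar \<Omega>) \<eta> * sin_cvx (polar \<Omega>) \<eta> - cos_cvx (polar \<Omega>) \<eta>0 * sin_cvx (polar \<Omega>) \<eta>0)"
    using C unfolding curve3_def Let_def H_def by blast
  have vm': "v3 \<in> borel_measurable (lebesgue_on {0..T})"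
    using vm by (simp add: measurable_on_iff_borel_measurable)
  have vB: "\<bar>v3 t\<bar> \<le> m + M" if "t \<in> {0..T}" for t
    using v that m_pos M_pos by (fastforce simp: argmax_on_def)
  have vint: "v3 integrable_on {0..T}" using bounded_measurable_integrable[OF vm'] vB by auto
  define e where "e t = \<eta>0 + H * c / a\<^sup>2 * t - c\<^sup>2 / a\<^sup>2 * integral {0..t} v3" for t
  have e: "bounded_primitive 0 T e (\<lambda>t. H * c / a\<^sup>2 - c\<^sup>2 / a\<^sup>2 * v3 t)"
    unfolding e_def by (rule angle_primitive[OF vm' vB])
  define p where "p t = a *\<^sub>R Pol.trig (e t)" for t
  \<comment> \<open>The planar covector follows the boundary of the polar set, and its velocity is a
    rotated subgradient. Rotating back and rescaling gives the control, with a maximizer chosen by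
    the right derivative.\<close>
  define U where "U t = f (v3 t) *\<^sub>R Pol.subgrad (Pol.iarea (e t))" for t
  have Hf: "H - c * v3 t = a * f (v3 t)" if "t \<in> {0..T}" for t
    using argmax_on_SUP[of "v3 t" "{-m..M}" "\<lambda>v. a * f v + c * v"] v that by (simp add: H_def)
  have "bounded_primitive 0 T p (\<lambda>t. a *\<^sub>R ((H * c / a\<^sup>2 - c\<^sup>2 / a\<^sup>2 * v3 t) *\<^sub>R rot90 (Pol.subgrad (Pol.iarea (e t)))))"
    unfolding p_def by (rule bounded_primitive_linear[OF Pol.bounded_primitive_trig[OF e] bounded_linear_scaleR_right])
  then have p: "bounded_primitive 0 T p (\<lambda>t. c *\<^sub>R rot90 (U t))"
  proof (rule bounded_primitive_cong[THEN iffD1, rotated 2])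
    fix t assume t: "t \<in> {0..T}"
    \<comment> \<open>Since \<open>H - c * v3 t = a * f (v3 t)\<close> by maximality of
      \<open>v3 t\<close>, the speed of the parameter produces exactly the factor
      \<open>f (v3 t)\<close> of an admissible control.\<close>
    have "a * (H * c / a\<^sup>2 - c\<^sup>2 / a\<^sup>2 * v3 t) = c / a * (H - c * v3 t)"
      using \<open>a > 0\<close> by (simp add: field_simps power2_eq_square)
    also have "\<dots> = c * f (v3 t)" unfolding Hf[OF t] using \<open>a > 0\<close> by simp
    finally show "a *\<^sub>R ((H * c / a\<^sup>2 - c\<^sup>2 / a\<^sup>2 * v3 t) *\<^sub>R rot90 (Pol.subgrad (Pol.iarea (e t)))) = c *\<^sub>R rot90 (U t)"
      by (simp add: U_def rot90_def)
  qed auto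
  have s: "support_fun \<Omega> (p t) = a" for t using \<open>a > 0\<close> by (simp add: p_def Pol.hom)
  have mx: "maximal (p t) c (U t) (v3 t)" if t: "t \<in> {0..T}" for t
  proof -
    have "p t \<bullet> Pol.subgrad (Pol.iarea (e t)) = a"
      using Pol.subgrad_trig[of "e t"] by (simp add: p_def inner_commute)
    then show ?thesis unfolding maximal_def s U_def using subgrad_in v t by blast
  qed
  have Um: "U \<in> borel_measurable (lebesgue_on {0..T})"
  proof -
    \<comment> \<open>Measurability of \<open>U\<close> is read off from its role as the derivative
      in a bounded primitive, whose integrability is already established; rotating by a right angle
      once more and dividing by \<open>- c\<close> recovers \<open>U\<close>.\<close>
    have w: "(\<lambda>t. c *\<^sub>R rot90 (U t)) \<in> borel_measurable (lebesgue_on {0..T})"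
      by (rule bounded_primitive_measurable[OF p])
    have "continuous_on UNIV (\<lambda>z. - (rot90 z /\<^sub>R c))"
      unfolding rot90_def by (intro continuous_intros)
    from measurable_compose[OF w borel_measurable_continuous_onI[OF this]]
    have "(\<lambda>t. - (rot90 (c *\<^sub>R rot90 (U t)) /\<^sub>R c)) \<in> borel_measurable (lebesgue_on {0..T})" .
    moreover have "- (rot90 (c *\<^sub>R rot90 z) /\<^sub>R c) = z" for z
      using \<open>c \<noteq> 0\<close> by (simp add: rot90_def prod_eq_iff)
    ultimately show ?thesis by simp
  qed
  have pU: "p t \<bullet> U t = H - c * v3 t" if t: "t \<in> {0..T}" for t
    using maximal_inner(2)[OF mx[OF t]] by (simp add: s H_def)
  note cc = coordinates_to_curve3[OF \<open>a > 0\<close> \<open>c \<noteq> 0\<close> p vint H_def pU p_def[unfolded e_def]]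
  have x1: "x1 t = integral {0..t} (\<lambda>s. fst (U s))" and x2: "x2 t = integral {0..t} (\<lambda>s. snd (U s))"
    and x3: "x3 t = integral {0..t} (\<lambda>s. v3 s + integral {0..s} (\<lambda>r. fst (U r)) * snd (U s))"
    if t: "t \<in> {0..T}" for t
    using x[rule_format, OF t] unfolding Let_def by (simp_all only: cc[OF _ t])
  have x3': "x3 t = integral {0..t} (\<lambda>s. v3 s + x1 s * snd (U s))" if t: "t \<in> {0..T}" for t
    unfolding x3[OF t] by (rule HK_integral_cong) (use x1 t in auto)
  have "extremal T x1 x2 x3 p c U v3"
    unfolding extremal_def using Um vm' p mx x1 x2 x3' \<open>c \<noteq> 0\<close> by (simp add: zero_prod_def)
  then show thesis by (rule that)
qed

end

theorem theorem2:
  fixes \<Omega> :: "(real \<times> real) set" and f :: "real \<Rightarrow> real" and m M :: real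
  assumes "compact \<Omega>" and "convex \<Omega>" and "0 \<in> interior \<Omega>"
    and "m > 0" and "M > 0"
    and "continuous_on {-m..M} f" and "concave_on {-m..M} f"
    and "\<forall>v \<in> {-m<..<M}. f v > 0"
  shows
    "(\<forall>T x1 x2 x3 h1 h2 h3 u1 u2 u3.
        T > 0 \<and> pmp_extremal \<Omega> f m M T x1 x2 x3 h1 h2 h3 u1 u2 u3 \<longrightarrow>
        (\<exists>A c. A \<ge> 0 \<and> A\<^sup>2 + c\<^sup>2 \<noteq> 0 \<and>
           (\<forall>t \<in> {0..T}. mink (polar \<Omega>) (h1 t, h2 t) = A \<and> h3 t = c) \<and>
           (A = 0 \<longrightarrow> curve1 m M T x1 x2 x3) \<and>
           (A \<noteq> 0 \<and> c = 0 \<longrightarrow> curve2 \<Omega> f m M T x1 x2 x3) \<and>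
           (A \<noteq> 0 \<and> c \<noteq> 0 \<longrightarrow> curve3 \<Omega> f m M A c T x1 x2 x3)))
     \<and>
     (\<forall>T x1 x2 x3.
        T > 0 \<and>
        (curve1 m M T x1 x2 x3 \<or> curve2 \<Omega> f m M T x1 x2 x3 \<or>
         (\<exists>A c. A > 0 \<and> c \<noteq> 0 \<and> curve3 \<Omega> f m M A c T x1 x2 x3)) \<longrightarrow>
        (\<exists>h1 h2 h3 u1 u2 u3. pmp_extremal \<Omega> f m M T x1 x2 x3 h1 h2 h3 u1 u2 u3))"
proof -
  interpret heisenberg_control \<Omega> f m M
    by unfold_locales (use assms in auto)
  show ?thesis
  proof ((intro conjI allI impI; elim conjE), goal_cases)
    case (1 T x1 x2 x3 h1 h2 h3 u1 u2 u3)
    note T = 1(1) and pmp = 1(2)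
    define p where "p t = (h1 t, h2 t)" for t
    define c where "c = h3 0"
    define A where "A = support_fun \<Omega> (p 0)"
    obtain U v3 where E: "extremal T x1 x2 x3 p c U v3"
      using pmp_imp_extremal[OF T pmp] unfolding p_def c_def by blast
    have A: "A \<ge> 0" unfolding A_def by (rule Pol.nonneg)
    have "(p 0, c) \<noteq> 0" using E T by (simp add: extremal_def)
    then have "A \<noteq> 0 \<or> c \<noteq> 0"
      unfolding A_def using Pol.pos[of "p 0"] by (fastforce simp: zero_prod_def)
    then have "A\<^sup>2 + c\<^sup>2 \<noteq> 0" by (simp add: sum_power2_eq_zero_iff)
    moreover have "mink (polar \<Omega>) (h1 t, h2 t) = A \<and> h3 t = c" if t: "t \<in> {0..T}" for t
    proof
      show "mink (polar \<Omega>) (h1 t, h2 t) = A"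
        using extremal_support_const[OF E t] by (simp add: mink_polar[OF comp int0] A_def p_def)
      show "h3 t = c" using pmp t unfolding pmp_extremal_def c_def by blast
    qed
    moreover have "curve1 m M T x1 x2 x3" if "A = 0"
      using extremal_curve1[OF E T] that by (simp add: A_def)
    moreover have "curve2 \<Omega> f m M T x1 x2 x3" if "A \<noteq> 0" "c = 0"
      using extremal_curve2[OF _ T] E that by (simp add: A_def)
    moreover have "curve3 \<Omega> f m M A c T x1 x2 x3" if "A \<noteq> 0" "c \<noteq> 0"
      using extremal_curve3[OF E T A_def[symmetric]] A that by simp
    ultimately show ?case
      using A by blast
  next
    case (2 T x1 x2 x3)
    note T = 2(1) and C = 2(2)
    have "\<exists>p c U v3. extremal T x1 x2 x3 p c U v3"
      using C extremal_of_curve1[OF T] extremal_of_curve2[OF T] extremal_of_curve3[OF T] by metis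
    then show ?case
      using extremal_imp_pmp[OF T] by blast
  qed
qed

end
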